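(* Let $G(A,B)$ be a cubic bipartite graph with bipartition $(A,B)$. Then $G$ has a nice pair set $(A',B')$ with $|A'|\geq 3$ and $|B'|\geq 3$. Moreover, every nice pair set $(A',B')$ of $G$ satisfies $|A'|\leq 3$ and $|B'|\leq 3$ if and only if $G\in\mathcal{T}$.
   Context: All graphs are finite, simple and connected. For a cubic bipartite graph $G(A,B)$, a pair $a\in A$, $b\in B$ is a nice pair if $G-(N_G[a]\cup N_G[b])$ has a perfect matching. A pair $(A',B')$ with $A'\subseteq A$, $B'\subseteq B$ is a nice pair set if every $a\in A'$, $b\in B'$ form a nice pair. Edge splicing: for vertex-disjoint graphs $G_1,G_2$ and edges $e_1=x_1x_2\in E(G_1)$, $e_2=y_1y_2\in E(G_2)$, $(G_1\oplus G_2)_{e_1,e_2}$ is obtained from $(G_1-e_1)\cup(G_2-e_2)$ by identifying $x_i$ with $y_i$ for $i=1,2$. $L_n$ ($n\ge1$) is the linear chain of $n$ quadrangles (ladder $P_2\times P_{n+1}$); a 22-edge is an edge with both ends of degree 2. The class $\mathcal{T}$ is defined recursively: $K_{3,3}\in\mathcal{T}$; and if $T\in\mathcal{T}$, then $(T\oplus (L_n\oplus K_{3,3})_{e_1,g})_{f,e_2}\in\mathcal{T}$, where $n\ge1$, $e_1,e_2$ are two vertex-disjoint 22-edges of $L_n$, $g\in E(K_{3,3})$ and $f\in E(T)$.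
   Formalization: In the "if and only if", only nice pair sets (A',B') with both A' and B' nonempty are considered, since (∅,B) is vacuously a nice pair set and would violate |B'| ≤ 3 for every member of T other than K_{3,3}. *)

theory Defs
  imports Main
begin

record 'a sgraph =
  verts :: "'a set"
  edges :: "'a set set"

definition simple_graph :: "'a sgraph \<Rightarrow> bool" where
  "simple_graph G \<longleftrightarrow> finite (verts G) \<and>
     (\<forall>e\<in>edges G. \<exists>u\<in>verts G. \<exists>v\<in>verts G. u \<noteq> v \<and> e = {u, v})"

definition connected_graph :: "'a sgraph \<Rightarrow> bool" where
  "connected_graph G \<longleftrightarrow> verts G \<noteq> {} \<and>
     (\<forall>u\<in>verts G. \<forall>v\<in>verts G. (\<lambda>x y. {x, y} \<in> edges G)\<^sup>*\<^sup>* u v)"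

definition nbhd :: "'a sgraph \<Rightarrow> 'a \<Rightarrow> 'a set" where
  "nbhd G v = {u. {u, v} \<in> edges G}"

definition closed_nbhd :: "'a sgraph \<Rightarrow> 'a \<Rightarrow> 'a set" where
  "closed_nbhd G v = insert v (nbhd G v)"

definition degree :: "'a sgraph \<Rightarrow> 'a \<Rightarrow> nat" where
  "degree G v = card (nbhd G v)"

definition cubic :: "'a sgraph \<Rightarrow> bool" where
  "cubic G \<longleftrightarrow> (\<forall>v\<in>verts G. degree G v = 3)"

definition bipartition :: "'a sgraph \<Rightarrow> 'a set \<Rightarrow> 'a set \<Rightarrow> bool" where
  "bipartition G A B \<longleftrightarrow> A \<inter> B = {} \<and> A \<union> B = verts G \<and>
     (\<forall>e\<in>edges G. \<exists>a\<in>A. \<exists>b\<in>B. e = {a, b})"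

definition delete_verts :: "'a sgraph \<Rightarrow> 'a set \<Rightarrow> 'a sgraph" where
  "delete_verts G X = \<lparr> verts = verts G - X, edges = {e \<in> edges G. e \<inter> X = {}} \<rparr>"

text \<open>The graph without vertices has a perfect matching, namely the empty one.\<close>

definition has_perfect_matching :: "'a sgraph \<Rightarrow> bool" where
  "has_perfect_matching G \<longleftrightarrow> (\<exists>M. M \<subseteq> edges G \<and> (\<forall>v\<in>verts G. \<exists>!e. e \<in> M \<and> v \<in> e))"

definition nice_pair :: "'a sgraph \<Rightarrow> 'a \<Rightarrow> 'a \<Rightarrow> bool" where
  "nice_pair G a b \<longleftrightarrow>
     has_perfect_matching (delete_verts G (closed_nbhd G a \<union> closed_nbhd G b))"

definition nice_pair_set ::
    "'a sgraph \<Rightarrow> 'a set \<Rightarrow> 'a set \<Rightarrow> 'a set \<Rightarrow> 'a set \<Rightarrow> bool" where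
  "nice_pair_set G A B A' B' \<longleftrightarrow>
     A' \<subseteq> A \<and> B' \<subseteq> B \<and> (\<forall>a\<in>A'. \<forall>b\<in>B'. nice_pair G a b)"

definition isomorphic :: "'a sgraph \<Rightarrow> 'b sgraph \<Rightarrow> bool" where
  "isomorphic G H \<longleftrightarrow> simple_graph G \<and> simple_graph H \<and>
     (\<exists>f. bij_betw f (verts G) (verts H) \<and> (\<lambda>e. f ` e) ` edges G = edges H)"

definition complete_bipartite :: "nat \<Rightarrow> nat \<Rightarrow> (nat + nat) sgraph" where
  "complete_bipartite m n =
     \<lparr> verts = {..<m} <+> {..<n}, edges = {{Inl i, Inr j} | i j. i < m \<and> j < n} \<rparr>"

definition path_graph :: "nat \<Rightarrow> nat sgraph" where
  "path_graph n = \<lparr> verts = {..<n}, edges = {{i, Suc i} | i. Suc i < n} \<rparr>"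

definition cartesian_product :: "'a sgraph \<Rightarrow> 'b sgraph \<Rightarrow> ('a \<times> 'b) sgraph" where
  "cartesian_product G H =
     \<lparr> verts = verts G \<times> verts H,
       edges = {{(u, v), (u, v')} | u v v'. u \<in> verts G \<and> {v, v'} \<in> edges H} \<union>
               {{(u, v), (u', v)} | u u' v. {u, u'} \<in> edges G \<and> v \<in> verts H} \<rparr>"

text \<open>The linear chain of n quadrangles.\<close>

definition ladder :: "nat \<Rightarrow> (nat \<times> nat) sgraph" where
  "ladder n = cartesian_product (path_graph 2) (path_graph (n + 1))"

definition is_22_edge :: "'a sgraph \<Rightarrow> 'a \<Rightarrow> 'a \<Rightarrow> bool" where
  "is_22_edge G u v \<longleftrightarrow> {u, v} \<in> edges G \<and> degree G u = 2 \<and> degree G v = 2"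

text \<open>
  Edge splicing of two graphs with disjoint vertex sets. The spliced edges are given as ordered
  pairs, which fixes which ends are identified; an identified vertex keeps its name in the
  first graph.
\<close>

definition splice_edges ::
    "'a sgraph \<Rightarrow> 'a \<times> 'a \<Rightarrow> 'a sgraph \<Rightarrow> 'a \<times> 'a \<Rightarrow> 'a sgraph" where
  "splice_edges G1 e1 G2 e2 =
     (case e1 of (x1, x2) \<Rightarrow> case e2 of (y1, y2) \<Rightarrow>
        let h = id(y1 := x1, y2 := x2) in
        \<lparr> verts = verts G1 \<union> h ` verts G2,
          edges = (edges G1 - {{x1, x2}}) \<union> (\<lambda>e. h ` e) ` (edges G2 - {{y1, y2}}) \<rparr>)"

text \<open>
  The recursive class, for graphs on natural numbers; any copies of the finite building blocks
  with disjoint vertex sets may be used. Every edge may be oriented either way, so both ways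
  of identifying the ends of two spliced edges are covered.
\<close>

inductive T_nat :: "nat sgraph \<Rightarrow> bool" where
  K33: "isomorphic K (complete_bipartite 3 3) \<Longrightarrow> T_nat K"
| splice: "\<lbrakk> T_nat T; n \<ge> 1;
     isomorphic L (ladder n); isomorphic K (complete_bipartite 3 3);
     verts T \<inter> verts L = {}; verts T \<inter> verts K = {}; verts L \<inter> verts K = {};
     is_22_edge L x1 x2; is_22_edge L y1 y2; {x1, x2} \<inter> {y1, y2} = {};
     {g1, g2} \<in> edges K; {f1, f2} \<in> edges T \<rbrakk>
   \<Longrightarrow> T_nat (splice_edges T (f1, f2) (splice_edges L (x1, x2) K (g1, g2)) (y1, y2))"

definition in_class_T :: "'a sgraph \<Rightarrow> bool" where
  "in_class_T G \<longleftrightarrow> (\<exists>H. T_nat H \<and> isomorphic G H)"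

end

theory Submission
  imports Defs
begin

text \<open>
  By Hall's theorem, a pair \<open>(a, b)\<close> that is not nice is separated by a set \<open>X \<subseteq> A\<close> containing \<open>a\<close>
  with at most \<open>|X| + 1\<close> neighbours, that is, by an edge cut of size three or two. If \<open>G\<close> has no cut
  of size two, a smallest such set \<open>X\<close> (over both colour classes) is nice to its whole neighbourhood,
  which yields a \<open>3 \<times> 3\<close> nice pair set, and a larger one unless \<open>G = K\<^sub>3\<^sub>,\<^sub>3\<close>. Across a cut of size two
  no pair is nice, and closing one side of it with an edge does not change the nice pairs inside.
  Hence the nice pairs of \<open>G\<close> are those of its pieces: a minimal piece must be \<open>K\<^sub>3\<^sub>,\<^sub>3\<close> if nice pair sets
  are small, the ladder next to it can be peeled off rung by rung, and the rest is smaller.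
  Conversely, in a ladder every vertex is nice only to the other end of its rung.
\<close>

section \<open>Hall's theorem and tight sets\<close>

text \<open>The \<open>+ 1\<close> in the separating condition comes from deleting the closed
  neighbourhoods: putting \<open>a\<close> into a set that violates Hall's condition adds one vertex
  but three neighbours. If \<open>card (nb X) = card X + 1\<close>, then
  \<open>3 * (card X + 1) - 3 * card X = 3\<close> edges leave \<open>X \<union> nb X\<close>. A
  vertex of \<open>nb X\<close> with a single neighbour in \<open>X\<close> can be moved across, and
  then only two edges are cut. Two-edge cuts are handled by one balance equation: a factor whose
  degrees balance on one side uses both cut edges or neither. This makes closing a side with an edge
  harmless, and a surplus of 2 in one class rules out nice pairs across. The formal obstacle is
  naming. The class splices disjoint copies over \<open>nat\<close> and renames ends at every step,
  whereas a cut graph is already glued together. The form \<open>assembled\<close> describes the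
  glued graph in place; names change only in the passage between it and \<open>splice_edges\<close>.
  For graphs in the class, what is carried through the recursion is a bound on single vertices: each
  has at most three nice partners.\<close>

lemma hall:
  fixes S :: "'a \<Rightarrow> 'b set"
  assumes "finite A" and "\<And>x. x \<in> A \<Longrightarrow> finite (S x)"
    and "\<And>X. X \<subseteq> A \<Longrightarrow> card X \<le> card (\<Union> (S ` X))"
  shows "\<exists>f. inj_on f A \<and> (\<forall>x\<in>A. f x \<in> S x)"
  using assms
proof (induction "card A" arbitrary: A S rule: less_induct)
  case less
  note fin = less.prems(1) and finS = less.prems(2) and H = less.prems(3)
  have finU: "finite (\<Union> (S ` X))" if "X \<subseteq> A" for X
    using that fin finS by (meson finite_UN finite_subset subsetD)
  show ?case
  proof (cases "\<exists>X. X \<noteq> {} \<and> X \<subset> A \<and> card (\<Union> (S ` X)) \<le> card X")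
    case True
    then obtain X where X: "X \<noteq> {}" "X \<subset> A" "card (\<Union> (S ` X)) \<le> card X" by blast
    let ?U = "\<Union> (S ` X)"
    have finX: "finite X" using X fin by (meson finite_subset psubset_imp_subset)
    have "\<exists>f. inj_on f X \<and> (\<forall>x\<in>X. f x \<in> S x)"
      using X fin finS H by (intro less.hyps) (auto intro: psubset_card_mono finX)
    then obtain f where f: "inj_on f X" "\<forall>x\<in>X. f x \<in> S x" by blast
    have "\<exists>g. inj_on g (A - X) \<and> (\<forall>x\<in>A-X. g x \<in> S x - ?U)"
    proof (rule less.hyps)
      show "card (A - X) < card A"
        using X fin by (intro psubset_card_mono) auto
      show "finite (A - X)" using fin by simp
      show "finite (S x - ?U)" if "x \<in> A - X" for x using that finS by auto
      \<comment> \<open>Hall's condition for \<open>X \<union> Y\<close>, minus the at most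
        \<open>card X\<close> elements of \<open>?U\<close>.\<close>
      show "card Y \<le> card (\<Union>x\<in>Y. S x - ?U)" if Y: "Y \<subseteq> A - X" for Y
      proof -
        have finY: "finite Y" using Y fin by (meson Diff_subset finite_subset)
        have eq: "\<Union> (S ` (X \<union> Y)) = ?U \<union> (\<Union>x\<in>Y. S x - ?U)" by auto
        have "card X + card Y = card (X \<union> Y)"
          using Y finX finY by (subst card_Un_disjoint) auto
        also have "\<dots> \<le> card (\<Union> (S ` (X \<union> Y)))"
          using Y X by (intro H) auto
        also have "\<dots> \<le> card ?U + card (\<Union>x\<in>Y. S x - ?U)"
          unfolding eq by (rule card_Un_le)
        finally show ?thesis using X by simp
      qed
    qed
    then obtain g where g: "inj_on g (A - X)" "\<forall>x\<in>A-X. g x \<in> S x - ?U" by blast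
    let ?h = "\<lambda>x. if x \<in> X then f x else g x"
    have "inj_on ?h A"
    proof (rule inj_onI)
      fix x y assume xy: "x \<in> A" "y \<in> A" "?h x = ?h y"
      show "x = y"
      proof (cases "x \<in> X"; cases "y \<in> X")
        assume "x \<in> X" "y \<in> X" with xy f show ?thesis by (auto dest: inj_onD)
      next
        assume "x \<in> X" "y \<notin> X"
        with xy f g have "f x \<in> ?U" "f x \<notin> ?U" by auto
        then show ?thesis by blast
      next
        assume "x \<notin> X" "y \<in> X"
        with xy f g have "f y \<in> ?U" "f y \<notin> ?U" by (auto dest!: bspec)
        then show ?thesis by blast
      next
        assume "x \<notin> X" "y \<notin> X" with xy g show ?thesis by (auto dest: inj_onD)
      qed
    qed
    moreover have "\<forall>x\<in>A. ?h x \<in> S x" using f g by auto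
    ultimately show ?thesis by blast
  next
    case False
    show ?thesis
    proof (cases "A = {}")
      case True then show ?thesis by simp
    next
      case ne: False
      then obtain x where x: "x \<in> A" by blast
      have "card {x} \<le> card (\<Union> (S ` {x}))" using x by (intro H) simp
      then have "S x \<noteq> {}" by auto
      then obtain y where y: "y \<in> S x" by blast
      have "\<exists>g. inj_on g (A - {x}) \<and> (\<forall>z\<in>A-{x}. g z \<in> S z - {y})"
      proof (rule less.hyps)
        show "card (A - {x}) < card A" using x fin by (intro psubset_card_mono) auto
        show "finite (A - {x})" using fin by simp
        show "finite (S z - {y})" if "z \<in> A - {x}" for z using that finS by auto
        show "card Y \<le> card (\<Union>z\<in>Y. S z - {y})" if Y: "Y \<subseteq> A - {x}" for Y
        proof (cases "Y = {}")
          case True then show ?thesis by simp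
        next
          case Yne: False
          have "Y \<subset> A" using Y x by auto
          then have "card Y < card (\<Union> (S ` Y))" using False Yne not_le by blast
          moreover have "(\<Union>z\<in>Y. S z - {y}) = \<Union> (S ` Y) - {y}" by auto
          moreover have "card (\<Union> (S ` Y)) \<le> Suc (card (\<Union> (S ` Y) - {y}))"
            using finU[of Y] Y by (cases "y \<in> \<Union> (S ` Y)") (auto simp: card_Diff_singleton)
          ultimately show ?thesis by simp
        qed
      qed
      then obtain g where g: "inj_on g (A - {x})" "\<forall>z\<in>A-{x}. g z \<in> S z - {y}" by blast
      have "inj_on (g(x := y)) A" using g by (auto simp: inj_on_def)
      moreover have "\<forall>z\<in>A. (g(x := y)) z \<in> S z" using g y by auto
      ultimately show ?thesis by blast
    qed
  qed
qed

section \<open>Edge counting in cubic bipartite graphs\<close>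

lemma nbhd_sym: "u \<in> nbhd G v \<longleftrightarrow> v \<in> nbhd G u"
  by (simp add: nbhd_def insert_commute)

lemma double_count:
  assumes "finite P" "finite Q"
  shows "(\<Sum>x\<in>P. card {u\<in>Q. {u, x} \<in> F}) = (\<Sum>y\<in>Q. card {u\<in>P. {u, y} \<in> F})"
proof -
  have *: "card {u\<in>Q. {u, x} \<in> F} = (\<Sum>u\<in>Q. if {u, x} \<in> F then 1 else 0)"
    if "finite Q" for x and Q :: "'a set"
    using that by (simp add: sum.If_cases Int_def)
  have "(\<Sum>x\<in>P. card {u\<in>Q. {u, x} \<in> F}) = (\<Sum>x\<in>P. \<Sum>u\<in>Q. if {u, x} \<in> F then 1 else 0)"
    using *[OF assms(2)] by simp
  also have "\<dots> = (\<Sum>u\<in>Q. \<Sum>x\<in>P. if {u, x} \<in> F then 1 else 0)" by (rule sum.swap)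
  also have "\<dots> = (\<Sum>y\<in>Q. card {u\<in>P. {u, y} \<in> F})"
    using *[OF assms(1)] by (simp add: insert_commute)
  finally show ?thesis .
qed

locale cubic_bipartite =
  fixes G :: "'a sgraph" and A B :: "'a set"
  assumes simple: "simple_graph G" and cubic: "cubic G" and bip: "bipartition G A B"
begin

lemma swap: "cubic_bipartite G B A"
proof
  have "\<exists>a\<in>B. \<exists>b\<in>A. e = {a, b}" if "e \<in> edges G" for e
  proof -
    obtain a b where "a \<in> A" "b \<in> B" "e = {a, b}"
      using \<open>e \<in> edges G\<close> bip by (auto simp: bipartition_def)
    then have "b \<in> B" "a \<in> A" "e = {b, a}" by auto
    then show ?thesis by blast
  qed
  then show "bipartition G B A"
    using bip unfolding bipartition_def by (metis Int_commute Un_commute)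
qed (fact simple cubic)+

lemma finite_verts: "finite (verts G)" using simple by (simp add: simple_graph_def)
lemma verts_eq: "verts G = A \<union> B" using bip by (auto simp: bipartition_def)
lemma finite_A: "finite A" and finite_B: "finite B"
  using finite_verts verts_eq by auto
lemma disj: "A \<inter> B = {}" using bip by (auto simp: bipartition_def)

lemma edge_cases:
  assumes "{u, v} \<in> edges G"
  shows "u \<in> A \<and> v \<in> B \<or> u \<in> B \<and> v \<in> A"
proof -
  obtain a b where "a \<in> A" "b \<in> B" "{u, v} = {a, b}"
    using assms bip by (auto simp: bipartition_def)
  then show ?thesis by (auto simp: doubleton_eq_iff)
qed

lemma edge_AB: "{u, v} \<in> edges G \<Longrightarrow> u \<in> A \<Longrightarrow> v \<in> B"
  using edge_cases disj by blast

lemma edge_obtain: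
  assumes "e \<in> edges G"
  obtains a b where "a \<in> A" "b \<in> B" "e = {a, b}"
  using assms bip by (auto simp: bipartition_def)

lemma nbhd_A: "v \<in> A \<Longrightarrow> nbhd G v \<subseteq> B"
  using edge_cases disj unfolding nbhd_def by blast
lemma nbhd_B: "v \<in> B \<Longrightarrow> nbhd G v \<subseteq> A"
  using edge_cases disj unfolding nbhd_def by blast
lemma card_nbhd: "v \<in> A \<union> B \<Longrightarrow> card (nbhd G v) = 3"
  using cubic verts_eq by (simp add: cubic_def degree_def)
lemma finite_nbhd: "v \<in> A \<union> B \<Longrightarrow> finite (nbhd G v)"
  using card_nbhd by (metis card.infinite zero_neq_numeral)

definition nb :: "'a set \<Rightarrow> 'a set" where "nb X = (\<Union>x\<in>X. nbhd G x)"

lemma nb_A: "X \<subseteq> A \<Longrightarrow> nb X \<subseteq> B" using nbhd_A by (auto simp: nb_def)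
lemma finite_nb: "X \<subseteq> A \<Longrightarrow> finite (nb X)" by (rule finite_subset[OF nb_A finite_B])
lemma finite_sub: "X \<subseteq> A \<Longrightarrow> finite X" by (rule finite_subset[OF _ finite_A])
lemma nb_iff: "b \<in> nb X \<longleftrightarrow> X \<inter> nbhd G b \<noteq> {}"
proof -
  have "b \<in> nb X \<longleftrightarrow> (\<exists>x\<in>X. x \<in> nbhd G b)" unfolding nb_def by (simp add: nbhd_sym[of b G])
  then show ?thesis by blast
qed

lemma count_edges:
  assumes "X \<subseteq> A" "Y \<subseteq> B"
  shows "(\<Sum>x\<in>X. card (nbhd G x \<inter> Y)) = (\<Sum>y\<in>Y. card (nbhd G y \<inter> X))"
proof -
  have "finite X" "finite Y" using assms finite_subset[OF _ finite_A] finite_subset[OF _ finite_B] by auto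
  from double_count[OF this, of "edges G"] show ?thesis
    by (simp add: nbhd_def Int_def conj_commute)
qed

lemma sum_card_nbhd: "X \<subseteq> A \<Longrightarrow> (\<Sum>x\<in>X. card (nbhd G x)) = 3 * card X"
  using card_nbhd by (simp add: subset_eq)

lemma sum_card_nbhd_Int_nb:
  assumes "X \<subseteq> A"
  shows "(\<Sum>y\<in>nb X. card (nbhd G y \<inter> X)) = 3 * card X"
proof -
  have "(\<Sum>x\<in>X. card (nbhd G x \<inter> nb X)) = (\<Sum>x\<in>X. card (nbhd G x))"
    by (intro sum.cong arg_cong[where f = card]) (auto simp: nb_def)
  with count_edges[OF assms nb_A[OF assms]] sum_card_nbhd[OF assms] show ?thesis by simp
qed

text \<open>\<open>3 * card X\<close> edges leave \<open>X\<close>, and each vertex of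
  \<open>nb X\<close> receives at most three of them.\<close>

lemma card_nb_ge:
  assumes "X \<subseteq> A" shows "card X \<le> card (nb X)"
proof -
  have "(\<Sum>y\<in>nb X. card (nbhd G y \<inter> X)) \<le> (\<Sum>y\<in>nb X. 3)"
  proof (rule sum_mono)
    fix y assume "y \<in> nb X"
    then have "y \<in> B" using nb_A assms by blast
    then show "card (nbhd G y \<inter> X) \<le> 3"
      using card_nbhd finite_nbhd by (metis Int_lower1 UnI2 card_mono)
  qed
  then show ?thesis using sum_card_nbhd_Int_nb[OF assms] by simp
qed

text \<open>The equality case of the count in \<open>card_nb_ge\<close>: every vertex of
  \<open>nb X\<close> must receive three edges from \<open>X\<close>.\<close>

lemma nb_closed:
  assumes "X \<subseteq> A" "card (nb X) \<le> card X" "y \<in> nb X"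
  shows "nbhd G y \<subseteq> X"
proof (rule ccontr)
  assume neg: "\<not> nbhd G y \<subseteq> X"
  have lt: "card (nbhd G z \<inter> X) \<le> 3" "z = y \<longrightarrow> card (nbhd G z \<inter> X) < 3" if "z \<in> nb X" for z
  proof -
    have z: "z \<in> A \<union> B" using that nb_A assms by blast
    show "card (nbhd G z \<inter> X) \<le> 3"
      using card_nbhd[OF z] finite_nbhd[OF z] by (metis Int_lower1 card_mono)
    show "z = y \<longrightarrow> card (nbhd G z \<inter> X) < 3"
      using card_nbhd[OF z] psubset_card_mono[OF finite_nbhd[OF z], of "nbhd G z \<inter> X"] neg by auto
  qed
  have "(\<Sum>z\<in>nb X. card (nbhd G z \<inter> X)) < (\<Sum>z\<in>nb X. 3)"
    using lt assms finite_nb by (intro sum_strict_mono_ex1) auto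
  then show False using sum_card_nbhd_Int_nb[OF assms(1)] assms(2) by simp
qed

lemma card_A_le_B: "card A \<le> card B"
  using card_nb_ge[OF order.refl] card_mono[OF finite_B nb_A[OF order.refl]] by (rule order.trans)

end

lemma (in cubic_bipartite) card_A_eq_B: "card A = card B"
  using card_A_le_B cubic_bipartite.card_A_le_B[OF swap] by simp

section \<open>A sufficient condition for nice pairs\<close>

lemma matching_of_bij:
  assumes "bij_betw f P Q" "P \<inter> Q = {}" "v \<in> P \<union> Q"
  shows "\<exists>!e. e \<in> (\<lambda>x. {x, f x}) ` P \<and> v \<in> e"
  using assms unfolding bij_betw_def inj_on_def by (auto simp: doubleton_eq_iff)

context cubic_bipartite
begin

lemma bij_of_inj:
  assumes "finite Q" "inj_on f P" "f ` P \<subseteq> Q" "card P = card Q"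
  shows "bij_betw f P Q"
  unfolding bij_betw_def using assms card_image[OF assms(2)] by (simp add: card_subset_eq)

text \<open>Hall's theorem for what remains of \<open>A\<close>, into the neighbours outside
  \<open>nbhd G a\<close>. Adding \<open>a\<close> to a set of remaining vertices adds one vertex
  and exactly the three neighbours of \<open>a\<close>, so Hall's condition becomes a surplus of 2.
  Allowing \<open>X\<close> to meet \<open>nbhd G b\<close> in \<open>a\<close> covers adjacent
  pairs.\<close>

lemma nice_pairI:
  assumes a: "a \<in> A" and b: "b \<in> B"
    and H: "\<And>X. X \<subseteq> A \<Longrightarrow> a \<in> X \<Longrightarrow> X \<inter> nbhd G b \<subseteq> {a} \<Longrightarrow> card X + 2 \<le> card (nb X)"
  shows "nice_pair G a b"
proof -
  define P where "P = A - insert a (nbhd G b)"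
  define Q where "Q = B - insert b (nbhd G a)"
  have na: "nbhd G a \<subseteq> B" "card (nbhd G a) = 3" "finite (nbhd G a)"
    using a nbhd_A card_nbhd finite_nbhd by auto
  have nb': "nbhd G b \<subseteq> A" "card (nbhd G b) = 3" "finite (nbhd G b)"
    using b nbhd_B card_nbhd finite_nbhd by auto
  have "\<exists>f. inj_on f P \<and> (\<forall>x\<in>P. f x \<in> nbhd G x - nbhd G a)"
  proof (rule hall)
    show "finite P" using finite_A by (simp add: P_def)
    show "finite (nbhd G x - nbhd G a)" if "x \<in> P" for x
      using that finite_nbhd by (auto simp: P_def)
    show "card X \<le> card (\<Union>x\<in>X. nbhd G x - nbhd G a)" if X: "X \<subseteq> P" for X
    proof -
      have XA: "X \<subseteq> A" "a \<notin> X" using X by (auto simp: P_def)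
      then have finX: "finite X" using finite_sub by blast
      have "card (insert a X) + 2 \<le> card (nb (insert a X))"
        using XA X a by (intro H) (auto simp: P_def)
      also have "nb (insert a X) = nbhd G a \<union> (\<Union>x\<in>X. nbhd G x - nbhd G a)"
        by (auto simp: nb_def)
      also have "card \<dots> \<le> 3 + card (\<Union>x\<in>X. nbhd G x - nbhd G a)"
        using card_Un_le[of "nbhd G a"] na by metis
      finally show ?thesis using XA finX by simp
    qed
  qed
  then obtain f where f: "inj_on f P" "\<And>x. x \<in> P \<Longrightarrow> f x \<in> nbhd G x - nbhd G a" by blast
  have fPQ: "f ` P \<subseteq> Q"
    using f(2) nbhd_A nbhd_sym[of b G] by (fastforce simp: P_def Q_def)
  \<comment> \<open>Both deleted sets have the same size whether or not \<open>a\<close> and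
    \<open>b\<close> are adjacent, because adjacency is symmetric.\<close>
  have "card P = card Q"
  proof -
    have "card P = card A - card (insert a (nbhd G b))"
      unfolding P_def using a nb' by (intro card_Diff_subset) auto
    moreover have "card Q = card B - card (insert b (nbhd G a))"
      unfolding Q_def using b na by (intro card_Diff_subset) auto
    moreover have "card (insert a (nbhd G b)) = card (insert b (nbhd G a))"
      using na nb' nbhd_sym[of a G b] by (simp add: card_insert_if)
    ultimately show ?thesis using card_A_eq_B by simp
  qed
  then have bij: "bij_betw f P Q"
    using f fPQ finite_B by (intro bij_of_inj) (auto simp: Q_def)
  have dPQ: "P \<inter> Q = {}" using disj by (auto simp: P_def Q_def)
  have vs: "verts (delete_verts G (closed_nbhd G a \<union> closed_nbhd G b)) = P \<union> Q"
    using disj a b na nb' unfolding delete_verts_def closed_nbhd_def verts_eq P_def Q_def by auto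
  have "(\<lambda>x. {x, f x}) ` P \<subseteq> edges (delete_verts G (closed_nbhd G a \<union> closed_nbhd G b))"
  proof
    fix e assume "e \<in> (\<lambda>x. {x, f x}) ` P"
    then obtain x where x: "x \<in> P" "e = {x, f x}" by blast
    have "f x \<in> Q" using x fPQ by blast
    then have "{x, f x} \<inter> (closed_nbhd G a \<union> closed_nbhd G b) = {}"
      using x vs by (auto simp: delete_verts_def)
    moreover have "{x, f x} \<in> edges G" using f(2)[OF x(1)] by (simp add: nbhd_def insert_commute)
    ultimately show "e \<in> edges (delete_verts G (closed_nbhd G a \<union> closed_nbhd G b))"
      using x by (simp add: delete_verts_def)
  qed
  then show ?thesis
    unfolding nice_pair_def has_perfect_matching_def vs
    by (intro exI[of _ "(\<lambda>x. {x, f x}) ` P"] conjI ballI matching_of_bij[OF bij dPQ])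
qed

end

lemma nice_pair_commute: "nice_pair G a b = nice_pair G b a"
  unfolding nice_pair_def by (subst Un_commute) (rule refl)

text \<open>Unprimed ends lie in \<open>W\<close>, primed ends outside. The ends on each side are
  distinct, so each side can be closed by joining its two ends.\<close>

definition two_cut :: "'a sgraph \<Rightarrow> 'a set \<Rightarrow> 'a \<Rightarrow> 'a \<Rightarrow> 'a \<Rightarrow> 'a \<Rightarrow> bool" where
  "two_cut G W x y x' y' \<longleftrightarrow> W \<subseteq> verts G \<and> x \<in> W \<and> y \<in> W \<and> x \<noteq> y \<and>
     x' \<in> verts G - W \<and> y' \<in> verts G - W \<and> x' \<noteq> y' \<and> {x, x'} \<in> edges G \<and> {y, y'} \<in> edges G \<and>
     (\<forall>u\<in>W. \<forall>v\<in>verts G - W. {u, v} \<in> edges G \<longrightarrow> u = x \<and> v = x' \<or> u = y \<and> v = y')"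

definition no_two_cut :: "'a sgraph \<Rightarrow> bool" where
  "no_two_cut G \<longleftrightarrow> (\<nexists>W x y x' y'. two_cut G W x y x' y')"

locale connected_cubic_bipartite = cubic_bipartite +
  assumes conn: "connected_graph G"
begin

lemma swap_conn: "connected_cubic_bipartite G B A"
  using swap conn by (simp add: connected_cubic_bipartite_def connected_cubic_bipartite_axioms_def)

lemma closed_verts:
  assumes "S \<subseteq> verts G" "S \<noteq> {}" "\<And>x. x \<in> S \<Longrightarrow> nbhd G x \<subseteq> S"
  shows "S = verts G"
proof -
  obtain s where s: "s \<in> S" using assms by blast
  have "v \<in> S" if "v \<in> verts G" for v
  proof -
    have "(\<lambda>x y. {x, y} \<in> edges G)\<^sup>*\<^sup>* s v"
      using conn s that assms by (auto simp: connected_graph_def)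
    then show ?thesis
      using s assms(3) by (induction rule: rtranclp_induct) (auto simp: nbhd_def insert_commute)
  qed
  then show ?thesis using assms by blast
qed

text \<open>Without surplus, \<open>X \<union> nb X\<close> would be closed under neighbours by
  \<open>nb_closed\<close>, hence be the whole connected graph.\<close>

lemma card_nb_gt:
  assumes "X \<subseteq> A" "X \<noteq> {}" "X \<noteq> A"
  shows "card X + 1 \<le> card (nb X)"
proof (rule ccontr)
  assume "\<not> ?thesis"
  then have le: "card (nb X) \<le> card X" by simp
  have "X \<union> nb X = verts G"
  proof (rule closed_verts)
    show "X \<union> nb X \<subseteq> verts G" using assms nb_A verts_eq by auto
    show "X \<union> nb X \<noteq> {}" using assms by simp
    show "nbhd G x \<subseteq> X \<union> nb X" if "x \<in> X \<union> nb X" for x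
      using that nb_closed[OF assms(1) le] by (auto simp: nb_def)
  qed
  then show False using assms nb_A[OF assms(1)] disj verts_eq by blast
qed

text \<open>Moving \<open>b\<close> out of \<open>nb X\<close> leaves a set \<open>Y\<close> as
  large as \<open>X\<close> that receives all but one of the \<open>3 * card X\<close> edges from
  \<open>X\<close>. So exactly one edge leaves \<open>Y\<close> for the rest, and it forms with
  \<open>{a, b}\<close> the cut around \<open>X \<union> Y\<close>.\<close>

lemma two_cut_of_pendant:
  assumes X: "X \<subseteq> A" "card (nb X) \<le> card X + 1" and b: "b \<in> B" "X \<inter> nbhd G b = {a}"
  shows "\<exists>W x y x' y'. two_cut G W x y x' y'"
proof -
  have nbb: "card (nbhd G b) = 3" "finite (nbhd G b)" "nbhd G b \<subseteq> A"
    using b card_nbhd finite_nbhd nbhd_B by auto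
  have "X \<noteq> A"
  proof
    assume "X = A"
    then have "nbhd G b = {a}" using b nbb by auto
    then show False using nbb by simp
  qed
  then have card: "card (nb X) = card X + 1"
    using card_nb_gt[OF X(1) _ \<open>X \<noteq> A\<close>] X(2) b(2) by (metis Int_empty_left insert_not_empty le_antisym)
  have bX: "b \<in> nb X" using b nb_iff by simp
  define Y where "Y = nb X - {b}"
  have finY: "finite Y" and YB: "Y \<subseteq> B" using finite_nb nb_A X by (auto simp: Y_def)
  have cY: "card Y = card X" using card bX finite_nb[OF X(1)] by (simp add: Y_def)
  have ab: "b \<in> nbhd G a" "a \<in> X" using b nbhd_sym[of b G a] by blast+
  have "(\<Sum>y\<in>nb X. card (nbhd G y \<inter> X)) = card (nbhd G b \<inter> X) + (\<Sum>y\<in>Y. card (nbhd G y \<inter> X))"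
    unfolding Y_def using bX finite_nb[OF X(1)] by (rule sum.remove[rotated])
  moreover have "card (nbhd G b \<inter> X) = 1" using b by (simp add: Int_commute)
  ultimately have s1: "(\<Sum>y\<in>Y. card (nbhd G y \<inter> X)) + 1 = 3 * card X"
    using sum_card_nbhd_Int_nb[OF X(1)] by simp
  \<comment> \<open>The degrees over \<open>Y\<close> add up to \<open>3 * card X\<close>, of which
    \<open>3 * card X - 1\<close> goes into \<open>X\<close>; one edge remains.\<close>
  have "(\<Sum>y\<in>Y. card (nbhd G y \<inter> X)) + (\<Sum>y\<in>Y. card (nbhd G y - X)) = (\<Sum>y\<in>Y. 3)"
  proof (subst sum.distrib[symmetric], rule sum.cong[OF refl])
    fix y assume "y \<in> Y"
    then have "y \<in> A \<union> B" using YB by blast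
    then show "card (nbhd G y \<inter> X) + card (nbhd G y - X) = 3"
      using card_nbhd finite_nbhd card_Int_Diff by metis
  qed
  then have "(\<Sum>y\<in>Y. card (nbhd G y - X)) = Suc 0" using s1 cY by simp
  then obtain y where y: "y \<in> Y" "card (nbhd G y - X) = Suc 0"
      and y0: "\<And>z. z \<in> Y \<Longrightarrow> y \<noteq> z \<Longrightarrow> card (nbhd G z - X) = 0"
    unfolding sum_eq_Suc0_iff[OF finY] by blast
  then obtain y' where y': "nbhd G y - X = {y'}" by (auto simp: card_Suc_eq)
  have y0': "nbhd G z \<subseteq> X" if "z \<in> Y" "y \<noteq> z" for z
    using y0[OF that] finite_nbhd[of z] that YB by (metis Diff_eq_empty_iff UnI2 card_0_eq finite_Diff subsetD)
  have "nbhd G y \<subseteq> A" using y YB nbhd_B by blast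
  then have y'A: "y' \<in> A" "y' \<notin> X" using y' by blast+
  have "two_cut G (X \<union> Y) a y b y'"
    unfolding two_cut_def
  proof (intro conjI ballI impI)
    show "X \<union> Y \<subseteq> verts G" using X YB verts_eq by auto
    show "a \<in> X \<union> Y" "y \<in> X \<union> Y" using ab y by auto
    show "b \<in> verts G - (X \<union> Y)" "y' \<in> verts G - (X \<union> Y)"
      using X(1) YB disj b(1) verts_eq y'A by (auto simp: Y_def)
    show "a \<noteq> y" "b \<noteq> y'"
      using ab(2) y(1) X(1) YB disj b(1) y'A(1) by auto
    show "{a, b} \<in> edges G" using ab by (simp add: nbhd_def insert_commute)
    have "y' \<in> nbhd G y" using y' by blast
    then show "{y, y'} \<in> edges G" by (simp add: nbhd_def insert_commute)
    fix u v assume uv: "u \<in> X \<union> Y" "v \<in> verts G - (X \<union> Y)" "{u, v} \<in> edges G"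
    then have v: "v \<in> nbhd G u" "u \<in> nbhd G v" by (simp_all add: nbhd_def insert_commute)
    show "u = a \<and> v = b \<or> u = y \<and> v = y'"
    proof (cases "u \<in> X")
      case True
      then have "v \<in> nb X" using v by (auto simp: nb_def)
      then have "v = b" using uv(2) by (simp add: Y_def)
      then show ?thesis using True v(2) b(2) by blast
    next
      case False
      then have "u \<in> Y" using uv by blast
      then show ?thesis using y0' y' v uv by blast
    qed
  qed
  then show ?thesis by blast
qed

end

text \<open>\<open>X \<union> nb X\<close> is one side of a cut of three edges, all from
  \<open>nb X\<close> to \<open>A - X\<close>. The condition \<open>nb X \<noteq> B\<close> excludes
  the trivial cut whose other side is a single vertex of \<open>A\<close>.\<close>

definition (in cubic_bipartite) tight :: "'a set \<Rightarrow> bool" where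
  "tight X \<longleftrightarrow> X \<subseteq> A \<and> X \<noteq> {} \<and> card (nb X) = card X + 1 \<and> nb X \<noteq> B"

context connected_cubic_bipartite
begin

text \<open>A violator of the condition in \<open>nice_pairI\<close> can meet
  \<open>nbhd G b\<close> only in \<open>a\<close>; then \<open>b\<close> would be pendant at
  \<open>X\<close> and give a two-edge cut. So it avoids \<open>nbhd G b\<close> entirely, and
  \<open>b\<close> witnesses \<open>nb X \<noteq> B\<close>.\<close>

lemma not_nice_tight:
  assumes "no_two_cut G" "a \<in> A" "b \<in> B" "\<not> nice_pair G a b"
  obtains X where "tight X" "a \<in> X" "X \<inter> nbhd G b = {}"
proof -
  obtain X where X: "X \<subseteq> A" "a \<in> X" "X \<inter> nbhd G b \<subseteq> {a}" "card (nb X) < card X + 2"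
    using nice_pairI[OF assms(2,3)] assms(4) not_le by blast
  have dis: "X \<inter> nbhd G b = {}"
  proof (rule ccontr)
    assume "X \<inter> nbhd G b \<noteq> {}"
    then have "X \<inter> nbhd G b = {a}" using X by blast
    then show False
      using two_cut_of_pendant[OF X(1) _ assms(3)] X(4) assms(1) by (simp add: no_two_cut_def)
  qed
  have "nbhd G b \<noteq> {}" using card_nbhd[of b] assms(3) by auto
  then have "X \<noteq> A" using dis nbhd_B[OF assms(3)] by blast
  then have "card (nb X) = card X + 1" using card_nb_gt[OF X(1)] X(2,4) by fastforce
  moreover have "nb X \<noteq> B" using dis nb_iff[of b X] assms(3) by blast
  ultimately have "tight X" using X(1,2) unfolding tight_def by blast
  then show ?thesis using that X dis by blast
qed

text \<open>The same three-edge cut seen from its other side, with the colour classes exchanged.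
  Vertices outside \<open>nb X\<close> have no neighbour in \<open>X\<close>, and
  \<open>card_nb_gt\<close> in the swapped graph leaves no room for a smaller neighbourhood.\<close>

lemma tight_compl:
  assumes "tight X"
  shows "cubic_bipartite.tight G B A (B - nb X)" "nb (B - nb X) = A - X"
    "card (B - nb X) + 1 = card (A - X)"
proof -
  interpret S: connected_cubic_bipartite G B A by (rule swap_conn)
  let ?Y = "B - nb X"
  have X: "X \<subseteq> A" "X \<noteq> {}" "card (nb X) = card X + 1" "nb X \<noteq> B"
    using assms by (auto simp: tight_def)
  have nbX: "nb X \<subseteq> B" "finite (nb X)" using nb_A finite_nb X by auto
  have cX: "card (A - X) = card A - card X" using X finite_sub by (intro card_Diff_subset) auto
  have cY: "card ?Y = card B - (card X + 1)" using nbX X by (simp add: card_Diff_subset)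
  have lt: "card X + 1 < card B"
    using X(3) psubset_card_mono[OF finite_B, of "nb X"] nbX X(4) by auto
  show c: "card ?Y + 1 = card (A - X)" using cX cY lt card_A_eq_B by simp
  have sub: "nb ?Y \<subseteq> A - X"
  proof
    fix a assume a: "a \<in> nb ?Y"
    then obtain b where b: "b \<in> ?Y" "a \<in> nbhd G b" by (auto simp: nb_def)
    then have "a \<in> A" using nbhd_B by blast
    moreover have "a \<notin> X" using b nb_iff[of b X] by blast
    ultimately show "a \<in> A - X" by blast
  qed
  have nem: "?Y \<noteq> {}" "?Y \<noteq> B" using X nbX c lt cY card_A_eq_B by (metis card.empty Diff_eq_empty_iff subset_antisym, metis Diff_disjoint Int_absorb1 X(3) add_is_0 card.empty inf_commute nbX(1) zero_neq_one)
  have "card ?Y + 1 \<le> card (nb ?Y)" using S.card_nb_gt[OF _ nem] by blast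
  then show eq: "nb ?Y = A - X"
    using sub c finite_A by (metis card_seteq finite_Diff)
  show "S.tight ?Y" unfolding S.tight_def using nem eq c X by auto
qed

text \<open>
  Uncrossing: if \<open>Y\<close> separates \<open>a \<in> X\<close> from \<open>b \<in> nb X\<close>, then \<open>X \<inter> Y\<close> is a smaller tight set, or
  \<open>X \<union> Y = A\<close> and the complementary tight set \<open>B - nb Y\<close> is smaller. If \<open>card X = 2\<close>, the neighbours
  of \<open>nb X\<close> outside \<open>X\<close> have to be added.
\<close>

lemma nice_set_of_min_tight:
  assumes no: "no_two_cut G" and X: "tight X"
    and minA: "\<And>Y. tight Y \<Longrightarrow> card X \<le> card Y"
    and minB: "\<And>Y. cubic_bipartite.tight G B A Y \<Longrightarrow> card X \<le> card Y"
  shows "\<exists>A' B'. nice_pair_set G A B A' B' \<and> 3 \<le> card A' \<and> 3 \<le> card B' \<and> (4 \<le> card A' \<or> 4 \<le> card B')"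
proof -
  interpret S: connected_cubic_bipartite G B A by (rule swap_conn)
  have XA: "X \<subseteq> A" "X \<noteq> {}" "card (nb X) = card X + 1" "nb X \<noteq> B"
    using X by (auto simp: tight_def)
  have fin: "finite X" "finite (nb X)" "nb X \<subseteq> B" using XA finite_sub finite_nb nb_A by auto
  have nice: "nice_pair G a b" if a: "a \<in> X" and b: "b \<in> nb X" for a b
  proof (rule ccontr)
    assume "\<not> nice_pair G a b"
    then obtain Y where Y: "tight Y" "a \<in> Y" "Y \<inter> nbhd G b = {}"
      using not_nice_tight[OF no] a b XA fin by blast
    have YA: "Y \<subseteq> A" "card (nb Y) = card Y + 1" "nb Y \<noteq> B" using Y by (auto simp: tight_def)
    have bY: "b \<notin> nb Y" using Y nb_iff by blast
    have finY: "finite Y" "finite (nb Y)" using YA finite_sub finite_nb by auto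
    have "X \<union> Y \<noteq> A"
    proof
      assume "X \<union> Y = A"
      then have "A - Y \<subseteq> X" by blast
      then have "card (A - Y) \<le> card X" using fin card_mono by blast
      then show False using tight_compl[OF Y(1)] minB by fastforce
    qed
    then have 1: "card (X \<union> Y) + 1 \<le> card (nb (X \<union> Y))"
      using card_nb_gt[of "X \<union> Y"] XA YA by blast
    \<comment> \<open>Submodularity: \<open>X\<close> and \<open>Y\<close> together have surplus 2,
      and \<open>X \<union> Y\<close> takes at least 1 of it, so at most 1 is left for
      \<open>X \<inter> Y\<close>.\<close>
    have "card (nb (X \<union> Y)) + card (nb X \<inter> nb Y) = card (nb X) + card (nb Y)"
      using card_Un_Int[OF fin(2) finY(2)] by (simp add: nb_def Un_commute)
    moreover have "card (X \<union> Y) + card (X \<inter> Y) = card X + card Y"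
      using card_Un_Int[OF fin(1) finY(1)] by simp
    moreover have "card (nb (X \<inter> Y)) \<le> card (nb X \<inter> nb Y)"
      using finY by (intro card_mono) (auto simp: nb_def)
    ultimately have 2: "card (nb (X \<inter> Y)) \<le> card (X \<inter> Y) + 1"
      using 1 XA(3) YA(2) by linarith
    \<comment> \<open>\<open>b\<close> has a neighbour in \<open>X\<close>, hence in
      \<open>A\<close>, but none in \<open>Y\<close>.\<close>
    have "X \<inter> Y \<noteq> A"
      using bY b nb_iff[of b A] nb_iff[of b X] nb_iff[of b Y] YA XA by blast
    then have "card (X \<inter> Y) + 1 \<le> card (nb (X \<inter> Y))"
      using a Y XA by (intro card_nb_gt) auto
    moreover have "b \<notin> nb (X \<inter> Y)" using bY by (auto simp: nb_def)
    then have "nb (X \<inter> Y) \<noteq> B" using b fin by blast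
    ultimately have "tight (X \<inter> Y)"
      unfolding tight_def using 2 XA a Y(2) by auto
    then have "card X \<le> card (X \<inter> Y)" by (rule minA)
    then have "X \<inter> Y = X" using fin by (intro card_seteq) auto
    then have "nb X \<subseteq> nb Y" by (auto simp: nb_def)
    then show False using b bY by blast
  qed
  have nbsub: "nbhd G x \<subseteq> nb X" if "x \<in> X" for x using that by (auto simp: nb_def)
  obtain x where x: "x \<in> X" using XA by blast
  have "3 \<le> card (nb X)"
    using card_mono[OF fin(2) nbsub[OF x]] card_nbhd[of x] x XA by auto
  then have c2: "2 \<le> card X" using XA by simp
  show ?thesis
  proof (cases "card X = 2")
    case False
    have "nice_pair_set G A B X (nb X)" using nice XA fin by (simp add: nice_pair_set_def)
    then show ?thesis using False c2 XA(3) by (intro exI[of _ X] exI[of _ "nb X"]) auto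
  next
    case True
    then have c3: "card (nb X) = 3" using XA by simp
    have nbx: "nbhd G x = nb X" if "x \<in> X" for x
      using card_subset_eq[OF fin(2) nbsub[OF that]] card_nbhd[of x] that XA c3 by auto
    have sub: "X \<subseteq> nbhd G b" if "b \<in> nb X" for b
      using nbx nbhd_sym[of _ G b] that by blast
    have ge: "3 + 1 \<le> card (nb (nb X))"
      using S.card_nb_gt[OF fin(3)] c3 XA(4) by fastforce
    have nice2: "nice_pair G a b" if a: "a \<in> nb (nb X)" and b: "b \<in> nb X" for a b
    proof (rule ccontr)
      assume nn: "\<not> nice_pair G a b"
      then have aX: "a \<notin> X" using nice b by blast
      have aA: "a \<in> A" using a S.nb_A[OF fin(3)] by blast
      obtain b2 where b2: "b2 \<in> nb X" "a \<in> nbhd G b2" using a by (auto simp: nb_def)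
      have b2B: "b2 \<in> B" using b2 fin by blast
      \<comment> \<open>With \<open>card X = 2\<close>, the third neighbour of \<open>b2\<close> is
        \<open>a\<close>. A set separating \<open>a\<close> from \<open>b\<close> avoids
        \<open>X\<close>, which lies in \<open>nbhd G b\<close>, so it meets
        \<open>nbhd G b2\<close> in \<open>a\<close> only: \<open>b2\<close> is pendant and yields a
        two-edge cut.\<close>
      have "insert a X = nbhd G b2"
        using b2 sub[OF b2(1)] card_nbhd[of b2] finite_nbhd[of b2] b2B True aX fin
        by (intro card_subset_eq) auto
      moreover obtain Y where Y: "tight Y" "a \<in> Y" "Y \<inter> nbhd G b = {}"
        using not_nice_tight[OF no aA _ nn] b fin by blast
      ultimately have "Y \<inter> nbhd G b2 = {a}" using sub[OF b] by blast
      moreover have "Y \<subseteq> A" "card (nb Y) \<le> card Y + 1" using Y by (auto simp: tight_def)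
      ultimately show False
        using two_cut_of_pendant[OF _ _ b2B] no by (simp add: no_two_cut_def)
    qed
    have "nice_pair_set G A B (nb (nb X)) (nb X)"
      using nice2 S.nb_A[OF fin(3)] fin by (simp add: nice_pair_set_def)
    then show ?thesis using ge c3 by (intro exI[of _ "nb (nb X)"] exI[of _ "nb X"]) auto
  qed
qed

lemma card_A_ge: "3 \<le> card A"
proof -
  obtain v where v: "v \<in> A \<union> B" using conn verts_eq by (auto simp: connected_graph_def)
  show ?thesis
  proof (cases "v \<in> A")
    case True
    then show ?thesis
      using card_nbhd[of v] card_mono[OF finite_B nbhd_A[of v]] card_A_eq_B by simp
  next
    case False
    then show ?thesis
      using v card_nbhd[of v] card_mono[OF finite_A nbhd_B[of v]] by simp
  qed
qed

text \<open>If neither class has a tight set, every pair is nice and \<open>(A, B)\<close> itself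
  serves. The clause with 4 records that only \<open>card A = 3\<close>, that is K33, can escape a
  larger nice pair set.\<close>

lemma nice_set_of_no_two_cut:
  assumes no: "no_two_cut G"
  shows "\<exists>A' B'. nice_pair_set G A B A' B' \<and> 3 \<le> card A' \<and> 3 \<le> card B' \<and>
    (4 \<le> card A \<longrightarrow> 4 \<le> card A' \<or> 4 \<le> card B')"
proof -
  interpret S: connected_cubic_bipartite G B A by (rule swap_conn)
  show ?thesis
  proof (cases "\<exists>X. tight X \<or> S.tight X")
    case True
    then obtain X where X: "tight X \<or> S.tight X"
      and min: "\<And>Y. tight Y \<or> S.tight Y \<Longrightarrow> card X \<le> card Y"
      using ex_has_least_nat[of "\<lambda>X. tight X \<or> S.tight X" _ card] by blast
    show ?thesis
    proof (cases "tight X")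
      case True
      then show ?thesis using nice_set_of_min_tight[OF no] min by blast
    next
      case False
      then have "S.tight X" using X by blast
      then obtain B' A' where *: "nice_pair_set G B A B' A'" "3 \<le> card B'" "3 \<le> card A'"
        "4 \<le> card B' \<or> 4 \<le> card A'"
        using S.nice_set_of_min_tight[OF no] min by blast
      have "nice_pair_set G A B A' B'"
        using *(1) nice_pair_commute[of G] unfolding nice_pair_set_def by blast
      then show ?thesis using * by blast
    qed
  next
    case False
    then have "nice_pair_set G A B A B"
      using not_nice_tight[OF no] by (meson nice_pair_set_def order.refl)
    then show ?thesis using card_A_ge card_A_eq_B by (intro exI[of _ A] exI[of _ B]) simp
  qed
qed

end

section \<open>Cuts of size two\<close>

text \<open>
  Counting over edge subsets is insensitive to whether \<open>a\<close> and \<open>b\<close> are adjacent: together with all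
  edges at \<open>a\<close> and \<open>b\<close>, a perfect matching of the remaining graph has degree 3 at \<open>a\<close> and \<open>b\<close>, and
  degree 1 elsewhere.
\<close>

definition fdeg :: "'a set set \<Rightarrow> 'a \<Rightarrow> nat" where "fdeg F v = card {u. {u, v} \<in> F}"

context cubic_bipartite
begin

lemma fdeg_subset: "F \<subseteq> edges G \<Longrightarrow> {u. {u, v} \<in> F} \<subseteq> nbhd G v"
  by (auto simp: nbhd_def)

lemma finite_fdeg: "F \<subseteq> edges G \<Longrightarrow> v \<in> verts G \<Longrightarrow> finite {u. {u, v} \<in> F}"
  using fdeg_subset finite_nbhd verts_eq finite_subset by metis

lemma fdeg_edges: "v \<in> verts G \<Longrightarrow> fdeg (edges G) v = 3"
  using card_nbhd[of v] verts_eq by (simp add: fdeg_def nbhd_def)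

lemma fdeg_1D:
  assumes "fdeg F v = 1" "{u, v} \<in> F" "{w, v} \<in> F"
  shows "u = w"
  using assms unfolding fdeg_def card_1_singleton_iff One_nat_def by (metis mem_Collect_eq singletonD)

lemma fdeg_3D:
  assumes "F \<subseteq> edges G" "v \<in> verts G" "fdeg F v = 3" "{u, v} \<in> edges G"
  shows "{u, v} \<in> F"
proof -
  have "{u. {u, v} \<in> F} = nbhd G v"
    using assms fdeg_subset[OF assms(1)] finite_nbhd[of v] card_nbhd[of v] verts_eq
    by (intro card_subset_eq) (auto simp: fdeg_def)
  then show ?thesis using assms(4) by (auto simp: nbhd_def)
qed

lemma edge_verts: "{u, v} \<in> edges G \<Longrightarrow> u \<in> verts G \<and> v \<in> verts G"
  using edge_cases verts_eq by blast

lemma no_loop: "{u, u} \<notin> edges G"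
  using edge_cases[of u u] disj by blast

lemma edge_at:
  assumes "e \<in> edges G" "v \<in> e"
  obtains w where "e = {w, v}"
proof -
  obtain p q where e: "e = {p, q}" using edge_obtain[OF assms(1)] by metis
  then consider "v = p" | "v = q" using assms(2) by blast
  then show ?thesis
  proof cases
    case 1 then have "e = {q, v}" using e by (simp add: insert_commute)
    then show ?thesis by (rule that)
  next
    case 2 then show ?thesis using e that by simp
  qed
qed

lemma fdeg_eq_1I:
  assumes "M \<subseteq> edges G" "\<exists>!e. e \<in> M \<and> v \<in> e"
  shows "fdeg M v = 1"
proof -
  obtain e where e: "e \<in> M" "v \<in> e" and uniq: "\<And>e'. e' \<in> M \<Longrightarrow> v \<in> e' \<Longrightarrow> e' = e"
    using assms(2) by (metis (no_types, lifting))
  obtain w where w: "e = {w, v}" using edge_at e assms(1) by (metis subsetD)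
  have "u = w" if "{u, v} \<in> M" for u
  proof -
    have "{u, v} = e" using uniq[OF that] by simp
    then show ?thesis using w by (simp add: doubleton_eq_iff) blast
  qed
  then have "{u. {u, v} \<in> M} = {w}" using e(1) w by (metis (mono_tags) Collect_cong singleton_conv)
  then show ?thesis by (simp add: fdeg_def)
qed

lemma nice_pair_iff_factor:
  assumes a: "a \<in> A" and b: "b \<in> B"
  shows "nice_pair G a b \<longleftrightarrow>
    (\<exists>F\<subseteq>edges G. \<forall>v\<in>verts G. fdeg F v = (if v = a \<or> v = b then 3 else 1))"
    (is "_ \<longleftrightarrow> ?R")
proof -
  let ?U = "closed_nbhd G a \<union> closed_nbhd G b"
  let ?H = "delete_verts G ?U"
  have abV: "a \<in> verts G" "b \<in> verts G" "a \<noteq> b" using a b verts_eq disj by auto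
  show ?thesis
  proof
    assume ?R
    then obtain F where F: "F \<subseteq> edges G"
      "\<And>v. v \<in> verts G \<Longrightarrow> fdeg F v = (if v = a \<or> v = b then 3 else 1)" by auto
    define M where "M = {e \<in> F. e \<inter> ?U = {}}"
    have "M \<subseteq> edges ?H" using F by (auto simp: M_def delete_verts_def)
    moreover have "\<exists>!e. e \<in> M \<and> v \<in> e" if v: "v \<in> verts ?H" for v
    proof -
      have vV: "v \<in> verts G" "v \<notin> ?U" using v by (auto simp: delete_verts_def)
      then have vab: "v \<noteq> a" "v \<noteq> b" by (auto simp: closed_nbhd_def)
      then have d1: "fdeg F v = 1" using F vV by simp
      then obtain u where u: "{w. {w, v} \<in> F} = {u}" unfolding fdeg_def by (metis One_nat_def card_1_singleton_iff)
      then have uv: "{u, v} \<in> F" by blast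
      \<comment> \<open>A neighbour of \<open>a\<close> or \<open>b\<close> spends its only edge of
        \<open>F\<close> there, so the edge of \<open>F\<close> at \<open>v\<close> cannot lead to
        it.\<close>
      have "u \<notin> ?U"
      proof
        assume "u \<in> ?U"
        then consider "u = a \<or> u = b" | c where "c = a \<or> c = b" "u \<noteq> a" "u \<noteq> b" "u \<in> nbhd G c"
          unfolding closed_nbhd_def by blast
        then show False
        proof cases
          case 1
          then have "v \<in> ?U" using uv F(1) by (auto simp: closed_nbhd_def nbhd_def insert_commute)
          then show False using vV by blast
        next
          case 2
          have "{u, c} \<in> edges G" using 2 by (simp add: nbhd_def)
          moreover have "fdeg F c = 3" "c \<in> verts G" using 2 F(2) abV by auto
          ultimately have "{u, c} \<in> F" using fdeg_3D F(1) by blast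
          then have "{c, u} \<in> F" "{v, u} \<in> F" using uv by (simp_all add: insert_commute)
          moreover have "fdeg F u = 1" using 2 F edge_verts[of u c] \<open>{u, c} \<in> edges G\<close> by simp
          ultimately have "c = v" by (intro fdeg_1D[of F u])
          then show False using 2 vab by blast
        qed
      qed
      then have "{u, v} \<in> M \<and> v \<in> {u, v}" using uv vV by (simp add: M_def)
      moreover have "e = {u, v}" if e: "e \<in> M" "v \<in> e" for e
      proof -
        have "e \<in> F" using e by (simp add: M_def)
        then obtain w where w: "e = {w, v}" using edge_at[of e v] F(1) e(2) by (metis subsetD)
        then have "w \<in> {w. {w, v} \<in> F}" using \<open>e \<in> F\<close> by simp
        then have "w = u" using u by blast
        then show ?thesis using w by simp
      qed
      ultimately show ?thesis by (intro ex1I[of _ "{u, v}"]) blast+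
    qed
    ultimately show "nice_pair G a b"
      unfolding nice_pair_def has_perfect_matching_def by (intro exI[of _ M]) simp
  next
    assume "nice_pair G a b"
    then obtain M where M: "M \<subseteq> edges ?H" "\<And>v. v \<in> verts ?H \<Longrightarrow> \<exists>!e. e \<in> M \<and> v \<in> e"
      unfolding nice_pair_def has_perfect_matching_def by auto
    define F where "F = M \<union> {e \<in> edges G. a \<in> e \<or> b \<in> e}"
    have M': "M \<subseteq> edges G" "\<And>e. e \<in> M \<Longrightarrow> e \<inter> ?U = {}" using M(1) by (auto simp: delete_verts_def)
    have FG: "F \<subseteq> edges G" using M' by (auto simp: F_def)
    have "fdeg F v = (if v = a \<or> v = b then 3 else 1)" if v: "v \<in> verts G" for v
    proof (cases "v = a \<or> v = b")
      case True
      then have "{u. {u, v} \<in> F} = nbhd G v" using FG by (auto simp: nbhd_def F_def)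
      then show ?thesis using True card_nbhd[of v] v verts_eq by (simp add: fdeg_def)
    next
      case vab: False
      show ?thesis
      proof (cases "v \<in> ?U")
        case True
        then obtain c where c: "{c, v} \<in> edges G" "c = a \<or> c = b"
          using vab by (auto simp: closed_nbhd_def nbhd_def insert_commute)
        \<comment> \<open>\<open>a\<close> and \<open>b\<close> are in opposite classes, so
          \<open>v\<close> is adjacent to only one of them.\<close>
        have "{u. {u, v} \<in> F} = {c}"
        proof (intro equalityI subsetI)
          fix u assume "u \<in> {u. {u, v} \<in> F}"
          then have uv: "{u, v} \<in> F" by simp
          have "{u, v} \<notin> M" using M'(2)[of "{u, v}"] True by blast
          then have "u = a \<or> u = b" "{u, v} \<in> edges G" using uv vab by (auto simp: F_def)
          then show "u \<in> {c}" using c a b disj edge_cases[of u v] edge_cases[of c v] by blast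
        next
          fix u assume "u \<in> {c}"
          then show "u \<in> {u. {u, v} \<in> F}" using c by (auto simp: F_def)
        qed
        then show ?thesis using vab by (simp add: fdeg_def)
      next
        case False
        then have "v \<in> verts ?H" using v by (simp add: delete_verts_def)
        then have "fdeg M v = 1" using M(2) fdeg_eq_1I[OF M'(1)] by blast
        moreover have "{u. {u, v} \<in> F} = {u. {u, v} \<in> M}"
        proof (intro equalityI subsetI)
          fix u assume "u \<in> {u. {u, v} \<in> F}"
          then have uv: "{u, v} \<in> F" by simp
          have "{u, v} \<in> M"
          proof (rule ccontr)
            assume "{u, v} \<notin> M"
            then have "u = a \<or> u = b" "{u, v} \<in> edges G" using uv vab by (auto simp: F_def)
            then have "v \<in> ?U" by (auto simp: closed_nbhd_def nbhd_def insert_commute)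
            then show False using False by blast
          qed
          then show "u \<in> {u. {u, v} \<in> M}" by simp
        qed (simp add: F_def)
        ultimately show ?thesis using vab by (simp add: fdeg_def)
      qed
    qed
    then show ?R using FG by blast
  qed
qed

text \<open>Hall's condition must survive the loss of \<open>b\<close>. A set \<open>X\<close>
  without surplus that sees \<open>b\<close> would contain all neighbours of \<open>b\<close> by
  \<open>nb_closed\<close>, in particular \<open>a\<close>, which is already used.\<close>

lemma perfect_matching_through:
  assumes a: "a \<in> A" and ab: "{a, b} \<in> edges G"
  shows "\<exists>M\<subseteq>edges G. {a, b} \<in> M \<and> (\<forall>v\<in>verts G. fdeg M v = 1)"
proof -
  have b: "b \<in> B" using edge_AB[OF ab a] .
  have "\<exists>f. inj_on f (A - {a}) \<and> (\<forall>x\<in>A - {a}. f x \<in> nbhd G x - {b})"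
  proof (rule hall)
    show "finite (A - {a})" using finite_A by simp
    show "finite (nbhd G x - {b})" if "x \<in> A - {a}" for x using that finite_nbhd by auto
    show "card X \<le> card (\<Union>x\<in>X. nbhd G x - {b})" if X: "X \<subseteq> A - {a}" for X
    proof -
      have XA: "X \<subseteq> A" using X by blast
      have eq: "(\<Union>x\<in>X. nbhd G x - {b}) = nb X - {b}" by (auto simp: nb_def)
      show ?thesis
      proof (cases "b \<in> nb X")
        case False
        then show ?thesis using card_nb_ge[OF XA] eq by simp
      next
        case True
        have "a \<in> nbhd G b" using ab by (simp add: nbhd_def)
        then have "card X < card (nb X)" using nb_closed[OF XA _ True] X not_le by blast
        then show ?thesis using eq True finite_nb[OF XA] by (simp add: card_Diff_singleton)
      qed
    qed
  qed
  then obtain g where g: "inj_on g (A - {a})" "\<forall>x\<in>A - {a}. g x \<in> nbhd G x - {b}" by blast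
  define f where "f = g(a := b)"
  have inj: "inj_on f A" using g by (auto simp: inj_on_def f_def)
  have fn: "f x \<in> nbhd G x" if "x \<in> A" for x
    using g that ab by (auto simp: f_def nbhd_def insert_commute)
  then have "f ` A \<subseteq> B" using nbhd_A by blast
  then have bij: "bij_betw f A B" using finite_B inj card_A_eq_B by (intro bij_of_inj)
  define M where "M = (\<lambda>x. {x, f x}) ` A"
  have MG: "M \<subseteq> edges G" using fn by (auto simp: M_def nbhd_def insert_commute)
  have "{a, b} \<in> M" using a by (auto simp: M_def f_def)
  moreover have "fdeg M v = 1" if v: "v \<in> verts G" for v
  proof -
    have "\<exists>!e. e \<in> M \<and> v \<in> e" unfolding M_def
      using matching_of_bij[OF bij disj] v verts_eq by simp
    then show ?thesis by (rule fdeg_eq_1I[OF MG])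
  qed
  ultimately show ?thesis using MG by blast
qed

text \<open>A perfect matching through another edge at \<open>a\<close> will do.\<close>

lemma perfect_matching_avoiding:
  assumes a: "a \<in> A" and ab: "{a, b} \<in> edges G"
  shows "\<exists>M\<subseteq>edges G. {a, b} \<notin> M \<and> (\<forall>v\<in>verts G. fdeg M v = 1)"
proof -
  have "\<not> nbhd G a \<subseteq> {b}" using card_nbhd[of a] a card_mono[of "{b}" "nbhd G a"] by auto
  then obtain c where c: "c \<in> nbhd G a" "c \<noteq> b" by blast
  then have "{a, c} \<in> edges G" by (simp add: nbhd_def insert_commute)
  then obtain M where M: "M \<subseteq> edges G" "{a, c} \<in> M" "\<forall>v\<in>verts G. fdeg M v = 1"
    using perfect_matching_through[OF a] by blast
  have "fdeg M a = 1" using M a verts_eq by blast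
  then have "{a, b} \<notin> M" using fdeg_1D[of M a c b] M(2) c(2) by (auto simp: insert_commute)
  then show ?thesis using M by blast
qed

end

section \<open>Factors on one side of a two-edge cut\<close>

lemma two_cutD:
  assumes "two_cut G W x y x' y'"
  shows "W \<subseteq> verts G" "x \<in> W" "y \<in> W" "x \<noteq> y" "x' \<in> verts G" "x' \<notin> W" "y' \<in> verts G" "y' \<notin> W"
    "x' \<noteq> y'" "{x, x'} \<in> edges G" "{y, y'} \<in> edges G"
    "\<And>u v. u \<in> W \<Longrightarrow> v \<in> verts G \<Longrightarrow> v \<notin> W \<Longrightarrow> {u, v} \<in> edges G \<Longrightarrow> u = x \<and> v = x' \<or> u = y \<and> v = y'"
  using assms unfolding two_cut_def by blast+

lemma two_cut_swap: "two_cut G W x y x' y' \<Longrightarrow> two_cut G W y x y' x'"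
  unfolding two_cut_def by blast

lemma two_cut_compl: "two_cut G W x y x' y' \<Longrightarrow> two_cut G (verts G - W) x' y' x y"
  unfolding two_cut_def by (simp add: insert_commute double_diff) (metis insert_commute)

text \<open>One side of the splicing that a cut of size two undoes.\<close>

definition reduct :: "'a sgraph \<Rightarrow> 'a set \<Rightarrow> 'a \<Rightarrow> 'a \<Rightarrow> 'a sgraph" where
  "reduct G W x y = \<lparr> verts = W, edges = insert {x, y} {e \<in> edges G. e \<subseteq> W} \<rparr>"

lemma reduct_swap: "reduct G W y x = reduct G W x y"
  by (simp add: reduct_def insert_commute)

text \<open>Carries a factor of \<open>G\<close> over to the reduct, with \<open>{x, y}\<close>
  standing in for the two cut edges. Testing only \<open>{x, x'}\<close> is enough for balanced
  factors, which use both cut edges or neither.\<close>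

definition trim :: "'a set set \<Rightarrow> 'a set \<Rightarrow> 'a \<Rightarrow> 'a \<Rightarrow> 'a \<Rightarrow> 'a set set" where
  "trim F W x y x' = {e \<in> F. e \<subseteq> W} \<union> (if {x, x'} \<in> F then {{x, y}} else {})"

lemma sum_3_1:
  assumes "finite S" "c \<in> S"
  shows "(\<Sum>v\<in>S. if v = c then 3 else 1 :: nat) = card S + 2"
proof -
  have "(\<Sum>v\<in>S - {c}. if v = c then 3 else 1 :: nat) = (\<Sum>v\<in>S - {c}. 1)"
    by (intro sum.cong) auto
  moreover have "card S = Suc (card (S - {c}))" using assms by (rule card.remove)
  ultimately show ?thesis using sum.remove[OF assms, of "\<lambda>v. if v = c then 3 else 1 :: nat"] by simp
qed

context cubic_bipartite
begin

lemma fdeg_cut: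
  assumes c: "two_cut G W x y x' y'" and F: "F \<subseteq> edges G" and v: "v \<in> W"
  shows "fdeg F v = card {u\<in>W. {u, v} \<in> F} + of_bool (v = x \<and> {x, x'} \<in> F) + of_bool (v = y \<and> {y, y'} \<in> F)"
proof -
  note D = two_cutD[OF c]
  let ?O = "{u. u \<notin> W \<and> {u, v} \<in> F}"
  have vV: "v \<in> verts G" using v D(1) by blast
  have fin: "finite {u. {u, v} \<in> F}" using finite_fdeg[OF F vV] .
  have un: "{u. {u, v} \<in> F} = {u\<in>W. {u, v} \<in> F} \<union> ?O" by blast
  have "finite ({u\<in>W. {u, v} \<in> F} \<union> ?O)" using fin by (simp only: un)
  then have "finite {u\<in>W. {u, v} \<in> F}" "finite ?O" "{u\<in>W. {u, v} \<in> F} \<inter> ?O = {}"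
    by (simp_all only: finite_Un) blast
  then have "fdeg F v = card {u\<in>W. {u, v} \<in> F} + card ?O"
    unfolding fdeg_def un by (rule card_Un_disjoint)
  moreover have out: "v = x \<and> u = x' \<or> v = y \<and> u = y'" if "u \<in> ?O" for u
  proof -
    have "{u, v} \<in> edges G" "u \<notin> W" using that F by auto
    then have e: "{v, u} \<in> edges G" by (simp add: insert_commute)
    then show ?thesis using D(12)[OF v _ \<open>u \<notin> W\<close> e] edge_verts[OF e] by blast
  qed
  have "?O = (if v = x \<and> {x, x'} \<in> F then {x'} else if v = y \<and> {y, y'} \<in> F then {y'} else {})"
  proof (intro equalityI subsetI)
    fix u assume u: "u \<in> ?O"
    then have vu: "{v, u} \<in> F" by (simp add: insert_commute)
    consider "v = x" "u = x'" | "v = y" "u = y'" using out[OF u] by blast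
    then show "u \<in> (if v = x \<and> {x, x'} \<in> F then {x'} else if v = y \<and> {y, y'} \<in> F then {y'} else {})"
      by cases (use vu D(4) in simp_all)
  next
    fix u assume "u \<in> (if v = x \<and> {x, x'} \<in> F then {x'} else if v = y \<and> {y, y'} \<in> F then {y'} else {})"
    then have "v = x \<and> {x, x'} \<in> F \<and> u = x' \<or> v = y \<and> {y, y'} \<in> F \<and> u = y'"
      by (simp split: if_splits)
    then have "{v, u} \<in> F" "u \<notin> W" using D(6,8) by blast+
    then show "u \<in> ?O" by (simp add: insert_commute)
  qed
  then have "card ?O = of_bool (v = x \<and> {x, x'} \<in> F) + of_bool (v = y \<and> {y, y'} \<in> F)"
    using D(4) by simp
  ultimately show ?thesis by simp
qed

lemma cut_sum_A:
  assumes c: "two_cut G W x y x' y'" and F: "F \<subseteq> edges G"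
  shows "(\<Sum>v\<in>W \<inter> A. fdeg F v) = (\<Sum>v\<in>W \<inter> A. card {u\<in>W \<inter> B. {u, v} \<in> F}) +
    of_bool (x \<in> A \<and> {x, x'} \<in> F) + of_bool (y \<in> A \<and> {y, y'} \<in> F)"
proof -
  note D = two_cutD[OF c]
  have fin: "finite (W \<inter> A)" using finite_A by simp
  have one: "(\<Sum>v\<in>W \<inter> A. of_bool (v = z \<and> P)) = (of_bool (z \<in> A \<and> P) :: nat)" if "z \<in> W" for z P
  proof -
    have "(\<Sum>v\<in>W \<inter> A. of_bool (v = z \<and> P)) = (\<Sum>v\<in>W \<inter> A. if v = z then of_bool P else (0::nat))"
      by (intro sum.cong) auto
    then show ?thesis using fin that by (simp add: sum.delta)
  qed
  have "{u\<in>W. {u, v} \<in> F} = {u\<in>W \<inter> B. {u, v} \<in> F}" if "v \<in> A" for v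
    using that F edge_AB[of v] by (auto simp: insert_commute)
  then have "fdeg F v = card {u\<in>W \<inter> B. {u, v} \<in> F} + of_bool (v = x \<and> {x, x'} \<in> F) +
    of_bool (v = y \<and> {y, y'} \<in> F)" if "v \<in> W \<inter> A" for v
    using that fdeg_cut[OF c F, of v] by simp
  then show ?thesis using one[OF D(2)] one[OF D(3)] by (simp add: sum.distrib)
qed

text \<open>Edges of \<open>F\<close> inside \<open>W\<close> are counted once from either class, so
  the degree sums differ only by the cut edges. All parity facts about two-edge cuts below come from
  this balance.\<close>

lemma cut_sum:
  assumes c: "two_cut G W x y x' y'" and F: "F \<subseteq> edges G"
  shows "(\<Sum>v\<in>W \<inter> A. fdeg F v) + of_bool (x \<in> B \<and> {x, x'} \<in> F) + of_bool (y \<in> B \<and> {y, y'} \<in> F) =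
    (\<Sum>v\<in>W \<inter> B. fdeg F v) + of_bool (x \<in> A \<and> {x, x'} \<in> F) + of_bool (y \<in> A \<and> {y, y'} \<in> F)"
proof -
  have "finite (W \<inter> A)" "finite (W \<inter> B)" using finite_A finite_B by auto
  note dc = double_count[OF this, of F]
  show ?thesis
    using cut_sum_A[OF c F] cubic_bipartite.cut_sum_A[OF swap c F] dc by linarith
qed

text \<open>The balance for all edges: the degree sums are multiples of 3, so two cut edges leaving
  from the same class would give a difference of 2, which is impossible modulo 3. With one in each
  class the sums agree.\<close>

lemma cut_sides:
  assumes c: "two_cut G W x y x' y'"
  shows "x \<in> A \<and> y \<in> B \<or> x \<in> B \<and> y \<in> A" "card (W \<inter> A) = card (W \<inter> B)"
proof -
  note D = two_cutD[OF c]
  have s: "(\<Sum>v\<in>W \<inter> S. fdeg (edges G) v) = 3 * card (W \<inter> S)" for S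
    using D(1) fdeg_edges by (simp add: subset_eq)
  have xy: "x \<in> A \<longleftrightarrow> x \<notin> B" "y \<in> A \<longleftrightarrow> y \<notin> B" using D verts_eq disj by blast+
  note cs = cut_sum[OF c order.refl, unfolded s]
  show "x \<in> A \<and> y \<in> B \<or> x \<in> B \<and> y \<in> A"
  proof (rule ccontr)
    assume "\<not> ?thesis"
    then consider "x \<in> A" "y \<in> A" "x \<notin> B" "y \<notin> B" | "x \<notin> A" "y \<notin> A" "x \<in> B" "y \<in> B" using xy by blast
    then show False by cases (use cs D in \<open>simp_all, presburger+\<close>)
  qed
  then show "card (W \<inter> A) = card (W \<inter> B)" using cs D xy by auto
qed

text \<open>If both cut edges are used, \<open>x\<close> trades its neighbour \<open>x'\<close> for
  \<open>y\<close>, and \<open>y\<close> trades \<open>y'\<close> for \<open>x\<close>. As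
  \<open>{x, y}\<close> is not an edge of \<open>G\<close>, the new neighbour is not already
  counted.\<close>

lemma fdeg_trim:
  assumes c: "two_cut G W x y x' y'" and xy: "{x, y} \<notin> edges G" and F: "F \<subseteq> edges G"
    and eq: "{x, x'} \<in> F \<longleftrightarrow> {y, y'} \<in> F" and v: "v \<in> W"
  shows "fdeg (trim F W x y x') v = fdeg F v"
proof -
  note D = two_cutD[OF c]
  let ?I = "{u\<in>W. {u, v} \<in> F}"
  let ?J = "if {x, x'} \<in> F \<and> v = x then {y} else if {x, x'} \<in> F \<and> v = y then {x} else {}"
  have "{u. {u, v} \<in> trim F W x y x'} = ?I \<union> ?J"
  proof (intro set_eqI)
    fix u
    have "{u, v} = {x, y} \<longleftrightarrow> u = x \<and> v = y \<or> u = y \<and> v = x" by (rule doubleton_eq_iff)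
    then show "u \<in> {u. {u, v} \<in> trim F W x y x'} \<longleftrightarrow> u \<in> ?I \<union> ?J"
      using v D(4) by (simp add: trim_def) blast
  qed
  moreover have "finite ?I" using finite_verts D(1) by (metis finite_Collect_conjI Collect_mem_eq finite_subset)
  moreover have "?I \<inter> ?J = {}" using xy F by (auto simp: insert_commute)
  ultimately have "fdeg (trim F W x y x') v = card ?I + card ?J"
    unfolding fdeg_def by (simp add: card_Un_disjoint)
  moreover have "card ?J = of_bool (v = x \<and> {x, x'} \<in> F) + of_bool (v = y \<and> {y, y'} \<in> F)"
    using eq D(4) by (cases "v = x"; cases "v = y"; cases "{y, y'} \<in> F") simp_all
  ultimately show ?thesis using fdeg_cut[OF c F v] by linarith
qed

lemma edges_reduct: "{x, x'} \<in> edges G \<Longrightarrow> edges (reduct G W x y) = trim (edges G) W x y x'"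
  by (simp add: reduct_def trim_def)

lemma reduct_cubic_bipartite:
  assumes c: "two_cut G W x y x' y'" and xy: "{x, y} \<notin> edges G"
  shows "cubic_bipartite (reduct G W x y) (W \<inter> A) (W \<inter> B)"
proof
  note D = two_cutD[OF c]
  have fin: "finite W" using finite_verts D(1) finite_subset by blast
  have e: "\<exists>a\<in>W \<inter> A. \<exists>b\<in>W \<inter> B. e = {a, b}" if "e \<in> edges (reduct G W x y)" for e
  proof (cases "e = {x, y}")
    case True
    then show ?thesis using cut_sides(1)[OF c] D(2,3) by (metis IntI insert_commute)
  next
    case False
    then have "e \<in> edges G" "e \<subseteq> W" using that by (auto simp: reduct_def)
    then show ?thesis by (elim edge_obtain) auto
  qed
  show "simple_graph (reduct G W x y)"
    unfolding simple_graph_def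
  proof (intro conjI ballI)
    show "finite (verts (reduct G W x y))" using fin by (simp add: reduct_def)
    fix e assume "e \<in> edges (reduct G W x y)"
    then obtain a b where "a \<in> W \<inter> A" "b \<in> W \<inter> B" "e = {a, b}" using e by blast
    then show "\<exists>u\<in>verts (reduct G W x y). \<exists>v\<in>verts (reduct G W x y). u \<noteq> v \<and> e = {u, v}"
      using disj by (intro bexI[of _ a] bexI[of _ b]) (auto simp: reduct_def)
  qed
  show "cubic (reduct G W x y)"
    unfolding cubic_def
  proof
    fix v assume "v \<in> verts (reduct G W x y)"
    then have v: "v \<in> W" by (simp add: reduct_def)
    have "degree (reduct G W x y) v = fdeg (edges (reduct G W x y)) v"
      by (simp add: degree_def nbhd_def fdeg_def)
    also have "\<dots> = fdeg (edges G) v"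
      using fdeg_trim[OF c xy order.refl _ v] D by (simp add: edges_reduct)
    finally show "degree (reduct G W x y) v = 3" using fdeg_edges v D(1) by auto
  qed
  show "bipartition (reduct G W x y) (W \<inter> A) (W \<inter> B)"
    unfolding bipartition_def using e D(1) verts_eq disj by (auto simp: reduct_def)
qed

text \<open>\<open>x\<close> and \<open>y\<close> lie in opposite classes, so the two cut edges
  stand on opposite sides of \<open>cut_sum\<close> and have to cancel.\<close>

lemma factor_cut_iff:
  assumes c: "two_cut G W x y x' y'" and F: "F \<subseteq> edges G"
    and s: "(\<Sum>v\<in>W \<inter> A. fdeg F v) = (\<Sum>v\<in>W \<inter> B. fdeg F v)"
  shows "{x, x'} \<in> F \<longleftrightarrow> {y, y'} \<in> F"
proof -
  have "x \<in> A \<longleftrightarrow> x \<notin> B" "y \<in> A \<longleftrightarrow> y \<notin> B" "x \<in> A \<longleftrightarrow> y \<in> B"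
    using cut_sides(1)[OF c] disj by blast+
  then show ?thesis using cut_sum[OF c F] s by (cases "x \<in> A") (simp_all add: of_bool_def split: if_splits)
qed

text \<open>A factor of \<open>G\<close> is trimmed to \<open>W\<close>. Conversely, a factor of the
  reduct is continued outside \<open>W\<close> by a perfect matching of \<open>G\<close> that uses
  the cut edges exactly if the factor uses \<open>{x, y}\<close>.\<close>

lemma nice_pair_reduct:
  assumes c: "two_cut G W x y x' y'" and xy: "{x, y} \<notin> edges G"
    and a: "a \<in> W \<inter> A" and b: "b \<in> W \<inter> B"
  shows "nice_pair (reduct G W x y) a b \<longleftrightarrow> nice_pair G a b"
proof -
  note D = two_cutD[OF c]
  let ?H = "reduct G W x y"
  let ?d = "\<lambda>v. if v = a \<or> v = b then 3 else 1 :: nat"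
  interpret H: cubic_bipartite ?H "W \<inter> A" "W \<inter> B" by (rule reduct_cubic_bipartite[OF c xy])
  have fin: "finite (W \<inter> A)" "finite (W \<inter> B)" using finite_A finite_B by auto
  \<comment> \<open>Both vertices of degree 3 lie in \<open>W\<close>, one in each class, so their
    surpluses cancel.\<close>
  have dS: "(\<Sum>v\<in>W \<inter> A. ?d v) = (\<Sum>v\<in>W \<inter> B. ?d v)"
  proof -
    have "(\<Sum>v\<in>W \<inter> A. ?d v) = (\<Sum>v\<in>W \<inter> A. if v = a then 3 else 1)"
      using b disj by (intro sum.cong) auto
    moreover have "(\<Sum>v\<in>W \<inter> B. ?d v) = (\<Sum>v\<in>W \<inter> B. if v = b then 3 else 1)"
      using a disj by (intro sum.cong) auto
    ultimately show ?thesis using sum_3_1[OF fin(1) a] sum_3_1[OF fin(2) b] cut_sides(2)[OF c] by simp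
  qed
  have vH: "verts ?H = W" by (simp add: reduct_def)
  show ?thesis
  proof
    assume "nice_pair G a b"
    then obtain F where F: "F \<subseteq> edges G" "\<And>v. v \<in> verts G \<Longrightarrow> fdeg F v = ?d v"
      using nice_pair_iff_factor[of a b] a b by auto
    have "(\<Sum>v\<in>W \<inter> S. fdeg F v) = (\<Sum>v\<in>W \<inter> S. ?d v)" for S
      using F(2) D(1) by (intro sum.cong) auto
    then have eq: "{x, x'} \<in> F \<longleftrightarrow> {y, y'} \<in> F" using factor_cut_iff[OF c F(1)] dS by simp
    have "trim F W x y x' \<subseteq> edges ?H" using F(1) by (auto simp: trim_def reduct_def)
    moreover have "fdeg (trim F W x y x') v = ?d v" if "v \<in> verts ?H" for v
      using fdeg_trim[OF c xy F(1) eq] F(2) D(1) that vH by auto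
    ultimately show "nice_pair ?H a b" using H.nice_pair_iff_factor[OF a b] by blast
  next
    assume "nice_pair ?H a b"
    then obtain K where K: "K \<subseteq> edges ?H" "\<And>v. v \<in> W \<Longrightarrow> fdeg K v = ?d v"
      using H.nice_pair_iff_factor[OF a b] vH by auto
    have "\<exists>M\<subseteq>edges G. ({x, x'} \<in> M \<longleftrightarrow> {x, y} \<in> K) \<and> (\<forall>v\<in>verts G. fdeg M v = 1)"
    proof (cases "x \<in> A")
      case True
      then show ?thesis
        using perfect_matching_through[OF True D(10)] perfect_matching_avoiding[OF True D(10)] by metis
    next
      case False
      then have xB: "x \<in> B" using D verts_eq by blast
      then show ?thesis
        using cubic_bipartite.perfect_matching_through[OF swap xB D(10)]
          cubic_bipartite.perfect_matching_avoiding[OF swap xB D(10)] by metis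
    qed
    then obtain M where M: "M \<subseteq> edges G" "{x, x'} \<in> M \<longleftrightarrow> {x, y} \<in> K" "\<forall>v\<in>verts G. fdeg M v = 1"
      by blast
    have "(\<Sum>v\<in>W \<inter> S. fdeg M v) = card (W \<inter> S)" for S
    proof -
      have "(\<Sum>v\<in>W \<inter> S. fdeg M v) = (\<Sum>v\<in>W \<inter> S. 1)" using M(3) D(1) by (intro sum.cong) auto
      then show ?thesis by simp
    qed
    then have eqM: "{x, x'} \<in> M \<longleftrightarrow> {y, y'} \<in> M"
      using factor_cut_iff[OF c M(1)] cut_sides(2)[OF c] by simp
    \<comment> \<open>Inside \<open>W\<close> the factor \<open>K\<close> is followed; on the cut
      and beyond it, the matching \<open>M\<close>.\<close>
    define F where "F = (K - {{x, y}}) \<union> {e \<in> M. \<not> e \<subseteq> W}"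
    have KW: "e \<in> edges G \<and> e \<subseteq> W" if "e \<in> K - {{x, y}}" for e
      using that K(1) by (auto simp: reduct_def)
    have FG: "F \<subseteq> edges G" using KW M(1) by (auto simp: F_def)
    have xF: "{x, x'} \<in> F \<longleftrightarrow> {x, x'} \<in> M" "{y, y'} \<in> F \<longleftrightarrow> {y, y'} \<in> M"
      using D(6,8) KW by (auto simp: F_def)
    have "trim F W x y x' = K"
    proof -
      have "{e \<in> F. e \<subseteq> W} = K - {{x, y}}" using KW by (auto simp: F_def)
      then show ?thesis using xF M(2) by (auto simp: trim_def)
    qed
    then have "fdeg F v = ?d v" if "v \<in> W" for v
      using fdeg_trim[OF c xy FG _ that] xF eqM K(2)[OF that] by simp
    moreover have "fdeg F v = ?d v" if v: "v \<in> verts G" "v \<notin> W" for v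
    proof -
      have "{u. {u, v} \<in> F} = {u. {u, v} \<in> M}" using v(2) KW by (auto simp: F_def)
      then have "fdeg F v = fdeg M v" by (simp add: fdeg_def)
      then show ?thesis using M(3) v a b by auto
    qed
    ultimately show "nice_pair G a b"
      using nice_pair_iff_factor[of a b] a b FG by blast
  qed
qed

text \<open>The degree 3 at \<open>a\<close> gives \<open>W \<inter> A\<close> a surplus of 2 that
  nothing in \<open>W \<inter> B\<close> balances, while only one cut edge starts in
  \<open>A\<close>.\<close>

lemma not_nice_pair_cross:
  assumes c: "two_cut G W x y x' y'" and a: "a \<in> W \<inter> A" and b: "b \<in> B - W"
  shows "\<not> nice_pair G a b"
proof
  note D = two_cutD[OF c]
  assume "nice_pair G a b"
  then obtain F where F: "F \<subseteq> edges G"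
    "\<And>v. v \<in> verts G \<Longrightarrow> fdeg F v = (if v = a \<or> v = b then 3 else 1)"
    using nice_pair_iff_factor[of a b] a b by auto
  have "(\<Sum>v\<in>W \<inter> A. fdeg F v) = (\<Sum>v\<in>W \<inter> A. if v = a then 3 else 1)"
    using F(2) D(1) b disj by (intro sum.cong) auto
  then have "(\<Sum>v\<in>W \<inter> A. fdeg F v) = card (W \<inter> A) + 2"
    using sum_3_1[of "W \<inter> A" a] finite_A a by simp
  moreover have "(\<Sum>v\<in>W \<inter> B. fdeg F v) = (\<Sum>v\<in>W \<inter> B. 1)"
  proof (rule sum.cong[OF refl])
    fix v assume "v \<in> W \<inter> B"
    then have "v \<in> verts G" "v \<noteq> a" "v \<noteq> b" using D(1) a b disj by blast+
    then show "fdeg F v = 1" using F(2) by simp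
  qed
  ultimately show False
    using cut_sum[OF c F(1)] cut_sides[OF c] disj by (auto simp: of_bool_def disjoint_iff split: if_splits)
qed

text \<open>Besides each other and their ends outside, \<open>x\<close> and \<open>y\<close> have
  one further neighbour each, inside \<open>W\<close>. Removing the rung \<open>{x, y}\<close> moves
  the cut to these two edges.\<close>

lemma peel_two_cut:
  assumes c: "two_cut G W x y x' y'" and xy: "{x, y} \<in> edges G"
  shows "\<exists>x2 y2. two_cut G (W - {x, y}) x2 y2 x y"
proof -
  have third: "\<exists>z. z \<in> W - {x, y} \<and> nbhd G x = {x', y, z}" if c: "two_cut G W x y x' y'" and xy: "{x, y} \<in> edges G" for x y x' y'
  proof -
    note D = two_cutD[OF c]
    have x: "card (nbhd G x) = 3" "finite (nbhd G x)" using card_nbhd[of x] finite_nbhd[of x] D(1,2) verts_eq by auto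
    have sub: "{x', y} \<subseteq> nbhd G x" using D(10) xy by (simp add: nbhd_def insert_commute)
    have "x' \<noteq> y" using D(3,6) by blast
    then have "card (nbhd G x - {x', y}) = 1" using sub x by (simp add: card_Diff_subset)
    then obtain z where z: "nbhd G x - {x', y} = {z}" by (auto simp: card_1_singleton_iff)
    have z': "z \<in> nbhd G x" "z \<noteq> x'" "z \<noteq> y" using z by blast+
    then have zx: "{x, z} \<in> edges G" by (simp add: nbhd_def insert_commute)
    have "z \<in> W" using D(12)[OF D(2) _ _ zx] z' D(4) edge_verts[OF zx] by blast
    moreover have "z \<noteq> x" using zx no_loop by metis
    moreover have "nbhd G x = {x', y, z}" using z sub by blast
    ultimately show ?thesis using z' by blast
  qed
  note D = two_cutD[OF c]
  obtain x2 where x2: "x2 \<in> W - {x, y}" "nbhd G x = {x', y, x2}" using third[OF c xy] by blast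
  have yx: "{y, x} \<in> edges G" using xy by (simp add: insert_commute)
  obtain y2 where y2: "y2 \<in> W - {y, x}" "nbhd G y = {y', x, y2}"
    using third[OF two_cut_swap[OF c] yx] by blast
  have ex: "{x2, x} \<in> edges G" "{y2, y} \<in> edges G"
    using x2(2) y2(2) unfolding nbhd_def by blast+
  \<comment> \<open>They are adjacent to vertices of opposite classes.\<close>
  have "x2 \<noteq> y2" using edge_cases[OF ex(1)] edge_cases[OF ex(2)] cut_sides(1)[OF c] disj by blast
  moreover have "u = x2 \<and> v = x \<or> u = y2 \<and> v = y"
    if uv: "u \<in> W - {x, y}" "v \<in> verts G - (W - {x, y})" "{u, v} \<in> edges G" for u v
  proof (cases "v \<in> W")
    case False
    then show ?thesis using D(12)[of u v] uv by blast
  next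
    case True
    then consider "v = x" | "v = y" using uv by blast
    then show ?thesis
    proof cases
      case 1
      then have "u \<in> nbhd G x" using uv by (simp add: nbhd_def)
      then show ?thesis using 1 x2 uv D(6) by auto
    next
      case 2
      then have "u \<in> nbhd G y" using uv by (simp add: nbhd_def)
      then show ?thesis using 2 y2 uv D(8) by auto
    qed
  qed
  ultimately have "two_cut G (W - {x, y}) x2 y2 x y"
    unfolding two_cut_def using ex x2(1) y2(1) D(1,2,3,4) by blast
  then show ?thesis by blast
qed

text \<open>By exchanging \<open>x\<close> and \<open>y\<close>, or \<open>U\<close> and its
  complement in \<open>W\<close>, it can be assumed that \<open>y \<notin> U\<close>. If also
  \<open>x \<notin> U\<close>, the same two edges cut off \<open>U\<close> in \<open>G\<close>.
  Otherwise \<open>{x, y}\<close> is one of them, and \<open>{x, x'}\<close> takes its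
  place.\<close>

lemma two_cut_of_reduct:
  assumes c: "two_cut G W x y x' y'" and xy: "{x, y} \<notin> edges G"
    and d: "two_cut (reduct G W x y) U p q p' q'"
  shows "\<exists>U' p q p' q'. U' \<subset> W \<and> two_cut G U' p q p' q'"
proof -
  have main: "\<exists>U' p q p' q'. U' \<subset> W \<and> two_cut G U' p q p' q'"
    if c: "two_cut G W x y x' y'" and xy: "{x, y} \<notin> edges G"
      and d: "two_cut (reduct G W x y) U p q p' q'" and yU: "y \<notin> U" for x y x' y' U p q p' q'
  proof -
    note D = two_cutD[OF c] and E = two_cutD[OF d]
    have vH: "verts (reduct G W x y) = W" by (simp add: reduct_def)
    have sub: "U \<subset> W" using E vH by blast
    have inG: "{u, v} \<in> edges G" if "{u, v} \<in> edges (reduct G W x y)" "{u, v} \<noteq> {x, y}" for u v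
      using that by (simp add: reduct_def)
    have inH: "{u, v} \<in> edges (reduct G W x y)" if "{u, v} \<in> edges G" "u \<in> W" "v \<in> W" for u v
      using that by (simp add: reduct_def)
    show ?thesis
    proof (cases "x \<in> U")
      case False
      have "{p, p'} \<noteq> {x, y}" "{q, q'} \<noteq> {x, y}" using False yU E(2,3) by (auto simp: doubleton_eq_iff)
      then have "{p, p'} \<in> edges G" "{q, q'} \<in> edges G" using inG E by blast+
      moreover have "u = p \<and> v = p' \<or> u = q \<and> v = q'"
        if uv: "u \<in> U" "v \<in> verts G - U" "{u, v} \<in> edges G" for u v
      proof (cases "v \<in> W")
        case True
        then show ?thesis using E(12)[of u v] inH[OF uv(3)] uv sub vH by blast
      next
        case out: False
        then have "u = x \<or> u = y" using D(12)[of u v] uv sub by blast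
        then show ?thesis using uv False yU by blast
      qed
      ultimately have "two_cut G U p q p' q'"
        unfolding two_cut_def using E(2-9) D(1) vH sub by blast
      then show ?thesis using sub by blast
    next
      case True
      have main2: "two_cut G U x q x' q'"
        if d: "two_cut (reduct G W x y) U p q p' q'" and p: "p = x" "p' = y" for p q p' q'
      proof -
        note E = two_cutD[OF d]
        have "{q, q'} \<noteq> {x, y}" using E(3,4) yU p by (metis doubleton_eq_iff)
        then have "{q, q'} \<in> edges G" using inG E(11) by blast
        moreover have "u = x \<and> v = x' \<or> u = q \<and> v = q'"
          if uv: "u \<in> U" "v \<in> verts G - U" "{u, v} \<in> edges G" for u v
        proof (cases "v \<in> W")
          case True
          then have "u = p \<and> v = p' \<or> u = q \<and> v = q'"
            using E(12)[of u v] inH[OF uv(3)] uv sub vH by blast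
          moreover have "\<not> (u = p \<and> v = p')" using uv(3) xy p by blast
          ultimately show ?thesis by blast
        next
          case out: False
          then have "u = x \<and> v = x' \<or> u = y" using D(12)[of u v] uv sub by blast
          then show ?thesis using uv yU by blast
        qed
        moreover have "x' \<notin> U" "q' \<in> verts G - U" "x' \<noteq> q'" using sub D(1,6) E(7,8) vH by blast+
        ultimately show ?thesis
          unfolding two_cut_def using True E(3,4) p D(1,5,10) sub by blast
      qed
      have "{x, y} \<in> edges (reduct G W x y)" by (simp add: reduct_def)
      then have "x = p \<and> y = p' \<or> x = q \<and> y = q'" using E(12)[of x y] True yU D(3) vH by blast
      then have "two_cut G U x q x' q' \<or> two_cut G U x p x' p'"
        using main2[OF d] main2[OF two_cut_swap[OF d]] by blast
      then show ?thesis using sub by blast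
    qed
  qed
  have vH: "verts (reduct G W x y) = W" by (simp add: reduct_def)
  consider "y \<notin> U" | "x \<notin> U" | "y \<in> U" "x \<in> U" by blast
  then show ?thesis
  proof cases
    case 1 then show ?thesis using main[OF c xy d] by blast
  next
    case 2
    then show ?thesis
      using main[OF two_cut_swap[OF c], of U p q p' q'] xy d reduct_swap[of G W x y]
      by (simp add: insert_commute)
  next
    case 3
    then show ?thesis using main[OF c xy two_cut_compl[OF d]] by (simp add: vH)
  qed
qed

end

context connected_cubic_bipartite
begin

lemma reduct_connected:
  assumes c: "two_cut G W x y x' y'" and xy: "{x, y} \<notin> edges G"
  shows "connected_cubic_bipartite (reduct G W x y) (W \<inter> A) (W \<inter> B)"
proof -
  note D = two_cutD[OF c]
  let ?H = "reduct G W x y"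
  interpret H: cubic_bipartite ?H "W \<inter> A" "W \<inter> B" by (rule reduct_cubic_bipartite[OF c xy])
  have vH: "verts ?H = W" by (simp add: reduct_def)
  let ?R = "\<lambda>u v. {u, v} \<in> edges ?H"
  \<comment> \<open>Collapsing the other side onto \<open>x\<close> turns walks of \<open>G\<close> into walks of the reduct.\<close>
  define f where "f v = (if v \<in> W then v else x)" for v
  have Rxy: "?R x y" "?R y x" by (simp_all add: reduct_def insert_commute)
  have edge_step: "?R (f u) (f v) \<or> f u = f v" if uv: "{u, v} \<in> edges G" for u v
  proof -
    have V: "u \<in> verts G" "v \<in> verts G" using edge_verts[OF uv] by auto
    have vu: "{v, u} \<in> edges G" using uv by (simp add: insert_commute)
    consider "u \<in> W" "v \<in> W" | "u \<in> W" "v \<notin> W" | "u \<notin> W" "v \<in> W" | "u \<notin> W" "v \<notin> W" by blast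
    then show ?thesis
    proof cases
      case 1 then show ?thesis using uv by (simp add: f_def reduct_def)
    next
      case 2
      then have "u = x \<or> u = y" using D(12)[OF _ V(2) _ uv] by blast
      then show ?thesis using 2 Rxy by (auto simp: f_def)
    next
      case 3
      then have "v = x \<or> v = y" using D(12)[OF _ V(1) _ vu] by blast
      then show ?thesis using 3 Rxy by (auto simp: f_def)
    next
      case 4 then show ?thesis by (simp add: f_def)
    qed
  qed
  have "?R\<^sup>*\<^sup>* u v" if "u \<in> W" "v \<in> W" for u v
  proof -
    have "(\<lambda>x y. {x, y} \<in> edges G)\<^sup>*\<^sup>* u v"
      using conn that D(1) by (auto simp: connected_graph_def)
    then have "?R\<^sup>*\<^sup>* (f u) (f v)"
    proof (induction rule: rtranclp_induct)
      case (step y z)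
      from edge_step[OF step(2)] show ?case
      proof
        assume "?R (f y) (f z)"
        with step(3) show ?case by (rule rtranclp.rtrancl_into_rtrancl)
      next
        assume "f y = f z"
        with step(3) show ?case by simp
      qed
    qed simp
    then show ?thesis using that by (simp add: f_def)
  qed
  then have "connected_graph ?H" using D(2) by (auto simp: connected_graph_def vH)
  then show ?thesis
    using H.cubic_bipartite_axioms by (simp add: connected_cubic_bipartite_def connected_cubic_bipartite_axioms_def)
qed

text \<open>A smallest side \<open>W\<close> works: if its ends were adjacent,
  \<open>peel_two_cut\<close> would give a smaller side, and a two-edge cut of its reduct would lift
  to a smaller one by \<open>two_cut_of_reduct\<close>.\<close>

lemma leaf_two_cut:
  assumes "\<not> no_two_cut G"
  obtains W x y x' y' where "two_cut G W x y x' y'" "{x, y} \<notin> edges G" "no_two_cut (reduct G W x y)"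
proof -
  obtain W where W: "\<exists>x y x' y'. two_cut G W x y x' y'"
    and min: "\<And>U. \<exists>x y x' y'. two_cut G U x y x' y' \<Longrightarrow> card W \<le> card U"
    using assms ex_has_least_nat[of "\<lambda>W. \<exists>x y x' y'. two_cut G W x y x' y'" _ card]
    unfolding no_two_cut_def by blast
  then obtain x y x' y' where c: "two_cut G W x y x' y'" by blast
  note D = two_cutD[OF c]
  have fin: "finite W" using finite_verts D(1) finite_subset by blast
  have no_less: "\<not> U \<subset> W" if "\<exists>x y x' y'. two_cut G U x y x' y'" for U
    using min[OF that] psubset_card_mono[OF fin, of U] by auto
  have xy: "{x, y} \<notin> edges G"
  proof
    assume "{x, y} \<in> edges G"
    then have "\<exists>p q p' q'. two_cut G (W - {x, y}) p q p' q'" using peel_two_cut[OF c] by blast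
    then have "\<not> W - {x, y} \<subset> W" by (rule no_less)
    then show False using D(2) by blast
  qed
  have "no_two_cut (reduct G W x y)"
    unfolding no_two_cut_def
  proof
    assume "\<exists>U p q p' q'. two_cut (reduct G W x y) U p q p' q'"
    then obtain U p q p' q' where d: "two_cut (reduct G W x y) U p q p' q'" by blast
    obtain U' where "U' \<subset> W" "\<exists>p q p' q'. two_cut G U' p q p' q'"
      using two_cut_of_reduct[OF c xy d] by (elim exE conjE) blast
    then show False using no_less[of U'] by simp
  qed
  then show ?thesis using that c xy by blast
qed

end

section \<open>Ladders and splicing\<close>

definition rename :: "('a \<Rightarrow> 'b) \<Rightarrow> 'a sgraph \<Rightarrow> 'b sgraph" where
  "rename f G = \<lparr> verts = f ` verts G, edges = (`) f ` edges G \<rparr>"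

lemma simple_edge_subset: "simple_graph G \<Longrightarrow> e \<in> edges G \<Longrightarrow> e \<subseteq> verts G"
  by (auto simp: simple_graph_def)

lemma simple_edgeD:
  assumes "simple_graph G" "{u, v} \<in> edges G"
  shows "u \<in> verts G" "v \<in> verts G" "u \<noteq> v"
  using assms by (fastforce simp: simple_graph_def doubleton_eq_iff)+

lemma simple_rename:
  assumes "simple_graph G" "inj_on f (verts G)"
  shows "simple_graph (rename f G)"
  unfolding simple_graph_def
proof (intro conjI ballI)
  show "finite (verts (rename f G))" using assms by (simp add: rename_def simple_graph_def)
  fix e assume "e \<in> edges (rename f G)"
  then obtain e' where e': "e' \<in> edges G" "e = f ` e'" by (auto simp: rename_def)
  then obtain u v where uv: "u \<in> verts G" "v \<in> verts G" "u \<noteq> v" "e' = {u, v}"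
    using assms(1) unfolding simple_graph_def by blast
  then have "f u \<noteq> f v" "e = {f u, f v}" using assms(2) e' by (auto dest: inj_onD)
  then show "\<exists>u\<in>verts (rename f G). \<exists>v\<in>verts (rename f G). u \<noteq> v \<and> e = {u, v}"
    using uv by (auto simp: rename_def)
qed

lemma isomorphic_rename:
  assumes "simple_graph G" "inj_on f (verts G)"
  shows "isomorphic G (rename f G)"
  unfolding isomorphic_def using assms simple_rename[OF assms]
  by (auto simp: rename_def bij_betw_def)

lemma isomorphicE:
  assumes "isomorphic G H"
  obtains f where "inj_on f (verts G)" "H = rename f G"
proof -
  obtain f where f: "inj_on f (verts G)" "f ` verts G = verts H" "(`) f ` edges G = edges H"
    using assms unfolding isomorphic_def bij_betw_def by blast
  then have "H = rename f G" by (cases H) (simp add: rename_def)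
  then show ?thesis using that f(1) by blast
qed

lemma rename_comp: "rename g (rename f G) = rename (g \<circ> f) G"
  by (simp add: rename_def image_image image_comp)

lemma rename_cong:
  assumes "simple_graph G" "\<And>v. v \<in> verts G \<Longrightarrow> f v = g v"
  shows "rename f G = rename g G"
proof -
  have "f ` e = g ` e" if "e \<in> edges G" for e
    using simple_edge_subset[OF assms(1) that] assms(2) by (intro image_cong) auto
  then show ?thesis using assms(2) by (simp add: rename_def)
qed

lemma rename_id: "rename (\<lambda>v. v) G = G" by (simp add: rename_def)

lemma isomorphic_sym:
  assumes "isomorphic G H" shows "isomorphic H G"
proof -
  obtain f where f: "inj_on f (verts G)" "H = rename f G" using assms by (rule isomorphicE)
  have s: "simple_graph G" "simple_graph H" using assms by (auto simp: isomorphic_def)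
  let ?g = "inv_into (verts G) f"
  have "rename ?g H = rename (\<lambda>v. v) G"
    unfolding f(2) rename_comp using f(1) by (intro rename_cong[OF s(1)]) simp
  moreover have "inj_on ?g (verts H)" unfolding f(2) by (simp add: rename_def inj_on_inv_into)
  ultimately show ?thesis using isomorphic_rename[OF s(2)] rename_id by metis
qed

lemma isomorphic_trans:
  assumes "isomorphic G H" "isomorphic H I" shows "isomorphic G I"
proof -
  obtain f where f: "inj_on f (verts G)" "H = rename f G" using assms(1) by (rule isomorphicE)
  obtain g where g: "inj_on g (verts H)" "I = rename g H" using assms(2) by (rule isomorphicE)
  have "inj_on (g \<circ> f) (verts G)" using f g by (simp add: comp_inj_on rename_def)
  then show ?thesis
    using isomorphic_rename[of G "g \<circ> f"] assms(1) f(2) g(2) by (simp add: rename_comp isomorphic_def)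
qed

definition rails :: "nat \<Rightarrow> (nat \<Rightarrow> 'a) \<Rightarrow> (nat \<Rightarrow> 'a) \<Rightarrow> 'a set set" where
  "rails n u v = (\<lambda>i. {u i, u (Suc i)}) ` {..<n} \<union> (\<lambda>i. {v i, v (Suc i)}) ` {..<n}"

text \<open>Coordinates for arbitrary copies of the ladder: a copy is given by its two rails, and
  identifying the ends of an end rung is an update of \<open>u\<close> and \<open>v\<close> at one
  index.\<close>

definition ladder_on :: "nat \<Rightarrow> (nat \<Rightarrow> 'a) \<Rightarrow> (nat \<Rightarrow> 'a) \<Rightarrow> 'a sgraph" where
  "ladder_on n u v = \<lparr> verts = u ` {..n} \<union> v ` {..n}, edges = rails n u v \<union> (\<lambda>i. {u i, v i}) ` {..n} \<rparr>"

definition distinct_rails :: "nat set \<Rightarrow> (nat \<Rightarrow> 'a) \<Rightarrow> (nat \<Rightarrow> 'a) \<Rightarrow> bool" where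
  "distinct_rails I u v \<longleftrightarrow> inj_on u I \<and> inj_on v I \<and> u ` I \<inter> v ` I = {}"

lemma distinct_railsD:
  assumes "distinct_rails I u v" "i \<in> I" "j \<in> I"
  shows "u i = u j \<longleftrightarrow> i = j" "v i = v j \<longleftrightarrow> i = j" "u i \<noteq> v j" "v j \<noteq> u i"
  using assms by (auto simp: distinct_rails_def inj_on_eq_iff)

lemma ladder_eq_ladder_on: "ladder n = ladder_on n (\<lambda>i. (0, i)) (\<lambda>i. (1, i))"
proof -
  have two: "{i. Suc i < 2} = {0}" by auto
  have v: "{..<2::nat} \<times> {..<n + 1} = Pair 0 ` {..n} \<union> Pair 1 ` {..n}"
    by (auto simp: image_iff less_Suc_eq numeral_2_eq_2)
  have e1: "{{(u, v), (u, v')} |u v v'. u < 2 \<and> {v, v'} \<in> {{i, Suc i} |i. Suc i < n + 1}}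
      = rails n (Pair 0) (Pair (1::nat))" (is "?l = ?r")
  proof (intro equalityI subsetI)
    fix e assume "e \<in> ?l"
    then obtain u v v' i where e: "e = {(u, v), (u, v')}" "u < 2" "{v, v'} = {i, Suc i}" "i < n" by auto
    then have "e = {(u, i), (u, Suc i)}" by (auto simp: doubleton_eq_iff)
    moreover have "u = 0 \<or> u = 1" using e(2) by auto
    ultimately show "e \<in> ?r" using e(4) by (auto simp: rails_def)
  next
    fix e assume "e \<in> ?r"
    then consider i where "i < n" "e = {(0, i), (0, Suc i)}" | i where "i < n" "e = {(1, i), (1, Suc i)}"
      by (auto simp: rails_def)
    then show "e \<in> ?l"
    proof cases
      case (1 i)
      then show ?thesis
        by - (rule CollectI, rule exI[of _ 0], rule exI[of _ i], rule exI[of _ "Suc i"],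
          intro conjI, simp, simp, rule CollectI, rule exI[of _ i], simp)
    next
      case (2 i)
      then show ?thesis
        by - (rule CollectI, rule exI[of _ 1], rule exI[of _ i], rule exI[of _ "Suc i"],
          intro conjI, simp, simp, rule CollectI, rule exI[of _ i], simp)
    qed
  qed
  have e2: "{{(u, v), (u', v)} |u u' v. {u, u'} \<in> {{i, Suc i} |i. Suc i < 2} \<and> v < n + 1}
      = (\<lambda>i. {(0, i), (1, i)}) ` {..n}" (is "?l = ?r")
  proof (intro equalityI subsetI)
    fix e assume "e \<in> ?l"
    then obtain u u' v i where e: "e = {(u, v), (u', v)}" "{u, u'} = {i, Suc i}" "Suc i < 2" "v < n + 1" by auto
    then have "i = 0" by simp
    then have "e = {(0, v), (1, v)}" using e by (auto simp: doubleton_eq_iff)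
    then show "e \<in> ?r" using e(4) by auto
  next
    fix e assume "e \<in> ?r"
    then obtain v where "v \<le> n" "e = {(0, v), (1, v)}" by auto
    then show "e \<in> ?l" by - (rule CollectI, rule exI[of _ 0], rule exI[of _ 1], rule exI[of _ v],
        intro conjI, simp, rule CollectI, rule exI[of _ 0], simp, simp)
  qed
  show ?thesis
    unfolding ladder_def cartesian_product_def path_graph_def ladder_on_def
    using v e1 e2 by simp
qed

lemma rename_ladder_on: "rename f (ladder_on n u v) = ladder_on n (f \<circ> u) (f \<circ> v)"
  by (simp add: rename_def ladder_on_def rails_def image_Un image_image)

lemma simple_ladder_on:
  assumes "distinct_rails {..n} u v" shows "simple_graph (ladder_on n u v)"
  unfolding simple_graph_def
proof (intro conjI ballI)
  show "finite (verts (ladder_on n u v))" by (simp add: ladder_on_def)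
  note d = distinct_railsD[OF assms]
  fix e assume "e \<in> edges (ladder_on n u v)"
  then consider i where "i < n" "e = {u i, u (Suc i)}" | i where "i < n" "e = {v i, v (Suc i)}"
    | i where "i \<le> n" "e = {u i, v i}" by (auto simp: ladder_on_def rails_def)
  then show "\<exists>a\<in>verts (ladder_on n u v). \<exists>b\<in>verts (ladder_on n u v). a \<noteq> b \<and> e = {a, b}"
  proof cases
    case 1 then show ?thesis using d(1)[of i "Suc i"]
      by (intro bexI[of _ "u i"] bexI[of _ "u (Suc i)"]) (auto simp: ladder_on_def)
  next
    case 2 then show ?thesis using d(2)[of i "Suc i"]
      by (intro bexI[of _ "v i"] bexI[of _ "v (Suc i)"]) (auto simp: ladder_on_def)
  next
    case 3 then show ?thesis using d(3)[of i i]
      by (intro bexI[of _ "u i"] bexI[of _ "v i"]) (auto simp: ladder_on_def)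
  qed
qed

lemma isomorphic_ladder_iff:
  "isomorphic L (ladder n) \<longleftrightarrow> (\<exists>u v. distinct_rails {..n} u v \<and> L = ladder_on n u v)"
proof
  assume iso: "isomorphic L (ladder n)"
  obtain f where f: "inj_on f (verts (ladder n))" "L = rename f (ladder n)"
    using isomorphic_sym[OF iso] by (rule isomorphicE)
  have "distinct_rails {..n} (f \<circ> Pair 0) (f \<circ> Pair 1)"
    using f(1) unfolding ladder_eq_ladder_on ladder_on_def distinct_rails_def inj_on_def by auto
  then show "\<exists>u v. distinct_rails {..n} u v \<and> L = ladder_on n u v"
    using f(2) unfolding ladder_eq_ladder_on rename_ladder_on by blast
next
  assume "\<exists>u v. distinct_rails {..n} u v \<and> L = ladder_on n u v"
  then obtain u v where d: "distinct_rails {..n} u v" and L: "L = ladder_on n u v" by blast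
  have s: "simple_graph (ladder n)"
    unfolding ladder_eq_ladder_on by (intro simple_ladder_on) (auto simp: distinct_rails_def inj_on_def)
  define f where "f p = (if fst p = 0 then u (snd p) else v (snd p))" for p :: "nat \<times> nat"
  have "L = rename f (ladder n)"
    unfolding L ladder_eq_ladder_on rename_ladder_on by (simp add: f_def comp_def)
  moreover have "inj_on f (verts (ladder n))"
    using distinct_railsD[OF d] unfolding ladder_eq_ladder_on ladder_on_def inj_on_def
    by (auto simp: f_def)
  ultimately show "isomorphic L (ladder n)" using isomorphic_rename[OF s] isomorphic_sym by metis
qed

lemma ladder_on_swap: "ladder_on n v u = ladder_on n u v"
  by (simp add: ladder_on_def rails_def Un_commute insert_commute)

lemma distinct_rails_swap: "distinct_rails I v u = distinct_rails I u v"
  by (auto simp: distinct_rails_def)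

lemma nbhd_ladder_on:
  assumes d: "distinct_rails {..n} u v" and i: "i \<le> n"
  shows "nbhd (ladder_on n u v) (u i) = u ` {j. j \<le> n \<and> (j = Suc i \<or> i = Suc j)} \<union> {v i}"
proof (intro equalityI subsetI)
  note D = distinct_railsD[OF d]
  fix w assume "w \<in> nbhd (ladder_on n u v) (u i)"
  then have "{w, u i} \<in> edges (ladder_on n u v)" by (simp add: nbhd_def)
  then consider j where "j < n" "{w, u i} = {u j, u (Suc j)}" | j where "j < n" "{w, u i} = {v j, v (Suc j)}"
    | j where "j \<le> n" "{w, u i} = {u j, v j}" by (auto simp: ladder_on_def rails_def)
  then show "w \<in> u ` {j. j \<le> n \<and> (j = Suc i \<or> i = Suc j)} \<union> {v i}"
  proof cases
    case (1 j)
    then consider "w = u j" "u i = u (Suc j)" | "w = u (Suc j)" "u i = u j" unfolding doubleton_eq_iff by blast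
    then show ?thesis
    proof cases
      case 1
      then have "i = Suc j" using D(1)[of i "Suc j"] i \<open>j < n\<close> by simp
      then show ?thesis using 1 \<open>j < n\<close> by simp
    next
      case 2
      then have "i = j" using D(1)[of i j] i \<open>j < n\<close> by simp
      then show ?thesis using 2 \<open>j < n\<close> by simp
    qed
  next
    case (2 j)
    then have "u i = v j \<or> u i = v (Suc j)" unfolding doubleton_eq_iff by blast
    then show ?thesis using D(3)[of i j] D(3)[of i "Suc j"] i \<open>j < n\<close> by simp
  next
    case (3 j)
    then consider "w = v j" "u i = u j" | "u i = v j" unfolding doubleton_eq_iff by blast
    then show ?thesis using D(1)[of i j] D(3)[of i j] i \<open>j \<le> n\<close> by cases simp_all
  qed
next
  fix w assume "w \<in> u ` {j. j \<le> n \<and> (j = Suc i \<or> i = Suc j)} \<union> {v i}"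
  then consider "w = u (Suc i)" "Suc i \<le> n" | j where "w = u j" "i = Suc j" | "w = v i" by auto
  then have "{w, u i} \<in> edges (ladder_on n u v)"
    by cases (use i in \<open>auto simp: ladder_on_def rails_def insert_commute\<close>)
  then show "w \<in> nbhd (ladder_on n u v) (u i)" by (simp add: nbhd_def)
qed

lemma degree_ladder_on:
  assumes d: "distinct_rails {..n} u v" and i: "i \<le> n" and n: "n \<ge> 1"
  shows "degree (ladder_on n u v) (u i) = 2 \<longleftrightarrow> i = 0 \<or> i = n"
proof -
  note D = distinct_railsD[OF d]
  let ?J = "{j. j \<le> n \<and> (j = Suc i \<or> i = Suc j)}"
  have "inj_on u ?J" using d by (auto simp: distinct_rails_def inj_on_def)
  moreover have "v i \<notin> u ` ?J" using D(4)[of _ i] i by auto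
  moreover have "finite ?J" by simp
  ultimately have "degree (ladder_on n u v) (u i) = card ?J + 1"
    unfolding degree_def nbhd_ladder_on[OF d i] by (simp add: card_image)
  moreover have "?J = (if i < n then {Suc i} else {}) \<union> (if i > 0 then {i - 1} else {})"
    using i by auto
  ultimately show ?thesis using i n by auto
qed

lemma degree_ladder_on':
  assumes d: "distinct_rails {..n} u v" and i: "i \<le> n" and n: "n \<ge> 1"
  shows "degree (ladder_on n u v) (v i) = 2 \<longleftrightarrow> i = 0 \<or> i = n"
  using degree_ladder_on[of n v u i] d i n by (simp add: distinct_rails_swap ladder_on_swap)

text \<open>Only the corners have degree 2. A rail edge joins two corners only if
  \<open>n = 1\<close>, and in that single quadrangle all four edges are 22-edges.\<close>

lemma ladder_22_edges:
  assumes d: "distinct_rails {..n} u v" and n: "n \<ge> 1" and x: "is_22_edge (ladder_on n u v) a b"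
  shows "{a, b} = {u 0, v 0} \<or> {a, b} = {u n, v n} \<or>
    n = 1 \<and> ({a, b} = {u 0, u n} \<or> {a, b} = {v 0, v n})"
proof -
  have deg: "degree (ladder_on n u v) a = 2" "degree (ladder_on n u v) b = 2"
    and "{a, b} \<in> edges (ladder_on n u v)" using x by (auto simp: is_22_edge_def)
  then consider j where "j < n" "{a, b} = {u j, u (Suc j)}" | j where "j < n" "{a, b} = {v j, v (Suc j)}"
    | j where "j \<le> n" "{a, b} = {u j, v j}" by (auto simp: ladder_on_def rails_def)
  then show ?thesis
  proof cases
    case 1
    then have "degree (ladder_on n u v) (u j) = 2" "degree (ladder_on n u v) (u (Suc j)) = 2"
      using deg by (auto simp: doubleton_eq_iff)
    then show ?thesis using 1 degree_ladder_on[OF d _ n, of j] degree_ladder_on[OF d _ n, of "Suc j"] by auto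
  next
    case 2
    then have "degree (ladder_on n u v) (v j) = 2" "degree (ladder_on n u v) (v (Suc j)) = 2"
      using deg by (auto simp: doubleton_eq_iff)
    then show ?thesis using 2 degree_ladder_on'[OF d _ n, of j] degree_ladder_on'[OF d _ n, of "Suc j"] by auto
  next
    case 3
    then have "degree (ladder_on n u v) (u j) = 2" using deg by (auto simp: doubleton_eq_iff)
    then show ?thesis using 3 degree_ladder_on[OF d _ n, of j] by auto
  qed
qed

lemma is_22_edge_ladder_on:
  assumes d: "distinct_rails {..n} u v" and n: "n \<ge> 1" and i: "i = 0 \<or> i = n"
  shows "is_22_edge (ladder_on n u v) (u i) (v i)"
proof -
  have "{u i, v i} \<in> edges (ladder_on n u v)" using i by (auto simp: ladder_on_def)
  moreover have "i \<le> n" using i by auto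
  ultimately show ?thesis
    using degree_ladder_on[OF d _ n, of i] degree_ladder_on'[OF d _ n, of i] i by (simp add: is_22_edge_def)
qed

lemma rails_reverse: "rails n (\<lambda>i. u (n - i)) (\<lambda>i. v (n - i)) = rails n u v"
proof -
  have "(\<lambda>i. {w (n - i), w (n - Suc i)}) ` {..<n} = (\<lambda>i. {w i, w (Suc i)}) ` {..<n}" for w :: "nat \<Rightarrow> 'a"
  proof (intro equalityI subsetI)
    fix e assume "e \<in> (\<lambda>i. {w (n - i), w (n - Suc i)}) ` {..<n}"
    then obtain i where i: "i < n" "e = {w (n - i), w (n - Suc i)}" by auto
    then have "n - i = Suc (n - Suc i)" "n - Suc i < n" by auto
    then show "e \<in> (\<lambda>i. {w i, w (Suc i)}) ` {..<n}"
      using i by (intro image_eqI[of _ _ "n - Suc i"]) (auto simp: insert_commute)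
  next
    fix e assume "e \<in> (\<lambda>i. {w i, w (Suc i)}) ` {..<n}"
    then obtain i where i: "i < n" "e = {w i, w (Suc i)}" by auto
    then have "n - (n - Suc i) = Suc i" "n - Suc (n - Suc i) = i" "n - Suc i < n" by auto
    then show "e \<in> (\<lambda>i. {w (n - i), w (n - Suc i)}) ` {..<n}"
      using i by (intro image_eqI[of _ _ "n - Suc i"]) (auto simp: insert_commute)
  qed
  then show ?thesis by (simp add: rails_def)
qed

lemma ladder_on_reverse: "ladder_on n (\<lambda>i. u (n - i)) (\<lambda>i. v (n - i)) = ladder_on n u v"
proof -
  have im: "(\<lambda>i. f (n - i)) ` {..n} = f ` {..n}" for f :: "nat \<Rightarrow> 'b"
  proof (intro equalityI subsetI)
    fix e assume "e \<in> f ` {..n}"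
    then obtain i where "i \<le> n" "e = f (n - (n - i))" by auto
    then show "e \<in> (\<lambda>i. f (n - i)) ` {..n}" by (intro image_eqI[of _ _ "n - i"]) auto
  qed auto
  show ?thesis
    unfolding ladder_on_def using im[of u] im[of v] im[of "\<lambda>i. {u i, v i}"] rails_reverse[of n u v] by simp
qed

text \<open>Reversing the ladder, or transposing the quadrangle if \<open>n = 1\<close>, brings the
  two 22-edges to rungs 0 and \<open>n\<close>. Exchanging the rails then fixes the orientation of
  the first edge. It flips both end rungs at once, so the relative twist of the second cannot be
  normalised away.\<close>

lemma ladder_normal:
  assumes iso: "isomorphic L (ladder n)" and n: "n \<ge> 1" and x: "is_22_edge L x1 x2"
    and y: "is_22_edge L y1 y2" and dis: "{x1, x2} \<inter> {y1, y2} = {}"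
  obtains u v where "distinct_rails {..n} u v" "L = ladder_on n u v" "u 0 = x1" "v 0 = x2"
    "u n = y1 \<and> v n = y2 \<or> u n = y2 \<and> v n = y1"
proof -
  define ok where "ok u v \<longleftrightarrow> distinct_rails {..n} u v \<and> L = ladder_on n u v" for u v
  have "\<exists>u v. ok u v \<and> {x1, x2} = {u 0, v 0} \<and> {y1, y2} = {u n, v n}"
  proof -
    obtain u v where d: "distinct_rails {..n} u v" and L: "L = ladder_on n u v"
      using iso isomorphic_ladder_iff by blast
    note D = distinct_railsD[OF d]
    have rev: "ok (\<lambda>i. u (n - i)) (\<lambda>i. v (n - i))"
    proof -
      have "distinct_rails {..n} (\<lambda>i. u (n - i)) (\<lambda>i. v (n - i))"
        unfolding distinct_rails_def
      proof (intro conjI inj_onI)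
        fix i j assume "i \<in> {..n}" "j \<in> {..n}" "u (n - i) = u (n - j)"
        then show "i = j" using D(1)[of "n - i" "n - j"] by simp
      next
        fix i j assume "i \<in> {..n}" "j \<in> {..n}" "v (n - i) = v (n - j)"
        then show "i = j" using D(2)[of "n - i" "n - j"] by simp
      next
        show "(\<lambda>i. u (n - i)) ` {..n} \<inter> (\<lambda>i. v (n - i)) ` {..n} = {}"
          using D(3) by (auto simp: disjoint_iff)
      qed
      then show ?thesis using L by (simp add: ok_def ladder_on_reverse)
    qed
    \<comment> \<open>For \<open>n = 1\<close> the quadrangle may be transposed, which exchanges
      rails and rungs.\<close>
    have rot: "ok (\<lambda>i. if i = 0 then u 0 else v 0) (\<lambda>i. if i = 0 then u 1 else v 1)" if "n = 1"
      unfolding ok_def distinct_rails_def L ladder_on_def rails_def inj_on_def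
      using D[of 0 1] D[of 0 0] D[of 1 1] D[of 1 0] that by (auto simp: atMost_Suc lessThan_Suc insert_commute)
    have rot': "ok (\<lambda>i. if i = 0 then v 0 else u 0) (\<lambda>i. if i = 0 then v 1 else u 1)" if "n = 1"
      unfolding ok_def distinct_rails_def L ladder_on_def rails_def inj_on_def
      using D[of 0 1] D[of 0 0] D[of 1 1] D[of 1 0] that by (auto simp: atMost_Suc lessThan_Suc insert_commute)
    note X = ladder_22_edges[OF d n x[unfolded L]] and Y = ladder_22_edges[OF d n y[unfolded L]]
    have cases: "P = {u 0, v 0} \<and> Q = {u n, v n} \<or> P = {u n, v n} \<and> Q = {u 0, v 0} \<or>
        n = 1 \<and> P = {u 0, u n} \<and> Q = {v 0, v n} \<or> n = 1 \<and> P = {v 0, v n} \<and> Q = {u 0, u n}"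
      if "P = {u 0, v 0} \<or> P = {u n, v n} \<or> n = 1 \<and> (P = {u 0, u n} \<or> P = {v 0, v n})"
        "Q = {u 0, v 0} \<or> Q = {u n, v n} \<or> n = 1 \<and> (Q = {u 0, u n} \<or> Q = {v 0, v n})"
        "P \<inter> Q = {}" for P Q
      using that by (elim disjE conjE; hypsubst; simp)
    show ?thesis
      using cases[OF X Y dis]
    proof (elim disjE conjE)
      assume "{x1, x2} = {u 0, v 0}" "{y1, y2} = {u n, v n}"
      then show ?thesis using d L by (intro exI[of _ u] exI[of _ v]) (simp add: ok_def)
    next
      assume "{x1, x2} = {u n, v n}" "{y1, y2} = {u 0, v 0}"
      then show ?thesis
        using rev by (intro exI[of _ "\<lambda>i. u (n - i)"] exI[of _ "\<lambda>i. v (n - i)"]) simp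
    next
      assume "n = 1" "{x1, x2} = {u 0, u n}" "{y1, y2} = {v 0, v n}"
      then show ?thesis using rot
        by (intro exI[of _ "\<lambda>i. if i = 0 then u 0 else v 0"] exI[of _ "\<lambda>i. if i = 0 then u 1 else v 1"]) simp
    next
      assume "n = 1" "{x1, x2} = {v 0, v n}" "{y1, y2} = {u 0, u n}"
      then show ?thesis using rot'
        by (intro exI[of _ "\<lambda>i. if i = 0 then v 0 else u 0"] exI[of _ "\<lambda>i. if i = 0 then v 1 else u 1"]) simp
    qed
  qed
  then obtain u v where uv: "ok u v" "{x1, x2} = {u 0, v 0}" "{y1, y2} = {u n, v n}" by blast
  have ok': "ok v u" using uv(1) by (simp add: ok_def distinct_rails_swap ladder_on_swap)
  have "u n = y1 \<and> v n = y2 \<or> u n = y2 \<and> v n = y1" using uv(3) by (auto simp: doubleton_eq_iff)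
  moreover have "u 0 = x1 \<and> v 0 = x2 \<or> u 0 = x2 \<and> v 0 = x1" using uv(2) by (auto simp: doubleton_eq_iff)
  ultimately show ?thesis using that[of u v] that[of v u] uv(1) ok' unfolding ok_def by blast
qed

text \<open>
  The graph produced by the recursive step of the class, with rails \<open>u\<close> and \<open>v\<close>: the ends of the
  spliced edges are \<open>u 0, v 0\<close> in \<open>K\<close> and \<open>u n, v n\<close> in \<open>T\<close>, so only the rungs \<open>1, \<dots>, n - 1\<close> are new.
\<close>

definition assembled :: "'a sgraph \<Rightarrow> nat \<Rightarrow> (nat \<Rightarrow> 'a) \<Rightarrow> (nat \<Rightarrow> 'a) \<Rightarrow> 'a sgraph \<Rightarrow> 'a sgraph" where
  "assembled T n u v K =
     \<lparr> verts = verts T \<union> verts K \<union> u ` {1..<n} \<union> v ` {1..<n},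
       edges = (edges T - {{u n, v n}}) \<union> (edges K - {{u 0, v 0}}) \<union> rails n u v \<union>
         (\<lambda>i. {u i, v i}) ` {1..<n} \<rparr>"

text \<open>The side conditions under which the parts overlap only in the four ends. For
  \<open>n = 1\<close> there are no inner rungs, and the two rail edges join \<open>K\<close>
  directly to \<open>T\<close>.\<close>

definition assembly :: "'a sgraph \<Rightarrow> nat \<Rightarrow> (nat \<Rightarrow> 'a) \<Rightarrow> (nat \<Rightarrow> 'a) \<Rightarrow> 'a sgraph \<Rightarrow> bool" where
  "assembly T n u v K \<longleftrightarrow> n \<ge> 1 \<and> simple_graph T \<and> simple_graph K \<and> verts T \<inter> verts K = {} \<and>
     {u 0, v 0} \<in> edges K \<and> {u n, v n} \<in> edges T \<and> distinct_rails {..n} u v \<and>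
     (u ` {1..<n} \<union> v ` {1..<n}) \<inter> (verts T \<union> verts K) = {}"

lemma splice_swap:
  assumes "y1 \<noteq> y2"
  shows "splice_edges G1 (x1, x2) G2 (y1, y2) = splice_edges G1 (x2, x1) G2 (y2, y1)"
proof -
  have "id(y1 := x1, y2 := x2) = id(y2 := x2, y1 := x1)" using assms by (rule fun_upd_twist)
  moreover have "{x2, x1} = {x1, x2}" "{y2, y1} = {y1, y2}" by (rule insert_commute)+
  ultimately show ?thesis unfolding splice_edges_def prod.case Let_def by (elim ssubst) (rule refl)
qed

text \<open>A splice keeps the names of its first graph. The inner one renames \<open>g1, g2\<close>
  to the ladder ends, which gives \<open>K'\<close>; the outer one renames \<open>u n, v n\<close>
  to \<open>f1, f2\<close>, which gives \<open>u', v'\<close>. The second renaming leaves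
  \<open>K'\<close> alone because \<open>u n\<close> and \<open>v n\<close> are not among its
  vertices.\<close>

lemma splice_eq:
  assumes n: "n \<ge> 1" and d: "distinct_rails {..n} u v" and L: "L = ladder_on n u v"
    and sT: "simple_graph T" and sK: "simple_graph K"
    and TL: "verts T \<inter> verts L = {}" and TK: "verts T \<inter> verts K = {}" and LK: "verts L \<inter> verts K = {}"
    and g: "{g1, g2} \<in> edges K" and f: "{f1, f2} \<in> edges T"
  defines "K' \<equiv> rename (id(g1 := u 0, g2 := v 0)) K"
    and "u' \<equiv> u(n := f1)" and "v' \<equiv> v(n := f2)"
  shows "splice_edges T (f1, f2) (splice_edges L (u 0, v 0) K (g1, g2)) (u n, v n) = assembled T n u' v' K'"
    "assembly T n u' v' K'" "isomorphic K K'"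
proof -
  note D = distinct_railsD[OF d]
  let ?h1 = "id(g1 := u 0, g2 := v 0)" and ?h2 = "id(u n := f1, v n := f2)"
  have gd: "g1 \<noteq> g2" "g1 \<in> verts K" "g2 \<in> verts K" using simple_edgeD[OF sK g] by auto
  have fd: "f1 \<noteq> f2" "f1 \<in> verts T" "f2 \<in> verts T" using simple_edgeD[OF sT f] by auto
  have uL: "u i \<in> verts L" "v i \<in> verts L" if "i \<le> n" for i using that by (auto simp: L ladder_on_def)
  have inj1: "inj_on ?h1 (verts K)"
    using uL[of 0] LK D(3)[of 0 0] by (auto simp: inj_on_def disjoint_iff)
  show "isomorphic K K'" unfolding K'_def by (rule isomorphic_rename[OF sK inj1])
  have sK': "simple_graph K'" unfolding K'_def by (rule simple_rename[OF sK inj1])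
  have vK': "verts K' \<subseteq> verts K \<union> {u 0, v 0}" by (auto simp: K'_def rename_def)
  have u0': "u' 0 = u 0" "v' 0 = v 0" using n by (auto simp: u'_def v'_def)
  have notK': "u i \<notin> verts K'" "v i \<notin> verts K'" if "1 \<le> i" "i \<le> n" for i
    using vK' uL[of i] LK D(1)[of i 0] D(2)[of i 0] D(3)[of i 0] D(4)[of 0 i] that by auto
  have h2K': "?h2 x = x" if "x \<in> verts K'" for x
    using notK'[of n] n that by auto
  have h2u: "?h2 (u i) = u' i" "?h2 (v i) = v' i" if "i \<le> n" for i
    using that D(1)[of i n] D(2)[of i n] D(3)[of i n] D(3)[of n n] D(4)[of n i]
    by (auto simp: u'_def v'_def)
  have eK': "(\<lambda>e. ?h1 ` e) ` (edges K - {{g1, g2}}) = edges K' - {{u 0, v 0}}"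
  proof -
    have "inj_on (\<lambda>e. ?h1 ` e) (edges K)"
      using inj1 simple_edge_subset[OF sK] by (meson inj_on_def inj_on_image_eq_iff)
    then have "(\<lambda>e. ?h1 ` e) ` (edges K - {{g1, g2}}) = (\<lambda>e. ?h1 ` e) ` edges K - (\<lambda>e. ?h1 ` e) ` {{g1, g2}}"
      using g by (intro inj_on_image_set_diff) auto
    then show ?thesis using gd by (simp add: K'_def rename_def insert_commute)
  qed
  have uvK': "{u' 0, v' 0} \<in> edges K'"
    unfolding u0' K'_def rename_def using gd g by (auto intro!: image_eqI[OF _ g])
  show asm: "assembly T n u' v' K'"
    unfolding assembly_def
  proof (intro conjI)
    show "verts T \<inter> verts K' = {}" using vK' TK TL uL[of 0] by auto
    show "{u' n, v' n} \<in> edges T" using f by (simp add: u'_def v'_def)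
    have notT: "u i \<notin> verts T" "v i \<notin> verts T" if "i \<le> n" for i using uL[OF that] TL by auto
    show "distinct_rails {..n} u' v'"
      unfolding distinct_rails_def
    proof (intro conjI)
      show "inj_on u' {..n}" "inj_on v' {..n}"
        unfolding u'_def v'_def inj_on_def using D(1,2) notT fd by (auto simp: le_less)+
      show "u' ` {..n} \<inter> v' ` {..n} = {}"
        unfolding u'_def v'_def using D(3) notT fd by (auto simp: disjoint_iff) 
    qed
    show "(u' ` {1..<n} \<union> v' ` {1..<n}) \<inter> (verts T \<union> verts K') = {}"
      using notT notK' by (auto simp: u'_def v'_def)
  qed (use n sT sK' uvK' in auto)
  let ?S = "splice_edges L (u 0, v 0) K (g1, g2)"
  have vS: "verts ?S = verts L \<union> verts K'" 
    by (simp add: splice_edges_def K'_def rename_def Let_def)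
  have eS: "edges ?S = (edges L - {{u 0, v 0}}) \<union> (edges K' - {{u 0, v 0}})"
    using eK' by (simp add: splice_edges_def Let_def)
  have rung: "{u i, v i} = {u j, v j} \<longleftrightarrow> i = j" if "i \<le> n" "j \<le> n" for i j
    using D(1)[of i j] D(3)[of i j] that by (auto simp: doubleton_eq_iff)
  have rail_rung: "{u i, v i} \<notin> rails n u v" if "i \<le> n" for i
    using D(3) that by (auto simp: rails_def doubleton_eq_iff) (metis Suc_leI less_imp_le)+
  \<comment> \<open>The inner splice removes rung 0 and the outer one rung \<open>n\<close>; both
    rails survive.\<close>
  have eL: "edges L - {{u 0, v 0}} - {{u n, v n}} = rails n u v \<union> (\<lambda>i. {u i, v i}) ` {1..<n}"
  proof -
    have "(\<lambda>i. {u i, v i}) ` {..n} - {{u 0, v 0}} - {{u n, v n}} = (\<lambda>i. {u i, v i}) ` {1..<n}"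
    proof (intro equalityI subsetI)
      fix e assume "e \<in> (\<lambda>i. {u i, v i}) ` {..n} - {{u 0, v 0}} - {{u n, v n}}"
      then obtain i where "i \<le> n" "e = {u i, v i}" "e \<noteq> {u 0, v 0}" "e \<noteq> {u n, v n}" by auto
      then have "i \<in> {1..<n}" by (metis One_nat_def Suc_leI atLeastLessThan_iff le_neq_implies_less neq0_conv)
      then show "e \<in> (\<lambda>i. {u i, v i}) ` {1..<n}" using \<open>e = {u i, v i}\<close> by blast
    next
      fix e assume "e \<in> (\<lambda>i. {u i, v i}) ` {1..<n}"
      then obtain i where "1 \<le> i" "i < n" "e = {u i, v i}" by auto
      then show "e \<in> (\<lambda>i. {u i, v i}) ` {..n} - {{u 0, v 0}} - {{u n, v n}}"
        using rung[of i 0] rung[of i n] by auto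
    qed
    moreover have "edges L = rails n u v \<union> (\<lambda>i. {u i, v i}) ` {..n}" by (simp add: L ladder_on_def)
    ultimately show ?thesis using rail_rung[of 0] rail_rung[of n] by (simp add: Un_Diff)
  qed
  have "{u n, v n} \<notin> edges K'" using simple_edge_subset[OF sK', of "{u n, v n}"] notK'[of n] n by auto
  then have eS': "edges ?S - {{u n, v n}} = rails n u v \<union> (\<lambda>i. {u i, v i}) ` {1..<n} \<union> (edges K' - {{u 0, v 0}})"
    unfolding eS Un_Diff eL by simp
  have h2r: "(\<lambda>e. ?h2 ` e) ` rails n u v = rails n u' v'"
    unfolding rails_def image_Un image_image using h2u
    by (intro arg_cong2[where f = "(\<union>)"] image_cong) (auto simp del: id_apply fun_upd_apply)
  have h2g: "(\<lambda>e. ?h2 ` e) ` (\<lambda>i. {u i, v i}) ` {1..<n} = (\<lambda>i. {u' i, v' i}) ` {1..<n}"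
    unfolding image_image using h2u
    by (intro image_cong) (auto simp del: id_apply fun_upd_apply)
  have h2k: "(\<lambda>e. ?h2 ` e) ` (edges K' - {{u 0, v 0}}) = edges K' - {{u 0, v 0}}"
  proof -
    have "?h2 ` e = e" if "e \<in> edges K'" for e
      using simple_edge_subset[OF sK' that] h2K' by (metis (no_types, lifting) image_cong image_ident subsetD)
    then show ?thesis by (simp cong: image_cong_simp)
  qed
  have uv'n: "u' n = f1" "v' n = f2" by (simp_all add: u'_def v'_def)
  have vv: "verts T \<union> ?h2 ` (verts L \<union> verts K') = verts T \<union> verts K' \<union> u' ` {1..<n} \<union> v' ` {1..<n}"
  proof -
    have e1: "?h2 ` verts K' = verts K'" using h2K' by (metis (no_types, lifting) image_cong image_ident)
    have e2: "?h2 ` verts L = u' ` {..n} \<union> v' ` {..n}"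
      unfolding L ladder_on_def using h2u
      by (simp add: image_Un image_image del: id_apply fun_upd_apply cong: image_cong_simp)
    have e3: "u' ` {..n} = {u' 0, f1} \<union> u' ` {1..<n}" "v' ` {..n} = {v' 0, f2} \<union> v' ` {1..<n}"
    proof -
      have "{..n} = {0, n} \<union> {1..<n}" using n by auto
      then show "u' ` {..n} = {u' 0, f1} \<union> u' ` {1..<n}" "v' ` {..n} = {v' 0, f2} \<union> v' ` {1..<n}"
        using uv'n by simp_all
    qed
    have "u' 0 \<in> verts K'" "v' 0 \<in> verts K'" using simple_edgeD[OF sK' uvK'] by auto
    then show ?thesis using fd(2,3) unfolding image_Un e1 e2 e3 by blast
  qed
  show "splice_edges T (f1, f2) ?S (u n, v n) = assembled T n u' v' K'"
    unfolding assembled_def uv'n u0'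
    unfolding splice_edges_def[of T] prod.case Let_def vS eS' vv
    unfolding image_Un h2r h2g h2k
    by (simp only: Un_ac)
qed

lemma simple_assembled:
  assumes "assembly T n u v K" shows "simple_graph (assembled T n u v K)"
proof -
  have a: "n \<ge> 1" "simple_graph T" "simple_graph K" "distinct_rails {..n} u v"
    "{u 0, v 0} \<in> edges K" "{u n, v n} \<in> edges T" using assms by (auto simp: assembly_def)
  note D = distinct_railsD[OF a(4)]
  have V: "u i \<in> verts (assembled T n u v K)" "v i \<in> verts (assembled T n u v K)" if "i \<le> n" for i
  proof -
    have "i = 0 \<or> i = n \<or> i \<in> {1..<n}" using that by auto
    then consider "i = 0" | "i = n" | "i \<in> {1..<n}" by blast
    then have "u i \<in> verts (assembled T n u v K) \<and> v i \<in> verts (assembled T n u v K)"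
      by cases (use simple_edgeD[OF a(3,5)] simple_edgeD[OF a(2,6)] in \<open>auto simp: assembled_def\<close>)
    then show "u i \<in> verts (assembled T n u v K)" "v i \<in> verts (assembled T n u v K)" by auto
  qed
  show ?thesis
    unfolding simple_graph_def
  proof (intro conjI ballI)
    show "finite (verts (assembled T n u v K))" using a by (auto simp: assembled_def simple_graph_def)
    fix e assume "e \<in> edges (assembled T n u v K)"
    then consider "e \<in> edges T" | "e \<in> edges K" | i where "i < n" "e = {u i, u (Suc i)}"
      | i where "i < n" "e = {v i, v (Suc i)}" | i where "i < n" "e = {u i, v i}"
      by (auto simp: assembled_def rails_def)
    then show "\<exists>p\<in>verts (assembled T n u v K). \<exists>q\<in>verts (assembled T n u v K). p \<noteq> q \<and> e = {p, q}"
    proof cases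
      case 1
      then obtain p q where "p \<in> verts T" "q \<in> verts T" "p \<noteq> q" "e = {p, q}"
        using a(2) by (auto simp: simple_graph_def)
      then show ?thesis by (intro bexI[of _ p] bexI[of _ q]) (auto simp: assembled_def)
    next
      case 2
      then obtain p q where "p \<in> verts K" "q \<in> verts K" "p \<noteq> q" "e = {p, q}"
        using a(3) by (auto simp: simple_graph_def)
      then show ?thesis by (intro bexI[of _ p] bexI[of _ q]) (auto simp: assembled_def)
    next
      case 3 then show ?thesis using V(1)[of i] V(1)[of "Suc i"] D(1)[of i "Suc i"] by auto
    next
      case 4 then show ?thesis using V(2)[of i] V(2)[of "Suc i"] D(2)[of i "Suc i"] by auto
    next
      case 5 then show ?thesis using V(1)[of i] V(2)[of i] D(3)[of i i] by auto
    qed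
  qed
qed

section \<open>Nice pairs in the recursive class\<close>

text \<open>The nested sides of the successive two-edge cuts along a ladder that starts at
  \<open>W\<close>. The start is a parameter, so that the sets can be used before the graph is known
  to be assembled.\<close>

definition strand :: "'a set \<Rightarrow> (nat \<Rightarrow> 'a) \<Rightarrow> (nat \<Rightarrow> 'a) \<Rightarrow> nat \<Rightarrow> 'a set" where
  "strand W u v i = W \<union> u ` {1..i} \<union> v ` {1..i}"

lemma strand_0: "strand W u v 0 = W" by (simp add: strand_def)

lemma strand_Suc: "strand W u v (Suc i) = strand W u v i \<union> {u (Suc i), v (Suc i)}"
  by (auto simp: strand_def atLeastAtMostSuc_conv)

lemma assembled_mem_strand:
  assumes a: "assembly T n u v K" and i: "i < n" and j: "j \<le> n"
  shows "u j \<in> strand (verts K) u v i \<longleftrightarrow> j \<le> i" "v j \<in> strand (verts K) u v i \<longleftrightarrow> j \<le> i"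
proof -
  have A: "simple_graph T" "simple_graph K" "verts T \<inter> verts K = {}" "{u 0, v 0} \<in> edges K"
    "{u n, v n} \<in> edges T" "distinct_rails {..n} u v"
    "(u ` {1..<n} \<union> v ` {1..<n}) \<inter> (verts T \<union> verts K) = {}" using a by (auto simp: assembly_def)
  note D = distinct_railsD[OF A(6)]
  note e0 = simple_edgeD[OF A(2,4)] and en = simple_edgeD[OF A(1,5)]
  have K: "u j \<in> verts K \<longleftrightarrow> j = 0" "v j \<in> verts K \<longleftrightarrow> j = 0"
  proof -
    have "j = 0 \<or> j = n \<or> j \<in> {1..<n}" using j by auto
    then have "(u j \<in> verts K \<longleftrightarrow> j = 0) \<and> (v j \<in> verts K \<longleftrightarrow> j = 0)"
    proof (elim disjE)
      assume "j = 0" then show ?thesis using e0 by simp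
    next
      assume "j = n" then show ?thesis using en A(3) i by auto
    next
      assume "j \<in> {1..<n}"
      then have "u j \<notin> verts K" "v j \<notin> verts K" using A(7) by blast+
      then show ?thesis using \<open>j \<in> {1..<n}\<close> by simp
    qed
    then show "u j \<in> verts K \<longleftrightarrow> j = 0" "v j \<in> verts K \<longleftrightarrow> j = 0" by auto
  qed
  have "u j \<in> u ` {1..i} \<longleftrightarrow> 1 \<le> j \<and> j \<le> i" "v j \<in> v ` {1..i} \<longleftrightarrow> 1 \<le> j \<and> j \<le> i"
    using D(1,2)[of j] i j by (auto simp: image_iff)
  moreover have "u j \<notin> v ` {1..i}" "v j \<notin> u ` {1..i}" using D(3,4) i j by auto
  ultimately show "u j \<in> strand (verts K) u v i \<longleftrightarrow> j \<le> i" "v j \<in> strand (verts K) u v i \<longleftrightarrow> j \<le> i"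
    unfolding strand_def using K by auto
qed

text \<open>Between two consecutive rungs only the two rail edges cross.\<close>

lemma two_cut_assembled:
  assumes a: "assembly T n u v K" and i: "i < n"
  shows "two_cut (assembled T n u v K) (strand (verts K) u v i) (u i) (v i) (u (Suc i)) (v (Suc i))"
proof -
  let ?H = "assembled T n u v K" and ?W = "strand (verts K) u v i"
  have A: "simple_graph T" "simple_graph K" "verts T \<inter> verts K = {}" "distinct_rails {..n} u v"
    "(u ` {1..<n} \<union> v ` {1..<n}) \<inter> (verts T \<union> verts K) = {}"
    "{u n, v n} \<in> edges T" using a by (auto simp: assembly_def)
  note D = distinct_railsD[OF A(4)]
  note mem = assembled_mem_strand[OF a i]
  have sH: "simple_graph ?H" by (rule simple_assembled[OF a])
  have WT: "?W \<inter> verts T = {}" using A(3,5) i by (fastforce simp: strand_def)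
  have KW: "verts K \<subseteq> ?W" by (auto simp: strand_def)
  have sub: "?W \<subseteq> verts ?H" using i by (fastforce simp: strand_def assembled_def)
  have rail: "{u i, u (Suc i)} \<in> edges ?H" "{v i, v (Suc i)} \<in> edges ?H"
    using i by (auto simp: assembled_def rails_def)
  have cut: "p = u i \<and> q = u (Suc i) \<or> p = v i \<and> q = v (Suc i)"
    if p: "p \<in> ?W" and q: "q \<notin> ?W" and e: "{p, q} \<in> edges ?H" for p q
  proof -
    consider "{p, q} \<in> edges T" | "{p, q} \<in> edges K" | j where "j < n" "{p, q} = {u j, u (Suc j)}"
      | j where "j < n" "{p, q} = {v j, v (Suc j)}" | j where "j < n" "{p, q} = {u j, v j}"
      using e by (auto simp: assembled_def rails_def)
    then show ?thesis
    proof cases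
      case 1 then show ?thesis using simple_edgeD[OF A(1)] WT p by blast
    next
      case 2 then show ?thesis using simple_edgeD[OF A(2)] KW q by blast
    next
      case (3 j)
      then consider "p = u j" "q = u (Suc j)" | "p = u (Suc j)" "q = u j" unfolding doubleton_eq_iff by blast
      then show ?thesis
      proof cases
        case 1
        then have "j = i" using mem(1)[of j] mem(1)[of "Suc j"] \<open>j < n\<close> p q by simp
        then show ?thesis using 1 by simp
      next
        case 2
        then show ?thesis using mem(1)[of j] mem(1)[of "Suc j"] \<open>j < n\<close> p q by simp
      qed
    next
      case (4 j)
      then consider "p = v j" "q = v (Suc j)" | "p = v (Suc j)" "q = v j" unfolding doubleton_eq_iff by blast
      then show ?thesis
      proof cases
        case 1
        then have "j = i" using mem(2)[of j] mem(2)[of "Suc j"] \<open>j < n\<close> p q by simp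
        then show ?thesis using 1 by simp
      next
        case 2
        then show ?thesis using mem(2)[of j] mem(2)[of "Suc j"] \<open>j < n\<close> p q by simp
      qed
    next
      case (5 j)
      then consider "p = u j" "q = v j" | "p = v j" "q = u j" unfolding doubleton_eq_iff by blast
      then show ?thesis using mem(1)[of j] mem(2)[of j] 5(1) p q by cases auto
    qed
  qed
  have in_out: "u i \<in> ?W" "v i \<in> ?W" "u (Suc i) \<notin> ?W" "v (Suc i) \<notin> ?W"
    using mem(1)[of i] mem(2)[of i] mem(1)[of "Suc i"] mem(2)[of "Suc i"] i by auto
  have ne: "u i \<noteq> v i" "u (Suc i) \<noteq> v (Suc i)" using D(3)[of i i] D(3)[of "Suc i" "Suc i"] i by auto
  show ?thesis
    unfolding two_cut_def
    using sub in_out ne rail simple_edgeD[OF sH rail(1)] simple_edgeD[OF sH rail(2)] cut by blast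
qed

text \<open>Beyond the last cut lies \<open>T\<close> without its spliced edge, and closing that
  side restores the edge. Hence \<open>nice_pair_reduct\<close> identifies the nice pairs there with
  those of \<open>T\<close>.\<close>

lemma assembled_compl_strand:
  assumes a: "assembly T n u v K"
  shows "verts (assembled T n u v K) - strand (verts K) u v (n - 1) = verts T"
    "reduct (assembled T n u v K) (verts T) (u n) (v n) = T" "{u n, v n} \<notin> edges (assembled T n u v K)"
proof -
  have A: "simple_graph T" "simple_graph K" "verts T \<inter> verts K = {}" "distinct_rails {..n} u v"
    "(u ` {1..<n} \<union> v ` {1..<n}) \<inter> (verts T \<union> verts K) = {}"
    "{u n, v n} \<in> edges T" "n \<ge> 1" "{u 0, v 0} \<in> edges K" using a by (auto simp: assembly_def)
  note D = distinct_railsD[OF A(4)]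
  have "{1..n - 1} = {1..<n}" using A(7) by auto
  then show "verts (assembled T n u v K) - strand (verts K) u v (n - 1) = verts T"
    unfolding strand_def assembled_def using A(3,5) by auto
  have notT: "u i \<notin> verts T" "v i \<notin> verts T" if "i < n" for i
  proof -
    have "i = 0 \<or> i \<in> {1..<n}" using that by auto
    then have "u i \<notin> verts T \<and> v i \<notin> verts T"
      using simple_edgeD[OF A(2,8)] A(3,5) by (elim disjE) (simp, blast+)
    then show "u i \<notin> verts T" "v i \<notin> verts T" by auto
  qed
  have eT: "e \<in> edges T - {{u n, v n}}" if "e \<in> edges (assembled T n u v K)" "e \<subseteq> verts T" for e
  proof -
    have "e \<notin> edges K"
    proof
      assume "e \<in> edges K"
      then obtain p q where "e = {p, q}" "p \<in> verts K" using A(2) by (auto simp: simple_graph_def)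
      then show False using that(2) A(3) by blast
    qed
    moreover have "e \<notin> rails n u v" using notT that(2) by (auto simp: rails_def)
    moreover have "e \<notin> (\<lambda>i. {u i, v i}) ` {1..<n}" using notT that(2) by auto
    ultimately show ?thesis using that(1) by (simp add: assembled_def)
  qed
  have un: "{u n, v n} \<subseteq> verts T" using simple_edgeD[OF A(1,6)] by simp
  show "{u n, v n} \<notin> edges (assembled T n u v K)" using eT[OF _ un] by blast
  have "{e \<in> edges (assembled T n u v K). e \<subseteq> verts T} = edges T - {{u n, v n}}"
    using eT simple_edge_subset[OF A(1)] by (auto simp: assembled_def)
  then have "insert {u n, v n} {e \<in> edges (assembled T n u v K). e \<subseteq> verts T} = edges T"
    using A(6) by blast
  then show "reduct (assembled T n u v K) (verts T) (u n) (v n) = T"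
    by (simp add: reduct_def)
qed

text \<open>All bipartitions are quantified because the recursive class carries none. Exchanging the
  classes then gives the bound for the vertices of \<open>B\<close> too.\<close>

definition nice_degree_le_3 :: "'a sgraph \<Rightarrow> bool" where
  "nice_degree_le_3 G \<longleftrightarrow>
     (\<forall>A B. cubic_bipartite G A B \<longrightarrow> (\<forall>a\<in>A. card {b \<in> B. nice_pair G a b} \<le> 3))"

text \<open>The nested cuts divide the graph into layers: \<open>K\<close>, the inner rungs, and
  \<open>T\<close>. By \<open>not_nice_pair_cross\<close> nice partners share a layer. In
  \<open>K\<close> the other class has three vertices, a rung has only two vertices, and in
  \<open>T\<close> the hypothesis applies.\<close>

lemma nice_degree_assembled:
  assumes a: "assembly T n u v K" and K: "card (verts K) = 6" and T: "nice_degree_le_3 T"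
  shows "nice_degree_le_3 (assembled T n u v K)"
  unfolding nice_degree_le_3_def
proof (intro allI impI ballI)
  let ?H = "assembled T n u v K"
  fix A B x assume cb: "cubic_bipartite ?H A B" and x: "x \<in> A"
  interpret cubic_bipartite ?H A B by (rule cb)
  let ?S = "strand (verts K) u v"
  have n: "n \<ge> 1" using a by (simp add: assembly_def)
  note cut = two_cut_assembled[OF a]
  have inside: "b \<in> ?S i" if "i < n" "x \<in> ?S i" "nice_pair ?H x b" "b \<in> B" for i b
    using not_nice_pair_cross[OF cut[OF that(1)], of x b] that x by blast
  have outside: "b \<notin> ?S i" if "i < n" "x \<notin> ?S i" "nice_pair ?H x b" "b \<in> B" for i b
  proof -
    have "x \<in> verts ?H" using x verts_eq by blast
    then show ?thesis
      using not_nice_pair_cross[OF two_cut_compl[OF cut[OF that(1)]], of x b] that x by blast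
  qed
  have disj': "A \<inter> B = {}" by (rule disj)
  show "card {b \<in> B. nice_pair ?H x b} \<le> 3"
  proof (cases "x \<in> ?S (n - 1)")
    case False
    have xV: "x \<in> verts T" using False x verts_eq assembled_compl_strand(1)[OF a] by blast
    have c: "two_cut ?H (verts T) (u n) (v n) (u (n - 1)) (v (n - 1))"
      using two_cut_compl[OF cut[of "n - 1"]] n assembled_compl_strand(1)[OF a] by simp
    have "{b \<in> B. nice_pair ?H x b} \<subseteq> {b \<in> verts T \<inter> B. nice_pair T x b}"
    proof
      fix b assume b: "b \<in> {b \<in> B. nice_pair ?H x b}"
      then have "b \<notin> ?S (n - 1)" using outside[OF _ False] n by simp
      then have bT: "b \<in> verts T" using b verts_eq assembled_compl_strand(1)[OF a] by blast
      have "nice_pair T x b"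
        using nice_pair_reduct[OF c assembled_compl_strand(3)[OF a], of x b] xV bT b x
        by (simp add: assembled_compl_strand(2)[OF a])
      then show "b \<in> {b \<in> verts T \<inter> B. nice_pair T x b}" using b bT by simp
    qed
    moreover have "cubic_bipartite T (verts T \<inter> A) (verts T \<inter> B)"
      using reduct_cubic_bipartite[OF c assembled_compl_strand(3)[OF a]]
      by (simp add: assembled_compl_strand(2)[OF a])
    then have "card {b \<in> verts T \<inter> B. nice_pair T x b} \<le> 3"
      using T xV x unfolding nice_degree_le_3_def by blast
    moreover have "finite {b \<in> verts T \<inter> B. nice_pair T x b}" using finite_B by simp
    ultimately show ?thesis using card_mono order.trans by meson
  next
    case True
    \<comment> \<open>The least strand containing \<open>x\<close> determines its layer.\<close>
    define i where "i = (LEAST i. x \<in> ?S i)"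
    have xi: "x \<in> ?S i" unfolding i_def using True by (rule LeastI)
    have i: "i < n" using Least_le[of "\<lambda>i. x \<in> ?S i", OF True] n by (simp add: i_def)
    have less: "x \<notin> ?S j" if "j < i" for j using that not_less_Least unfolding i_def by blast
    show ?thesis
    proof (cases i)
      case 0
      \<comment> \<open>The cut splits the six vertices of \<open>K\<close> evenly between the
        classes.\<close>
      have "card (?S 0 \<inter> A) = card (?S 0 \<inter> B)" using cut_sides(2)[OF cut[of 0]] n by simp
      moreover have fin: "finite (?S 0 \<inter> A)" "finite (?S 0 \<inter> B)" using finite_A finite_B by auto
      moreover have "verts K = (?S 0 \<inter> A) \<union> (?S 0 \<inter> B)"
        using two_cutD(1)[OF cut[of 0]] n verts_eq by (auto simp: strand_0)
      ultimately have "card (?S 0 \<inter> B) = 3"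
        using K card_Un_disjoint[OF fin] disj' by (simp add: disjoint_iff)
      moreover have "{b \<in> B. nice_pair ?H x b} \<subseteq> ?S 0 \<inter> B" using inside[OF i xi] 0 by auto
      ultimately show ?thesis using card_mono[OF fin(2)] by metis
    next
      case (Suc j)
      have "{b \<in> B. nice_pair ?H x b} \<subseteq> {u i, v i}"
      proof
        fix b assume b: "b \<in> {b \<in> B. nice_pair ?H x b}"
        then have "b \<in> ?S i" using inside[OF i xi] by simp
        moreover have "b \<notin> ?S j" using outside[of j b] less[of j] Suc i b by simp
        ultimately show "b \<in> {u i, v i}" unfolding Suc strand_Suc by blast
      qed
      then have "card {b \<in> B. nice_pair ?H x b} \<le> card {u i, v i}" by (intro card_mono) auto
      also have "\<dots> \<le> 3" by (simp add: card_insert_if)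
      finally show ?thesis .
    qed
  qed
qed

lemma card_verts_K33: "card (verts (complete_bipartite 3 3)) = 6"
  by (simp add: complete_bipartite_def card_Plus)

lemma isomorphic_card: "isomorphic G H \<Longrightarrow> card (verts G) = card (verts H)"
  by (auto simp: isomorphic_def bij_betw_same_card)

text \<open>The twist left open by \<open>ladder_normal\<close> is absorbed by
  \<open>splice_swap\<close>: reversing \<open>f1, f2\<close> together with \<open>y1, y2\<close>
  does not change the graph.\<close>

lemma splice_assembled:
  assumes n: "n \<ge> 1" and L: "isomorphic L (ladder n)" and sK: "simple_graph K" and sT: "simple_graph T"
    and TL: "verts T \<inter> verts L = {}" and TK: "verts T \<inter> verts K = {}" and LK: "verts L \<inter> verts K = {}"
    and x: "is_22_edge L x1 x2" and y: "is_22_edge L y1 y2" and xy: "{x1, x2} \<inter> {y1, y2} = {}"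
    and g: "{g1, g2} \<in> edges K" and f: "{f1, f2} \<in> edges T"
  shows "\<exists>u v K'. assembly T n u v K' \<and> isomorphic K K' \<and>
    splice_edges T (f1, f2) (splice_edges L (x1, x2) K (g1, g2)) (y1, y2) = assembled T n u v K'"
proof -
  obtain u v where uv: "distinct_rails {..n} u v" "L = ladder_on n u v" "u 0 = x1" "v 0 = x2"
    and yn: "u n = y1 \<and> v n = y2 \<or> u n = y2 \<and> v n = y1"
    using ladder_normal[OF L n x y xy] by metis
  have f': "{f2, f1} \<in> edges T" using f by (simp add: insert_commute)
  show ?thesis
    using yn
  proof
    assume "u n = y1 \<and> v n = y2"
    then show ?thesis using splice_eq[OF n uv(1,2) sT sK TL TK LK g f] uv(3,4) by blast
  next
    assume yn: "u n = y2 \<and> v n = y1"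
    have "u n \<noteq> v n" using distinct_railsD(3)[OF uv(1), of n n] by simp
    then have "splice_edges T (f1, f2) (splice_edges L (x1, x2) K (g1, g2)) (y1, y2) =
      splice_edges T (f2, f1) (splice_edges L (x1, x2) K (g1, g2)) (y2, y1)"
      using yn by (intro splice_swap) auto
    then show ?thesis using splice_eq[OF n uv(1,2) sT sK TL TK LK g f'] uv(3,4) yn by metis
  qed
qed

lemma T_nat_nice_degree:
  "T_nat H \<Longrightarrow> simple_graph H \<and> nice_degree_le_3 H"
proof (induction rule: T_nat.induct)
  case (K33 K)
  have "card {b \<in> B. nice_pair K a b} \<le> 3" if "cubic_bipartite K A B" for A B a
  proof -
    interpret cubic_bipartite K A B by (rule that)
    have "card (A \<union> B) = 6" using isomorphic_card[OF K33] card_verts_K33 verts_eq by simp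
    then have "card B = 3" using card_Un_disjoint[OF finite_A finite_B disj] card_A_eq_B by simp
    moreover have "card {b \<in> B. nice_pair K a b} \<le> card B" using finite_B by (intro card_mono) auto
    ultimately show ?thesis by simp
  qed
  then show ?case using K33 by (auto simp: nice_degree_le_3_def isomorphic_def)
next
  case (splice T n L K x1 x2 y1 y2 g1 g2 f1 f2)
  have "simple_graph K" using splice by (simp add: isomorphic_def)
  then obtain u v K' where *: "assembly T n u v K'" "isomorphic K K'"
    "splice_edges T (f1, f2) (splice_edges L (x1, x2) K (g1, g2)) (y1, y2) = assembled T n u v K'"
    using splice_assembled[of n L K T x1 x2 y1 y2 g1 g2 f1 f2] splice by blast
  have "card (verts K') = 6"
    using isomorphic_card[OF *(2)] isomorphic_card[OF splice(4)] card_verts_K33 by simp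
  then show ?case using *(3) nice_degree_assembled[OF *(1)] simple_assembled[OF *(1)] splice by simp
qed

section \<open>Peeling off a ladder\<close>

text \<open>The converse passage to \<open>splice_eq\<close>: a graph glued in place is recognised
  as an output of the recursive constructor.\<close>

lemma T_nat_assembled:
  assumes T: "T_nat T" and a: "assembly T n u v K" and K: "isomorphic K (complete_bipartite 3 3)"
  shows "T_nat (assembled T n u v K)"
proof -
  have A: "simple_graph T" "simple_graph K" "verts T \<inter> verts K = {}" "{u 0, v 0} \<in> edges K"
    "{u n, v n} \<in> edges T" "distinct_rails {..n} u v"
    "(u ` {1..<n} \<union> v ` {1..<n}) \<inter> (verts T \<union> verts K) = {}" "n \<ge> 1"
    using a by (auto simp: assembly_def)
  note D = distinct_railsD[OF A(6)]
  note e0 = simple_edgeD[OF A(2,4)] and en = simple_edgeD[OF A(1,5)]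
  define F where "F = verts T \<union> verts K \<union> u ` {..n} \<union> v ` {..n}"
  have "finite F" using A(1,2) by (auto simp: F_def simple_graph_def)
  then obtain m where "\<forall>x\<in>F. x < m" using finite_nat_set_iff_bounded by blast
  then have m: "x < m" if "x \<in> F" for x using that by blast
  have mT: "x < m" if "x \<in> verts T" for x using m that by (simp add: F_def)
  have mK: "x < m" if "x \<in> verts K" for x using m that by (simp add: F_def)
  have mu: "u i < m" "v i < m" if "i \<le> n" for i using m that by (simp_all add: F_def)
  \<comment> \<open>Splicing renames \<open>u n, v n\<close> in the ladder and \<open>u 0, v 0\<close> in \<open>K\<close>, so these need fresh names.\<close>
  define u' v' where "u' = u(n := m)" and "v' = v(n := m + 1)"
  define h where "h = id(u 0 := m + 2, v 0 := m + 3)"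
  define L where "L = ladder_on n u' v'"
  define K' where "K' = rename h K"
  have d': "distinct_rails {..n} u' v'"
    unfolding distinct_rails_def u'_def v'_def
  proof (intro conjI inj_onI)
    fix i j assume "i \<in> {..n}" "j \<in> {..n}" "(u(n := m)) i = (u(n := m)) j"
    then show "i = j" using D(1)[of i j] mu(1)[of i] mu(1)[of j] by (auto split: if_splits)
  next
    fix i j assume "i \<in> {..n}" "j \<in> {..n}" "(v(n := m + 1)) i = (v(n := m + 1)) j"
    then show "i = j" using D(2)[of i j] mu(2)[of i] mu(2)[of j] by (auto split: if_splits)
  next
    have "(u(n := m)) i \<noteq> (v(n := m + 1)) j" if "i \<le> n" "j \<le> n" for i j
      using D(3)[of i j] mu(1)[of i] mu(2)[of j] that by auto
    then show "(u(n := m)) ` {..n} \<inter> (v(n := m + 1)) ` {..n} = {}" by blast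
  qed
  have injh: "inj_on h (verts K)"
  proof (rule inj_onI)
    fix x y assume "x \<in> verts K" "y \<in> verts K" "h x = h y"
    then show "x = y" using mK[of x] mK[of y] e0(3) by (auto simp: h_def split: if_splits)
  qed
  have hv: "h ` verts K \<subseteq> (verts K - {u 0, v 0}) \<union> {m + 2, m + 3}"
    by (auto simp: h_def)
  have LV: "verts L \<subseteq> u ` {..<n} \<union> v ` {..<n} \<union> {m, m + 1}"
    by (auto simp: L_def ladder_on_def u'_def v'_def)
  have uvlt: "u i = u 0 \<or> u i \<notin> verts K" "v i = v 0 \<or> v i \<notin> verts K" "u i \<notin> verts T" "v i \<notin> verts T"
    if "i < n" for i
  proof -
    have "i = 0 \<or> i \<in> {1..<n}" using that by auto
    then have "(u i = u 0 \<or> u i \<notin> verts K) \<and> (v i = v 0 \<or> v i \<notin> verts K) \<and> u i \<notin> verts T \<and> v i \<notin> verts T"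
      using A(3,7) e0 by (elim disjE) (simp, blast+)
    then show "u i = u 0 \<or> u i \<notin> verts K" "v i = v 0 \<or> v i \<notin> verts K" "u i \<notin> verts T" "v i \<notin> verts T"
      by auto
  qed
  have TL: "verts T \<inter> verts L = {}"
  proof -
    have "x \<notin> verts T" if xL: "x \<in> verts L" for x
    proof -
      consider i where "i < n" "x = u i" | i where "i < n" "x = v i" | "x = m \<or> x = m + 1"
        using LV xL by blast
      then show ?thesis
      proof cases
        case 1 then show ?thesis using uvlt(3) by simp
      next
        case 2 then show ?thesis using uvlt(4) by simp
      next
        case 3 then show ?thesis using mT[of x] by auto
      qed
    qed
    then show ?thesis by blast
  qed
  have TK: "verts T \<inter> verts K' = {}"
  proof -
    have big: "m + 2 \<notin> verts T" "m + 3 \<notin> verts T" using mT[of "m + 2"] mT[of "m + 3"] by auto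
    have "x \<notin> verts T" if "x \<in> h ` verts K" for x
    proof -
      have "x \<in> verts K \<or> x = m + 2 \<or> x = m + 3" using subsetD[OF hv that] by blast
      then show ?thesis
      proof (elim disjE)
        assume "x \<in> verts K" then show ?thesis using A(3) by blast
      next
        assume "x = m + 2" then show ?thesis using big(1) by simp
      next
        assume "x = m + 3" then show ?thesis using big(2) by simp
      qed
    qed
    then show ?thesis unfolding K'_def rename_def sgraph.simps by blast
  qed
  have LK: "verts L \<inter> verts K' = {}"
  proof -
    have "x \<notin> verts K'" if xL: "x \<in> verts L" for x
    proof
      assume "x \<in> verts K'"
      then have "x \<in> h ` verts K" by (simp add: K'_def rename_def)
      then have x: "x \<in> verts K - {u 0, v 0} \<or> x = m + 2 \<or> x = m + 3" using subsetD[OF hv] by blast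
      consider i where "i < n" "x = u i" | i where "i < n" "x = v i" | "x = m \<or> x = m + 1"
        using LV xL by blast
      then show False
      proof cases
        case 1 then show ?thesis using x uvlt(1)[of i] mu(1)[of i] by auto
      next
        case 2 then show ?thesis using x uvlt(2)[of i] mu(2)[of i] by auto
      next
        case 3 then show ?thesis using x mK[of x] by auto
      qed
    qed
    then show ?thesis by blast
  qed
  have sK': "simple_graph K'" unfolding K'_def by (rule simple_rename[OF A(2) injh])
  have h0: "h (u 0) = m + 2" "h (v 0) = m + 3" using e0 by (simp_all add: h_def)
  have g: "{m + 2, m + 3} \<in> edges K'"
  proof -
    have "h ` {u 0, v 0} \<in> edges K'" unfolding K'_def rename_def sgraph.simps using A(4) by (rule imageI)
    then show ?thesis using h0 by simp
  qed
  note eq = splice_eq(1)[OF A(8) d' L_def A(1) sK' TL TK LK g A(5)]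
  \<comment> \<open>The inner splice maps the fresh names back to \<open>u 0, v 0\<close> and so
    undoes \<open>h\<close>.\<close>
  have "rename (id(m + 2 := u' 0, m + 3 := v' 0)) K' = rename (\<lambda>v. v) K"
    unfolding K'_def rename_comp
  proof (rule rename_cong[OF A(2)])
    fix x assume "x \<in> verts K"
    then show "(id(m + 2 := u' 0, m + 3 := v' 0) \<circ> h) x = x"
      using mK[of x] A(8) by (auto simp: h_def u'_def v'_def)
  qed
  then have eq': "splice_edges T (u n, v n) (splice_edges L (u' 0, v' 0) K' (m + 2, m + 3)) (u' n, v' n) = assembled T n u v K"
    using eq by (simp add: rename_id u'_def v'_def)
  have iL: "isomorphic L (ladder n)" unfolding isomorphic_ladder_iff L_def using d' by blast
  have iK: "isomorphic K' (complete_bipartite 3 3)"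
    using isomorphic_trans[OF isomorphic_sym[OF isomorphic_rename[OF A(2) injh]] K] by (simp add: K'_def)
  have x: "is_22_edge L (u' 0) (v' 0)" "is_22_edge L (u' n) (v' n)"
    unfolding L_def using is_22_edge_ladder_on[OF d' A(8)] by auto
  have xy: "{u' 0, v' 0} \<inter> {u' n, v' n} = {}"
    using distinct_railsD[OF d', of 0 n] distinct_railsD[OF d', of n 0] A(8) by auto
  show ?thesis
    using T_nat.splice[OF T A(8) iL iK TL TK LK x xy g A(5)] eq' by simp
qed

lemma rename_assembled:
  assumes a: "assembly T n u v K" and f: "inj_on f (verts (assembled T n u v K))"
  shows "rename f (assembled T n u v K) = assembled (rename f T) n (f \<circ> u) (f \<circ> v) (rename f K)"
    "assembly (rename f T) n (f \<circ> u) (f \<circ> v) (rename f K)"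
proof -
  let ?V = "verts (assembled T n u v K)"
  have A: "simple_graph T" "simple_graph K" "verts T \<inter> verts K = {}" "{u 0, v 0} \<in> edges K"
    "{u n, v n} \<in> edges T" "distinct_rails {..n} u v"
    "(u ` {1..<n} \<union> v ` {1..<n}) \<inter> (verts T \<union> verts K) = {}" "n \<ge> 1"
    using a by (auto simp: assembly_def)
  note e0 = simple_edgeD[OF A(2,4)] and en = simple_edgeD[OF A(1,5)]
  have sub: "verts T \<subseteq> ?V" "verts K \<subseteq> ?V" "u ` {1..<n} \<subseteq> ?V" "v ` {1..<n} \<subseteq> ?V"
    by (auto simp: assembled_def)
  have injT: "inj_on f (verts T)" and injK: "inj_on f (verts K)" using f sub inj_on_subset by blast+
  have "{..n} = insert 0 (insert n {1..<n})" using A(8) by auto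
  then have uV: "u ` {..n} \<subseteq> ?V" "v ` {..n} \<subseteq> ?V" using e0 en sub by auto
  have img: "(`) f ` (edges S - {e}) = (`) f ` edges S - {f ` e}"
    if S: "simple_graph S" "inj_on f (verts S)" "e \<in> edges S" for S e
  proof -
    have "inj_on ((`) f) (edges S)"
    proof (rule inj_onI)
      fix x y assume "x \<in> edges S" "y \<in> edges S" "f ` x = f ` y"
      then show "x = y"
        using inj_on_image_eq_iff[OF S(2)] simple_edge_subset[OF S(1)] by blast
    qed
    then show ?thesis using S(3) inj_on_image_set_diff[of "(`) f" "edges S" "edges S" "{e}"] by simp
  qed
  have r: "(`) f ` rails n u v = rails n (f \<circ> u) (f \<circ> v)" by (simp add: rails_def image_Un image_image)
  show "rename f (assembled T n u v K) = assembled (rename f T) n (f \<circ> u) (f \<circ> v) (rename f K)"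
    using img[OF A(1) injT A(5)] img[OF A(2) injK A(4)] r
    by (simp add: assembled_def rename_def image_Un image_image)
  have disj: "f ` X \<inter> f ` Y = {}" if "X \<inter> Y = {}" "X \<subseteq> ?V" "Y \<subseteq> ?V" for X Y
    using inj_on_image_Int[OF f that(2,3)] that(1) by simp
  show "assembly (rename f T) n (f \<circ> u) (f \<circ> v) (rename f K)"
    unfolding assembly_def
  proof (intro conjI)
    show "simple_graph (rename f T)" "simple_graph (rename f K)"
      using simple_rename A(1,2) injT injK by blast+
    show "verts (rename f T) \<inter> verts (rename f K) = {}"
      using disj[OF A(3) sub(1,2)] by (simp add: rename_def)
    have "f ` {u 0, v 0} \<in> edges (rename f K)" "f ` {u n, v n} \<in> edges (rename f T)"
      unfolding rename_def sgraph.simps using A(4,5) by (auto intro: imageI simp del: image_insert)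
    then show "{(f \<circ> u) 0, (f \<circ> v) 0} \<in> edges (rename f K)" "{(f \<circ> u) n, (f \<circ> v) n} \<in> edges (rename f T)"
      by simp_all
    show "distinct_rails {..n} (f \<circ> u) (f \<circ> v)"
      unfolding distinct_rails_def
    proof (intro conjI comp_inj_on)
      show "inj_on u {..n}" "inj_on v {..n}" using A(6) by (auto simp: distinct_rails_def)
      show "inj_on f (u ` {..n})" "inj_on f (v ` {..n})" using f uV inj_on_subset by blast+
      show "(f \<circ> u) ` {..n} \<inter> (f \<circ> v) ` {..n} = {}"
        unfolding image_comp[symmetric] using A(6) uV by (intro disj) (auto simp: distinct_rails_def)
    qed
    have "f ` (u ` {1..<n} \<union> v ` {1..<n}) \<inter> f ` (verts T \<union> verts K) = {}"
      using A(7) sub by (intro disj) auto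
    then show "((f \<circ> u) ` {1..<n} \<union> (f \<circ> v) ` {1..<n}) \<inter> (verts (rename f T) \<union> verts (rename f K)) = {}"
      by (simp add: rename_def image_Un image_image)
  qed (rule A(8))
qed

text \<open>The vertices of \<open>T\<close> keep the numbers of the given copy \<open>T0\<close>,
  and all others are numbered from \<open>m\<close> upwards, above that copy. So the renamed graph
  is assembled from \<open>T0\<close> itself.\<close>

lemma in_class_T_assembled:
  assumes T: "in_class_T T" and a: "assembly T n u v K" and K: "isomorphic K (complete_bipartite 3 3)"
  shows "in_class_T (assembled T n u v K)"
proof -
  let ?H = "assembled T n u v K"
  have sH: "simple_graph ?H" by (rule simple_assembled[OF a])
  have sK: "simple_graph K" and sT: "simple_graph T" using a by (auto simp: assembly_def)
  obtain T0 where T0: "T_nat T0" "isomorphic T T0" using T by (auto simp: in_class_T_def)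
  obtain f where f: "inj_on f (verts T)" "T0 = rename f T" using T0(2) by (rule isomorphicE)
  have "finite (f ` verts T)" using sT by (simp add: simple_graph_def)
  then obtain m where m: "\<forall>x\<in>f ` verts T. x < m" using finite_nat_set_iff_bounded by blast
  have "finite (verts ?H)" using sH by (simp add: simple_graph_def)
  then obtain g :: "'a \<Rightarrow> nat" where g: "inj_on g (verts ?H)" using finite_imp_inj_to_nat_seg by metis
  define h where "h x = (if x \<in> verts T then f x else m + g x)" for x
  have inj: "inj_on h (verts ?H)"
  proof (rule inj_onI)
    fix x y assume xy: "x \<in> verts ?H" "y \<in> verts ?H" "h x = h y"
    have lt: "z \<in> verts T \<Longrightarrow> f z < m" for z using m by blast
    show "x = y"
      using xy lt[of x] lt[of y] inj_onD[OF f(1), of x y] inj_onD[OF g, of x y]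
      by (auto simp: h_def split: if_splits)
  qed
  have hT: "rename h T = T0" unfolding f(2) by (intro rename_cong[OF sT]) (simp add: h_def)
  have injK: "inj_on h (verts K)" using inj by (rule inj_on_subset) (auto simp: assembled_def)
  have "isomorphic (rename h K) (complete_bipartite 3 3)"
    using isomorphic_trans[OF isomorphic_sym[OF isomorphic_rename[OF sK injK]] K] .
  then have "T_nat (rename h ?H)"
    unfolding rename_assembled(1)[OF a inj]
    using T_nat_assembled rename_assembled(2)[OF a inj] T0(1) hT by metis
  then show ?thesis using isomorphic_rename[OF sH inj] by (auto simp: in_class_T_def)
qed

lemma in_class_T_K33:
  assumes "isomorphic H (complete_bipartite 3 3)" shows "in_class_T H"
proof -
  have s: "simple_graph H" using assms by (simp add: isomorphic_def)
  then have "finite (verts H)" by (simp add: simple_graph_def)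
  then obtain g :: "'a \<Rightarrow> nat" where g: "inj_on g (verts H)" using finite_imp_inj_to_nat_seg by metis
  note iso = isomorphic_rename[OF s g]
  have "isomorphic (rename g H) (complete_bipartite 3 3)"
    by (rule isomorphic_trans[OF isomorphic_sym[OF iso] assms])
  then show ?thesis using T_nat.K33 iso by (auto simp: in_class_T_def)
qed

lemma (in cubic_bipartite) isomorphic_K33:
  assumes "card A = 3" shows "isomorphic G (complete_bipartite 3 3)"
proof -
  have cB: "card B = 3" using assms card_A_eq_B by simp
  \<comment> \<open>\<open>B\<close> has only three vertices, so every neighbourhood fills
    it.\<close>
  have nb: "nbhd G a = B" if "a \<in> A" for a
    using card_subset_eq[OF finite_B nbhd_A[OF that]] card_nbhd[of a] that cB by simp
  obtain g where g: "bij_betw g A {..<3::nat}"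
    using finite_same_card_bij[OF finite_A, of "{..<3::nat}"] assms by auto
  obtain h where h: "bij_betw h B {..<3::nat}"
    using finite_same_card_bij[OF finite_B, of "{..<3::nat}"] cB by auto
  define f where "f x = (if x \<in> A then Inl (g x) else Inr (h x))" for x
  have fA: "f a = Inl (g a)" if "a \<in> A" for a using that by (simp add: f_def)
  have fB: "f b = Inr (h b)" if "b \<in> B" for b using that disj by (auto simp: f_def)
  have "inj_on f (A \<union> B)"
  proof (rule inj_onI)
    fix x y assume "x \<in> A \<union> B" "y \<in> A \<union> B" "f x = f y"
    then show "x = y"
      using g h unfolding bij_betw_def f_def inj_on_def by (auto split: if_splits)
  qed
  then have inj: "inj_on f (verts G)" using verts_eq by simp
  have "f ` verts G = {..<3} <+> {..<3}"
  proof -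
    have "f ` A = Inl ` {..<3}" "f ` B = Inr ` {..<3}"
      using fA fB g h by (simp_all add: bij_betw_def image_image[symmetric])
    then show ?thesis using verts_eq by (simp add: image_Un Plus_def)
  qed
  moreover have "(`) f ` edges G = {{Inl i, Inr j} | i j. i < 3 \<and> j < 3}"
  proof (intro equalityI subsetI)
    fix e assume "e \<in> (`) f ` edges G"
    then obtain e' where e': "e' \<in> edges G" "e = f ` e'" by blast
    then obtain a b where ab: "a \<in> A" "b \<in> B" "e' = {a, b}" by (elim edge_obtain)
    then have "e = {Inl (g a), Inr (h b)}" using e' fA fB by simp
    moreover have "g a < 3" "h b < 3" using ab g h by (auto simp: bij_betw_def)
    ultimately show "e \<in> {{Inl i, Inr j} | i j. i < 3 \<and> j < 3}" by blast
  next
    fix e :: "(nat + nat) set" assume "e \<in> {{Inl i, Inr j} | i j. i < 3 \<and> j < 3}"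
    then obtain i j where ij: "e = {Inl i, Inr j}" "i < 3" "j < 3" by blast
    obtain a where a: "a \<in> A" "g a = i" using g ij(2) unfolding bij_betw_def by (metis imageE lessThan_iff)
    obtain b where b: "b \<in> B" "h b = j" using h ij(3) unfolding bij_betw_def by (metis imageE lessThan_iff)
    have "{b, a} \<in> edges G" using nb[OF a(1)] b(1) unfolding nbhd_def by blast
    moreover have "f ` {b, a} = e" using a b fA fB ij(1) by auto
    ultimately show "e \<in> (`) f ` edges G" by blast
  qed
  ultimately have "rename f G = complete_bipartite 3 3" by (simp add: rename_def complete_bipartite_def)
  then show ?thesis using isomorphic_rename[OF simple inj] by simp
qed

text \<open>A ladder growing out of \<open>W\<close>, described by its cuts alone. Rungs 0 and
  \<open>n\<close> are left open: whether \<open>{u n, v n}\<close> is an edge decides if the chain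
  can be prolonged.\<close>

definition chain :: "'a sgraph \<Rightarrow> 'a set \<Rightarrow> nat \<Rightarrow> (nat \<Rightarrow> 'a) \<Rightarrow> (nat \<Rightarrow> 'a) \<Rightarrow> bool" where
  "chain G W n u v \<longleftrightarrow>
     (\<forall>i<n. two_cut G (strand W u v i) (u i) (v i) (u (Suc i)) (v (Suc i))) \<and>
     (\<forall>i. 1 \<le> i \<and> i < n \<longrightarrow> {u i, v i} \<in> edges G)"

lemma strand_upd: "i \<le> n \<Longrightarrow> strand W (u(Suc n := p)) (v(Suc n := q)) i = strand W u v i"
proof -
  assume "i \<le> n"
  then have "(w(Suc n := z)) ` {1..i} = w ` {1..i}" for w :: "nat \<Rightarrow> 'a" and z
    by (intro image_cong) auto
  then show ?thesis by (simp add: strand_def)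
qed

context cubic_bipartite
begin

text \<open>If the last two ends are adjacent, they form a rung that \<open>peel_two_cut\<close>
  removes from the far side of the last cut. Taking complements again gives the next strand.\<close>

lemma chain_extend:
  assumes n: "n \<ge> 1" and c: "chain G W n u v" and e: "{u n, v n} \<in> edges G"
  shows "\<exists>p q. chain G W (Suc n) (u(Suc n := p)) (v(Suc n := q))"
proof -
  obtain k where k: "n = Suc k" using n by (cases n) auto
  let ?S = "strand W u v k"
  have cut: "two_cut G ?S (u k) (v k) (u n) (v n)" using c k by (simp add: chain_def)
  obtain p q where "two_cut G (verts G - ?S - {u n, v n}) p q (u n) (v n)"
    using peel_two_cut[OF two_cut_compl[OF cut] e] by blast
  then have "two_cut G (verts G - (verts G - ?S - {u n, v n})) (u n) (v n) p q" by (rule two_cut_compl)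
  moreover have "verts G - (verts G - ?S - {u n, v n}) = strand W u v n"
    unfolding k strand_Suc using two_cutD[OF cut] k by auto
  ultimately have new: "two_cut G (strand W u v n) (u n) (v n) p q" by simp
  have "chain G W (Suc n) (u(Suc n := p)) (v(Suc n := q))"
    unfolding chain_def
  proof (intro conjI allI impI)
    fix i assume "i < Suc n"
    then have "i = n \<or> i < n" by auto
    then show "two_cut G (strand W (u(Suc n := p)) (v(Suc n := q)) i) ((u(Suc n := p)) i) ((v(Suc n := q)) i)
      ((u(Suc n := p)) (Suc i)) ((v(Suc n := q)) (Suc i))"
      using new c by (elim disjE) (simp_all add: strand_upd chain_def)
  next
    fix i assume "1 \<le> i \<and> i < Suc n"
    then have "i = n \<or> 1 \<le> i \<and> i < n" by auto
    then show "{(u(Suc n := p)) i, (v(Suc n := q)) i} \<in> edges G"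
      using c e by (elim disjE) (simp_all add: chain_def)
  qed
  then show ?thesis by blast
qed

text \<open>Each strand contains a vertex that the previous one misses. This bounds the length of a
  chain.\<close>

lemma chain_card:
  assumes c: "chain G W n u v" and i: "i < n" shows "i \<le> card (strand W u v i)"
  using i
proof (induction i)
  case (Suc i)
  have cut: "two_cut G (strand W u v j) (u j) (v j) (u (Suc j)) (v (Suc j))" if "j < n" for j
    using c that by (simp add: chain_def)
  have fin: "finite (strand W u v j)" if "j < n" for j
    using two_cutD(1)[OF cut[OF that]] finite_verts finite_subset by blast
  have "i < n" using Suc by simp
  have "u (Suc i) \<notin> strand W u v i" using two_cutD(6)[OF cut[OF \<open>i < n\<close>]] .
  then have "Suc (card (strand W u v i)) = card (insert (u (Suc i)) (strand W u v i))"
    using fin[OF \<open>i < n\<close>] by simp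
  also have "\<dots> \<le> card (strand W u v (Suc i))"
    using fin[OF Suc.prems] by (intro card_mono) (auto simp: strand_Suc)
  finally show ?case using Suc by simp
qed simp

text \<open>A chain that never met a nonadjacent pair of ends could be prolonged for ever, contrary
  to finiteness.\<close>

lemma chain_exists:
  assumes c: "two_cut G W x y x' y'"
  obtains n u v where "n \<ge> 1" "chain G W n u v" "u 0 = x" "v 0 = y" "{u n, v n} \<notin> edges G"
proof (rule ccontr)
  note found = that
  assume "\<not> thesis"
  then have neg: "{u n, v n} \<in> edges G" if "n \<ge> 1" "chain G W n u v" "u 0 = x" "v 0 = y" for n u v
    using that found[of n u v] by blast
  have ex: "\<exists>u v. chain G W (Suc n) u v \<and> u 0 = x \<and> v 0 = y" for n
  proof (induction n)
    case 0
    have "chain G W (Suc 0) (\<lambda>i. if i = 0 then x else x') (\<lambda>i. if i = 0 then y else y')"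
      using c by (simp add: chain_def strand_0)
    then show ?case by (intro exI[of _ "\<lambda>i. if i = 0 then x else x'"] exI[of _ "\<lambda>i. if i = 0 then y else y'"]) simp
  next
    case (Suc n)
    then obtain u v where uv: "chain G W (Suc n) u v" "u 0 = x" "v 0 = y" by blast
    then have "{u (Suc n), v (Suc n)} \<in> edges G" using neg by simp
    then obtain p q where ch: "chain G W (Suc (Suc n)) (u(Suc (Suc n) := p)) (v(Suc (Suc n) := q))"
      using chain_extend[OF _ uv(1)] by auto
    then show ?case
      using uv by - (rule exI[of _ "u(Suc (Suc n) := p)"], rule exI[of _ "v(Suc (Suc n) := q)"],
        intro conjI, rule ch, simp_all)
  qed
  \<comment> \<open>The length \<open>card (verts G) + 2\<close> makes index
    \<open>card (verts G) + 1\<close> admissible in \<open>chain_card\<close>, where the strand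
    would have too many vertices.\<close>
  obtain u v where ch: "chain G W (Suc (Suc (card (verts G)))) u v" using ex by blast
  let ?i = "Suc (card (verts G))"
  have "?i \<le> card (strand W u v ?i)" using chain_card[OF ch] by simp
  moreover have "strand W u v ?i \<subseteq> verts G"
    using ch two_cutD(1) unfolding chain_def by (metis lessI)
  then have "card (strand W u v ?i) \<le> card (verts G)" using finite_verts by (rule card_mono[rotated])
  ultimately show False by simp
qed

text \<open>Nonadjacency at both ends makes the closing edges of \<open>K\<close> and
  \<open>T\<close> new, so deleting them in \<open>assembled\<close> gives back exactly the edges of
  \<open>G\<close> on the two outer sides.\<close>

lemma chain_assembled:
  assumes n: "n \<ge> 1" and c: "chain G W n u v"
    and e0: "{u 0, v 0} \<notin> edges G" and en: "{u n, v n} \<notin> edges G"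
  defines "T \<equiv> reduct G (verts G - strand W u v (n - 1)) (u n) (v n)" and "K \<equiv> reduct G W (u 0) (v 0)"
  shows "assembly T n u v K" "G = assembled T n u v K"
proof -
  let ?S = "strand W u v"
  have cut: "two_cut G (?S i) (u i) (v i) (u (Suc i)) (v (Suc i))" if "i < n" for i
    using c that by (simp add: chain_def)
  note D = two_cutD[OF cut]
  have cut0: "two_cut G W (u 0) (v 0) (u (Suc 0)) (v (Suc 0))" using cut[of 0] n by (simp add: strand_0)
  have cutn: "two_cut G (verts G - ?S (n - 1)) (u n) (v n) (u (n - 1)) (v (n - 1))"
    using two_cut_compl[OF cut[of "n - 1"]] n by simp
  have sT: "simple_graph T" and sK: "simple_graph K"
    using cubic_bipartite.simple[OF reduct_cubic_bipartite[OF cutn en]]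
      cubic_bipartite.simple[OF reduct_cubic_bipartite[OF cut0 e0]] by (simp_all add: T_def K_def)
  have mono: "?S i \<subseteq> ?S j" if "i \<le> j" for i j using that by (fastforce simp: strand_def)
  have "\<exists>k. n = Suc k" using n by (cases n) auto
  then obtain k where k: "n = Suc k" by blast
  have inS: "u i \<in> ?S j" "v i \<in> ?S j" if "i \<le> j" "i < n" for i j
    using D(2,3)[of i] mono[of i j] that by auto
  have notS: "u j \<notin> ?S i" "v j \<notin> ?S i" if "i < j" "j \<le> n" for i j
  proof -
    have "\<exists>l. j = Suc l" using that(1) by (cases j) auto
    then obtain l where l: "j = Suc l" by blast
    then show "u j \<notin> ?S i" "v j \<notin> ?S i"
      using D(6,8)[of l] mono[of i l] that by auto
  qed
  \<comment> \<open>Nesting yields distinctness: the earlier vertex lies in strand \<open>i\<close>,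
    the later one does not.\<close>
  have neq: "u i \<noteq> u j" "v i \<noteq> v j" "u i \<noteq> v j" "v i \<noteq> u j" if "i < j" "j \<le> n" for i j
    using inS[of i i] notS[of i j] that by auto
  have same: "u i \<noteq> v i" if "i \<le> n" for i
  proof (cases "i = n")
    case True
    then show ?thesis using D(9)[of k] k by simp
  next
    case False
    then show ?thesis using D(4)[of i] that by simp
  qed
  have dr: "distinct_rails {..n} u v"
    unfolding distinct_rails_def
  proof (intro conjI inj_onI)
    fix i j assume "i \<in> {..n}" "j \<in> {..n}" "u i = u j"
    then show "i = j" using neq(1)[of i j] neq(1)[of j i] by (cases i j rule: linorder_cases) auto
  next
    fix i j assume "i \<in> {..n}" "j \<in> {..n}" "v i = v j"
    then show "i = j" using neq(2)[of i j] neq(2)[of j i] by (cases i j rule: linorder_cases) auto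
  next
    have "u i \<noteq> v j" if "i \<le> n" "j \<le> n" for i j
      using neq(3)[of i j] neq(4)[of j i] same[of i] that by (cases i j rule: linorder_cases) auto
    then show "u ` {..n} \<inter> v ` {..n} = {}" by blast
  qed
  have vT: "verts T = verts G - ?S k" and vK: "verts K = W" by (simp_all add: T_def K_def reduct_def k)
  have WS: "W \<subseteq> ?S i" for i unfolding strand_def by blast
  show "assembly T n u v K"
    unfolding assembly_def
  proof (intro conjI)
    show "verts T \<inter> verts K = {}" using vT vK WS[of k] by auto
    show "{u 0, v 0} \<in> edges K" "{u n, v n} \<in> edges T" by (simp_all add: K_def T_def reduct_def)
    show "(u ` {1..<n} \<union> v ` {1..<n}) \<inter> (verts T \<union> verts K) = {}"
    proof -
      have "u i \<in> ?S k \<and> v i \<in> ?S k \<and> u i \<notin> W \<and> v i \<notin> W" if "i \<in> {1..<n}" for i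
        using inS[of i k] notS[of 0 i] that k by (simp add: strand_0)
      then show ?thesis using vT vK by blast
    qed
  qed (use n sT sK dr in auto)
  \<comment> \<open>Each further strand adds the two cut edges and the rung that closes them; no
    other edge crosses the cut.\<close>
  have inner: "{e \<in> edges G. e \<subseteq> ?S i} = {e \<in> edges G. e \<subseteq> W} \<union> rails i u v \<union> (\<lambda>i. {u i, v i}) ` {1..i}"
    if "i < n" for i
    using that
  proof (induction i)
    case 0
    show ?case by (simp add: strand_0 rails_def)
  next
    case (Suc i)
    have i: "i < n" using Suc.prems by simp
    let ?N = "{{u i, u (Suc i)}, {v i, v (Suc i)}, {u (Suc i), v (Suc i)}}"
    have rung: "{u (Suc i), v (Suc i)} \<in> edges G" using c Suc.prems by (simp add: chain_def)
    have "{e \<in> edges G. e \<subseteq> ?S (Suc i)} = {e \<in> edges G. e \<subseteq> ?S i} \<union> ?N"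
    proof (intro equalityI subsetI)
      fix e assume "e \<in> {e \<in> edges G. e \<subseteq> ?S (Suc i)}"
      then have e: "e \<in> edges G" "e \<subseteq> ?S i \<union> {u (Suc i), v (Suc i)}" by (auto simp: strand_Suc)
      obtain p q where pq: "e = {p, q}" using edge_obtain[OF e(1)] by metis
      have pqG: "{p, q} \<in> edges G" "{q, p} \<in> edges G" using e(1) pq by (simp_all add: insert_commute)
      have ne: "p \<noteq> q" using pqG(1) no_loop by metis
      have V: "p \<in> verts G" "q \<in> verts G" using edge_verts[OF pqG(1)] by auto
      consider "p \<in> ?S i" "q \<in> ?S i" | "p \<in> ?S i" "q \<notin> ?S i" | "p \<notin> ?S i" "q \<in> ?S i"
        | "p \<notin> ?S i" "q \<notin> ?S i" by blast
      then show "e \<in> {e \<in> edges G. e \<subseteq> ?S i} \<union> ?N"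
      proof cases
        case 1 then show ?thesis using e(1) pq by simp
      next
        case 2 then show ?thesis using D(12)[OF i 2(1) V(2) 2(2) pqG(1)] pq by auto
      next
        case 3 then show ?thesis using D(12)[OF i 3(2) V(1) 3(1) pqG(2)] pq by (auto simp: insert_commute)
      next
        case 4
        then have "p \<in> {u (Suc i), v (Suc i)}" "q \<in> {u (Suc i), v (Suc i)}" using e(2) pq by auto
        then have "e = {u (Suc i), v (Suc i)}" using ne pq by blast
        then show ?thesis by simp
      qed
    next
      fix e assume "e \<in> {e \<in> edges G. e \<subseteq> ?S i} \<union> ?N"
      then show "e \<in> {e \<in> edges G. e \<subseteq> ?S (Suc i)}"
        using D(2,3,10,11)[OF i] rung by (auto simp: strand_Suc)
    qed
    then show ?case unfolding Suc.IH[OF i]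
      by (simp add: rails_def lessThan_Suc atLeastAtMostSuc_conv) blast
  qed
  have kn: "k < n" using k by simp
  have "edges G = {e \<in> edges G. e \<subseteq> ?S k} \<union> {e \<in> edges G. e \<subseteq> verts G - ?S k} \<union> {{u k, u n}, {v k, v n}}"
  proof (intro equalityI subsetI)
    fix e assume e: "e \<in> edges G"
    obtain p q where pq: "e = {p, q}" using edge_obtain[OF e] by metis
    have pqG: "{p, q} \<in> edges G" "{q, p} \<in> edges G" using e pq by (simp_all add: insert_commute)
    have V: "p \<in> verts G" "q \<in> verts G" using edge_verts[OF pqG(1)] by auto
    consider "p \<in> ?S k" "q \<in> ?S k" | "p \<in> ?S k" "q \<notin> ?S k" | "p \<notin> ?S k" "q \<in> ?S k"
      | "p \<notin> ?S k" "q \<notin> ?S k" by blast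
    then show "e \<in> {e \<in> edges G. e \<subseteq> ?S k} \<union> {e \<in> edges G. e \<subseteq> verts G - ?S k} \<union> {{u k, u n}, {v k, v n}}"
    proof cases
      case 1 then show ?thesis using e pq by simp
    next
      case 2 then show ?thesis using D(12)[OF kn 2(1) V(2) 2(2) pqG(1)] pq k by auto
    next
      case 3 then show ?thesis using D(12)[OF kn 3(2) V(1) 3(1) pqG(2)] pq k by (auto simp: insert_commute)
    next
      case 4 then show ?thesis using e pq V by simp
    qed
  next
    fix e assume "e \<in> {e \<in> edges G. e \<subseteq> ?S k} \<union> {e \<in> edges G. e \<subseteq> verts G - ?S k} \<union> {{u k, u n}, {v k, v n}}"
    then show "e \<in> edges G" using D(10,11)[OF kn] k by auto
  qed
  moreover have "edges T - {{u n, v n}} = {e \<in> edges G. e \<subseteq> verts G - ?S k}"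
    using en by (auto simp: T_def reduct_def k)
  moreover have "edges K - {{u 0, v 0}} = {e \<in> edges G. e \<subseteq> W}"
    using e0 by (auto simp: K_def reduct_def)
  moreover have "{1..<n} = {1..k}" using k by auto
  moreover have "rails n u v = rails k u v \<union> {{u k, u n}, {v k, v n}}"
    unfolding k by (simp add: rails_def lessThan_Suc) blast
  ultimately have eG: "edges G = edges (assembled T n u v K)"
    using inner[OF kn] by (simp add: assembled_def) blast
  have vG: "verts G = verts (assembled T n u v K)"
  proof -
    have "?S k = verts K \<union> u ` {1..<n} \<union> v ` {1..<n}"
      using k by (simp add: strand_def vK atLeastLessThanSuc_atLeastAtMost)
    moreover have "?S k \<subseteq> verts G" using D(1)[OF kn] .
    ultimately show ?thesis unfolding assembled_def using vT by auto
  qed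
  show "G = assembled T n u v K" using eG vG by (cases G) (simp add: assembled_def)
qed

end

section \<open>From bounded nice pair sets to the class\<close>

context connected_cubic_bipartite
begin

lemma nice_pair_set_reduct:
  assumes c: "two_cut G W x y x' y'" and xy: "{x, y} \<notin> edges G"
    and N: "nice_pair_set (reduct G W x y) (W \<inter> A) (W \<inter> B) A' B'"
  shows "nice_pair_set G A B A' B'"
  unfolding nice_pair_set_def
proof (intro conjI ballI)
  have sub: "A' \<subseteq> W \<inter> A" "B' \<subseteq> W \<inter> B" using N by (auto simp: nice_pair_set_def)
  then show "A' \<subseteq> A" "B' \<subseteq> B" by auto
  fix a b assume ab: "a \<in> A'" "b \<in> B'"
  then have "nice_pair (reduct G W x y) a b" using N by (simp add: nice_pair_set_def)
  then show "nice_pair G a b" using nice_pair_reduct[OF c xy] sub ab by blast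
qed

text \<open>With two-edge cuts present, the reduct of a smallest side has none, and its nice pairs
  are nice in \<open>G\<close>.\<close>

lemma nice_set_exists: "\<exists>A' B'. nice_pair_set G A B A' B' \<and> 3 \<le> card A' \<and> 3 \<le> card B'"
proof (cases "no_two_cut G")
  case True
  then show ?thesis using nice_set_of_no_two_cut by blast
next
  case False
  then obtain W x y x' y' where c: "two_cut G W x y x' y'" "{x, y} \<notin> edges G" "no_two_cut (reduct G W x y)"
    by (rule leaf_two_cut)
  interpret H: connected_cubic_bipartite "reduct G W x y" "W \<inter> A" "W \<inter> B"
    by (rule reduct_connected[OF c(1,2)])
  obtain A' B' where "nice_pair_set (reduct G W x y) (W \<inter> A) (W \<inter> B) A' B'" "3 \<le> card A'" "3 \<le> card B'"
    using H.nice_set_of_no_two_cut[OF c(3)] by blast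
  then show ?thesis using nice_pair_set_reduct[OF c(1,2)] by blast
qed

text \<open>The bound refutes the clause with 4 in \<open>nice_set_of_no_two_cut\<close>, so
  \<open>card A = 3\<close>.\<close>

lemma K33_of_no_two_cut:
  assumes no: "no_two_cut G"
    and le3: "\<And>A' B'. nice_pair_set G A B A' B' \<Longrightarrow> A' \<noteq> {} \<Longrightarrow> B' \<noteq> {} \<Longrightarrow> card A' \<le> 3 \<and> card B' \<le> 3"
  shows "isomorphic G (complete_bipartite 3 3)"
proof -
  obtain A' B' where N: "nice_pair_set G A B A' B'" "3 \<le> card A'" "3 \<le> card B'"
    "4 \<le> card A \<longrightarrow> 4 \<le> card A' \<or> 4 \<le> card B'"
    using nice_set_of_no_two_cut[OF no] by blast
  have "A' \<noteq> {}" "B' \<noteq> {}" using N(2,3) by auto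
  then have "card A' \<le> 3 \<and> card B' \<le> 3" using le3[OF N(1)] by blast
  then have "card A = 3" using N(4) card_A_ge by linarith
  then show ?thesis by (rule isomorphic_K33)
qed

end

text \<open>The bound passes to both outer pieces of a chain starting at a leaf cut, since their
  nice pairs are nice in \<open>G\<close>. The leaf has no two-edge cut and must be K33; the far
  piece is smaller and falls under the induction.\<close>

lemma in_class_T_of_nice_le_3:
  assumes "connected_cubic_bipartite G A B"
    and "\<And>A' B'. nice_pair_set G A B A' B' \<Longrightarrow> A' \<noteq> {} \<Longrightarrow> B' \<noteq> {} \<Longrightarrow> card A' \<le> 3 \<and> card B' \<le> 3"
  shows "in_class_T G"
  using assms
proof (induction "card (verts G)" arbitrary: G A B rule: less_induct)
  case less
  interpret connected_cubic_bipartite G A B by (rule less.prems(1))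
  note le3 = less.prems(2)
  show ?case
  proof (cases "no_two_cut G")
    case True
    then show ?thesis using K33_of_no_two_cut[OF True le3] in_class_T_K33 by blast
  next
    case False
    then obtain W x y x' y' where c: "two_cut G W x y x' y'" and xy: "{x, y} \<notin> edges G"
      and no: "no_two_cut (reduct G W x y)" by (rule leaf_two_cut)
    let ?K = "reduct G W x y"
    interpret H: connected_cubic_bipartite ?K "W \<inter> A" "W \<inter> B" by (rule reduct_connected[OF c xy])
    have K: "isomorphic ?K (complete_bipartite 3 3)"
      using H.K33_of_no_two_cut[OF no] le3 nice_pair_set_reduct[OF c xy] by blast
    obtain n u v where ch: "n \<ge> 1" "chain G W n u v" "u 0 = x" "v 0 = y" "{u n, v n} \<notin> edges G"
      using chain_exists[OF c] by metis
    let ?S = "verts G - strand W u v (n - 1)"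
    let ?T = "reduct G ?S (u n) (v n)"
    have e0: "{u 0, v 0} \<notin> edges G" using xy ch(3,4) by simp
    have n: "n - 1 < n" "Suc (n - 1) = n" using ch(1) by auto
    have "two_cut G (strand W u v (n - 1)) (u (n - 1)) (v (n - 1)) (u (Suc (n - 1))) (v (Suc (n - 1)))"
      using ch(2) n(1) unfolding chain_def by blast
    then have cut: "two_cut G ?S (u n) (v n) (u (n - 1)) (v (n - 1))"
      unfolding n(2) by (rule two_cut_compl)
    have T: "connected_cubic_bipartite ?T (?S \<inter> A) (?S \<inter> B)" by (rule reduct_connected[OF cut ch(5)])
    have "verts ?T \<subset> verts G" using two_cutD(5,6)[OF cut] by (auto simp: reduct_def)
    then have "card (verts ?T) < card (verts G)" using finite_verts by (rule psubset_card_mono[rotated])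
    moreover have "card A' \<le> 3 \<and> card B' \<le> 3"
      if "nice_pair_set ?T (?S \<inter> A) (?S \<inter> B) A' B'" "A' \<noteq> {}" "B' \<noteq> {}" for A' B'
      using le3[OF nice_pair_set_reduct[OF cut ch(5) that(1)] that(2,3)] .
    ultimately have "in_class_T ?T" using less.hyps[OF _ T] by blast
    moreover note chain_assembled[OF ch(1,2) e0 ch(5)]
    ultimately show ?thesis using in_class_T_assembled[of ?T n u v ?K] K ch(3,4) by simp
  qed
qed

section \<open>Transfer along isomorphisms\<close>

lemma (in cubic_bipartite) rename_cubic_bipartite:
  assumes f: "inj_on f (verts G)"
  shows "cubic_bipartite (rename f G) (f ` A) (f ` B)"
proof
  show "simple_graph (rename f G)" by (rule simple_rename[OF simple f])
  show "cubic (rename f G)"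
    unfolding cubic_def
  proof
    fix w assume "w \<in> verts (rename f G)"
    then obtain v where v: "v \<in> verts G" "w = f v" by (auto simp: rename_def)
    have "nbhd (rename f G) w = f ` nbhd G v"
    proof (intro equalityI subsetI)
      fix z assume "z \<in> nbhd (rename f G) w"
      then obtain e where e: "e \<in> edges G" "f ` e = {z, f v}" using v by (auto simp: nbhd_def rename_def)
      then obtain p q where pq: "e = {p, q}" using edge_obtain by metis
      have V: "p \<in> verts G" "q \<in> verts G" using edge_verts e(1) pq by blast+
      have "{f p, f q} = {z, f v}" using e(2) pq by simp
      then consider "f p = z" "f q = f v" | "f q = z" "f p = f v" by (auto simp: doubleton_eq_iff)
      then show "z \<in> f ` nbhd G v"
      proof cases
        case 1
        then have "q = v" using f V v(1) by (meson inj_onD)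
        then have "p \<in> nbhd G v" using e(1) pq by (simp add: nbhd_def)
        then show ?thesis using 1 by blast
      next
        case 2
        then have "p = v" using f V v(1) by (meson inj_onD)
        then have "q \<in> nbhd G v" using e(1) pq by (simp add: nbhd_def insert_commute)
        then show ?thesis using 2 by blast
      qed
    next
      fix z assume "z \<in> f ` nbhd G v"
      then obtain p where p: "{p, v} \<in> edges G" "z = f p" by (auto simp: nbhd_def)
      then have "f ` {p, v} \<in> (`) f ` edges G" by (intro imageI)
      then show "z \<in> nbhd (rename f G) w" using p(2) v(2) by (simp add: nbhd_def rename_def)
    qed
    moreover have "nbhd G v \<subseteq> verts G" using edge_verts by (auto simp: nbhd_def)
    then have "inj_on f (nbhd G v)" by (rule inj_on_subset[OF f])
    ultimately show "degree (rename f G) w = 3"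
      using card_nbhd[of v] v(1) verts_eq by (simp add: degree_def card_image)
  qed
  show "bipartition (rename f G) (f ` A) (f ` B)"
    unfolding bipartition_def
  proof (intro conjI ballI)
    show "f ` A \<inter> f ` B = {}"
      using inj_on_image_Int[OF f, of A B] disj verts_eq by auto
    show "f ` A \<union> f ` B = verts (rename f G)" using verts_eq by (simp add: rename_def image_Un)
    fix e assume "e \<in> edges (rename f G)"
    then obtain e' where e': "e' \<in> edges G" "e = f ` e'" by (auto simp: rename_def)
    obtain a b where "a \<in> A" "b \<in> B" "e' = {a, b}" using edge_obtain[OF e'(1)] by metis
    then show "\<exists>a\<in>f ` A. \<exists>b\<in>f ` B. e = {a, b}"
      using e'(2) by (intro bexI[of _ "f a"] bexI[of _ "f b"]) auto
  qed
qed

text \<open>In the form of \<open>nice_pair_iff_factor\<close>, the image of a factor is a factor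
  with the corresponding degrees.\<close>

lemma (in cubic_bipartite) nice_pair_rename:
  assumes f: "inj_on f (verts G)" and a: "a \<in> A" and b: "b \<in> B" and N: "nice_pair G a b"
  shows "nice_pair (rename f G) (f a) (f b)"
proof -
  interpret R: cubic_bipartite "rename f G" "f ` A" "f ` B" by (rule rename_cubic_bipartite[OF f])
  obtain F where F: "F \<subseteq> edges G" "\<And>v. v \<in> verts G \<Longrightarrow> fdeg F v = (if v = a \<or> v = b then 3 else 1)"
    using N nice_pair_iff_factor[OF a b] by auto
  have abV: "a \<in> verts G" "b \<in> verts G" using a b verts_eq by auto
  have "fdeg ((`) f ` F) w = (if w = f a \<or> w = f b then 3 else 1)" if wV: "w \<in> verts (rename f G)" for w
  proof -
    obtain v where v: "v \<in> verts G" "w = f v" using wV by (auto simp: rename_def)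
    have "{z. {z, w} \<in> (`) f ` F} = f ` {u. {u, v} \<in> F}"
    proof (intro equalityI subsetI)
      fix z assume "z \<in> {z. {z, w} \<in> (`) f ` F}"
      then obtain e where e: "e \<in> F" "f ` e = {z, f v}" using v by auto
      have eG: "e \<in> edges G" using e(1) F(1) by blast
      then obtain p q where pq: "e = {p, q}" using edge_obtain by metis
      have V: "p \<in> verts G" "q \<in> verts G" using edge_verts eG pq by blast+
      have "{f p, f q} = {z, f v}" using e(2) pq by simp
      then consider "f p = z" "f q = f v" | "f q = z" "f p = f v" by (auto simp: doubleton_eq_iff)
      then show "z \<in> f ` {u. {u, v} \<in> F}"
      proof cases
        case 1
        then have "q = v" using f V v(1) by (meson inj_onD)
        then show ?thesis using 1 e(1) pq by blast
      next
        case 2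
        then have "p = v" using f V v(1) by (meson inj_onD)
        then have "{q, v} \<in> F" using e(1) pq by (simp add: insert_commute)
        then show ?thesis using 2 by blast
      qed
    next
      fix z assume "z \<in> f ` {u. {u, v} \<in> F}"
      then obtain p where p: "{p, v} \<in> F" "z = f p" by blast
      then have "f ` {p, v} \<in> (`) f ` F" by (intro imageI)
      then show "z \<in> {z. {z, w} \<in> (`) f ` F}" using p(2) v(2) by simp
    qed
    moreover have "{u. {u, v} \<in> F} \<subseteq> verts G" using edge_verts F(1) by blast
    then have "inj_on f {u. {u, v} \<in> F}" by (rule inj_on_subset[OF f])
    ultimately have "fdeg ((`) f ` F) w = fdeg F v" by (simp add: fdeg_def card_image)
    moreover have "w = f a \<longleftrightarrow> v = a" "w = f b \<longleftrightarrow> v = b"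
      using inj_on_eq_iff[OF f] v abV by auto
    ultimately show ?thesis using F(2)[OF v(1)] by simp
  qed
  moreover have "(`) f ` F \<subseteq> edges (rename f G)" using F(1) by (auto simp: rename_def)
  ultimately show ?thesis
    using R.nice_pair_iff_factor[of "f a" "f b"] a b by blast
qed

lemma (in cubic_bipartite) card_nice_le_3:
  assumes T: "in_class_T G" and a: "a \<in> A"
  shows "card {b \<in> B. nice_pair G a b} \<le> 3"
proof -
  obtain H where H: "T_nat H" "isomorphic G H" using T by (auto simp: in_class_T_def)
  obtain f where f: "inj_on f (verts G)" "H = rename f G" using H(2) by (rule isomorphicE)
  interpret R: cubic_bipartite H "f ` A" "f ` B" unfolding f(2) by (rule rename_cubic_bipartite[OF f(1)])
  let ?N = "{b \<in> B. nice_pair G a b}" and ?M = "{b \<in> f ` B. nice_pair H (f a) b}"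
  have "f ` ?N \<subseteq> ?M" using nice_pair_rename[OF f(1) a] f(2) by auto
  then have "card (f ` ?N) \<le> card ?M" using R.finite_B by (intro card_mono) auto
  also have "\<dots> \<le> 3"
    using T_nat_nice_degree[OF H(1)] R.cubic_bipartite_axioms a unfolding nice_degree_le_3_def by blast
  also have "card (f ` ?N) = card ?N"
  proof (rule card_image)
    show "inj_on f ?N" using f(1) by (rule inj_on_subset) (use verts_eq in auto)
  qed
  finally show ?thesis .
qed

text \<open>The upper bound speaks of nonempty sets because an empty \<open>A'\<close> is vacuously
  nice to all of \<open>B\<close>, which may be large. Given elements of both sets, each set lies
  among the nice partners of a vertex of the other, and \<open>card_nice_le_3\<close> applies in
  \<open>G\<close> and in its swapped form.\<close>

theorem theorem4p1:
  fixes G :: "'a sgraph" and A B :: "'a set"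
  assumes "simple_graph G" and "connected_graph G" and "cubic G" and "bipartition G A B"
  shows "(\<exists>A' B'. nice_pair_set G A B A' B' \<and> card A' \<ge> 3 \<and> card B' \<ge> 3) \<and>
    ((\<forall>A' B'. nice_pair_set G A B A' B' \<and> A' \<noteq> {} \<and> B' \<noteq> {} \<longrightarrow> card A' \<le> 3 \<and> card B' \<le> 3)
      \<longleftrightarrow> in_class_T G)"
proof -
  interpret connected_cubic_bipartite G A B using assms by unfold_locales
  interpret S: cubic_bipartite G B A by (rule swap)
  have "card A' \<le> 3 \<and> card B' \<le> 3"
    if T: "in_class_T G" and N: "nice_pair_set G A B A' B'" and ne: "A' \<noteq> {}" "B' \<noteq> {}" for A' B'
  proof
    obtain a b where ab: "a \<in> A'" "b \<in> B'" using ne by blast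
    have sub: "A' \<subseteq> A" "B' \<subseteq> B" and nice: "\<And>a b. a \<in> A' \<Longrightarrow> b \<in> B' \<Longrightarrow> nice_pair G a b"
      using N by (auto simp: nice_pair_set_def)
    have "B' \<subseteq> {b \<in> B. nice_pair G a b}" using sub nice[OF ab(1)] by blast
    then have "card B' \<le> card {b \<in> B. nice_pair G a b}" using finite_B by (intro card_mono) auto
    then show "card B' \<le> 3" using card_nice_le_3[OF T, of a] ab sub by fastforce
    have "A' \<subseteq> {a \<in> A. nice_pair G b a}" using sub nice[OF _ ab(2)] nice_pair_commute[of G] by blast
    then have "card A' \<le> card {a \<in> A. nice_pair G b a}" using finite_A by (intro card_mono) auto
    then show "card A' \<le> 3" using S.card_nice_le_3[OF T, of b] ab sub by fastforce
  qed
  moreover have "in_class_T G"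
    if "\<forall>A' B'. nice_pair_set G A B A' B' \<and> A' \<noteq> {} \<and> B' \<noteq> {} \<longrightarrow> card A' \<le> 3 \<and> card B' \<le> 3"
    using in_class_T_of_nice_le_3[OF connected_cubic_bipartite_axioms] that by blast
  ultimately show ?thesis using nice_set_exists by blast
qed

end
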